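(* Let $\alpha,\beta\in\mathbb{R}$. Suppose there exists a twice continuously differentiable function $v\colon \mathbb{R}^n\to \mathbb{R}$ satisfying $$\begin{cases}\mathcal{L}v(x)\leq \alpha v(x)+\beta, & \forall x\in \mathcal{X}\setminus \mathcal{X}_s,\\ 0\leq \alpha v(x)+\beta, & \forall x\in \partial \mathcal{X}\cup \partial \mathcal{X}_s,\\ v(x)\geq 1_{\partial \mathcal{X}_s}(x), & \forall x\in \overline{\mathcal{X}\setminus \mathcal{X}_s}.\end{cases}$$ Then, for every $x_0\in \mathcal{X}\setminus \mathcal{X}_s$, $$\mathbb{P}_{x_0}^{[0,T]}\leq \begin{cases} v(x_0)+\beta T, & \text{if } \alpha=0,\\ e^{\alpha T}v(x_0)+\frac{\beta}{\alpha}(e^{\alpha T}-1), & \text{if } \alpha\neq 0.\end{cases}$$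
   Context: Let $b\colon\mathbb{R}^n\to\mathbb{R}^n$ and $\sigma\colon\mathbb{R}^n\to\mathbb{R}^{n\times k}$ be locally Lipschitz continuous, and let $W$ be a standard $k$-dimensional Wiener process on a probability space $(\Omega,\mathbb{P})$. For $x_0\in\mathbb{R}^n$, the SDE $dX=b(X)\,dt+\sigma(X)\,dW$ with initial state $x_0$ has a unique maximal local strong solution $X_{x_0}^{w}(t)$, $t\in[0,T^{x_0}(w))$, with continuous sample paths, where $T^{x_0}(w)\in(0,\infty]$. Let $\mathcal{X}\subseteq\mathbb{R}^n$ be open and bounded, $\mathcal{X}_s\subseteq\mathcal{X}$ a closed set, and $0<T<\infty$. An overline denotes closure, $\partial$ denotes topological boundary, and $1_A$ is the indicator function of $A$. For $x_0\in\mathcal{X}\setminus\mathcal{X}_s$ define $$\mathbb{P}_{x_0}^{[0,T]}:=\mathbb{P}\big(\{w\in\Omega \mid \exists t\in[0,T].\ X_{x_0}^{w}(t)\in\mathcal{X}_s\ \wedge\ \forall\tau\in[0,t).\ X_{x_0}^{w}(\tau)\in\mathcal{X}\}\big),$$ where the path is required to be defined at the times involved. For a twice continuously differentiable $v\colon\mathbb{R}^n\to\mathbb{R}$, $$\mathcal{L}v(x)=\frac{\partial v(x)}{\partial x}b(x)+\frac12\mathrm{tr}\Big(\sigma(x)^{\top}\frac{\partial^2 v(x)}{\partial x^2}\sigma(x)\Big).$$ *)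

theory Defs
  imports "HOL-Probability.Probability"
begin

section \<open>Differential operators\<close>

definition gradient :: "(real ^ 'n \<Rightarrow> real) \<Rightarrow> real ^ 'n \<Rightarrow> real ^ 'n" where
  "gradient v x = (\<chi> i. frechet_derivative v (at x) (axis i 1))"

definition hessian :: "(real ^ 'n \<Rightarrow> real) \<Rightarrow> real ^ 'n \<Rightarrow> real ^ 'n ^ 'n" where
  "hessian v x = matrix (frechet_derivative (gradient v) (at x))"

text \<open>Continuity of the gradient is implied by its differentiability.\<close>

definition twice_continuously_differentiable :: "(real ^ 'n \<Rightarrow> real) \<Rightarrow> bool" where
  "twice_continuously_differentiable v \<longleftrightarrow>
     (\<forall>x. v differentiable (at x)) \<and>
     (\<forall>x. gradient v differentiable (at x)) \<and>
     continuous_on UNIV (hessian v)"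

definition generator ::
  "(real ^ 'n \<Rightarrow> real ^ 'n) \<Rightarrow> (real ^ 'n \<Rightarrow> real ^ 'k ^ 'n) \<Rightarrow>
   (real ^ 'n \<Rightarrow> real) \<Rightarrow> real ^ 'n \<Rightarrow> real" where
  "generator b \<sigma> v x =
     gradient v x \<bullet> b x + 1 / 2 * trace (transpose (\<sigma> x) ** hessian v x ** \<sigma> x)"

definition locally_lipschitz :: "('a::metric_space \<Rightarrow> 'b::metric_space) \<Rightarrow> bool" where
  "locally_lipschitz f \<longleftrightarrow> (\<forall>x. \<exists>r>0. \<exists>L. L-lipschitz_on (cball x r) f)"


section \<open>Wiener process and its augmented filtration\<close>

text \<open>Processes are indexed by \<^typ>\<open>real\<close>; only times \<open>\<ge> 0\<close> are ever constrained.\<close>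

definition standard_wiener_process :: "'w measure \<Rightarrow> (real \<Rightarrow> 'w \<Rightarrow> real ^ 'k) \<Rightarrow> bool" where
  "standard_wiener_process M W \<longleftrightarrow>
     (\<forall>t\<ge>0. W t \<in> borel_measurable M) \<and>
     (AE w in M. W 0 w = 0) \<and>
     (AE w in M. continuous_on {0..} (\<lambda>t. W t w)) \<and>
     (\<forall>(t :: nat \<Rightarrow> real) m. 0 \<le> t 0 \<and> mono t \<longrightarrow>
        prob_space.indep_vars M (\<lambda>_. borel) (\<lambda>i w. W (t (Suc i)) w - W (t i) w) {..<m}) \<and>
     (\<forall>s t. 0 \<le> s \<and> s < t \<longrightarrow>
        prob_space.indep_vars M (\<lambda>_. borel) (\<lambda>i w. (W t w - W s w) $ i) UNIV \<and>
        (\<forall>i. distributed M lborel (\<lambda>w. (W t w - W s w) $ i) (normal_density 0 (sqrt (t - s)))))"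

definition wiener_filtration ::
  "'w measure \<Rightarrow> (real \<Rightarrow> 'w \<Rightarrow> 'a::topological_space) \<Rightarrow> real \<Rightarrow> 'w measure" where
  "wiener_filtration M W t =
     sigma (space M) ({W s -` A \<inter> space M | s A. s \<in> {0..t} \<and> A \<in> sets borel} \<union> null_sets M)"


section \<open>The It\^o integral\<close>

definition progressively_measurable ::
  "(real \<Rightarrow> 'w measure) \<Rightarrow> (real \<Rightarrow> 'w \<Rightarrow> 'a::topological_space) \<Rightarrow> bool" where
  "progressively_measurable F H \<longleftrightarrow>
     (\<forall>t\<ge>0. (\<lambda>(s, w). H s w) \<in> borel_measurable (restrict_space borel {0..t} \<Otimes>\<^sub>M F t))"

text \<open>A triple \<open>(m, t, \<xi>)\<close> encodes the simple process
  \<open>\<Sum>i<m. \<xi>\<^sub>i 1\<^bsub>(t\<^sub>i, t\<^sub>i\<^sub>+\<^sub>1]\<^esub>\<close>.\<close>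

definition simple_process ::
  "'w measure \<Rightarrow> (real \<Rightarrow> 'w measure) \<Rightarrow> nat \<Rightarrow> (nat \<Rightarrow> real) \<Rightarrow>
   (nat \<Rightarrow> 'w \<Rightarrow> 'a::real_normed_vector) \<Rightarrow> bool" where
  "simple_process M F m t \<xi> \<longleftrightarrow>
     0 \<le> t 0 \<and> (\<forall>i<m. t i \<le> t (Suc i)) \<and>
     (\<forall>i<m. \<xi> i \<in> borel_measurable (F (t i))) \<and>
     (\<exists>B. \<forall>i<m. \<forall>w\<in>space M. norm (\<xi> i w) \<le> B)"

definition simple_process_value ::
  "nat \<Rightarrow> (nat \<Rightarrow> real) \<Rightarrow> (nat \<Rightarrow> 'w \<Rightarrow> 'a::real_vector) \<Rightarrow> real \<Rightarrow> 'w \<Rightarrow> 'a" where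
  "simple_process_value m t \<xi> s w = (\<Sum>i<m. indicator {t i<..t (Suc i)} s *\<^sub>R \<xi> i w)"

definition simple_process_integral ::
  "(real \<Rightarrow> 'w \<Rightarrow> real ^ 'k) \<Rightarrow> nat \<Rightarrow> (nat \<Rightarrow> real) \<Rightarrow> (nat \<Rightarrow> 'w \<Rightarrow> real ^ 'k ^ 'n) \<Rightarrow>
   real \<Rightarrow> 'w \<Rightarrow> real ^ 'n" where
  "simple_process_integral W m t \<xi> s w =
     (\<Sum>i<m. \<xi> i w *v (W (min (t (Suc i)) s) w - W (min (t i) s) w))"

text \<open>
  \<open>I\<close> is (a continuous version of) the process \<open>t \<mapsto> \<integral>\<^sub>0\<^sup>t H dW\<close>: there are simple processes \<open>S\<^sub>j\<close>
  such that for each \<open>t \<ge> 0\<close>, both \<open>\<integral>\<^sub>0\<^sup>t \<parallel>S\<^sub>j - H\<parallel>\<^sup>2 ds \<longrightarrow> 0\<close> and \<open>\<integral>\<^sub>0\<^sup>t S\<^sub>j dW \<longrightarrow> I\<^sub>t\<close> in probability.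
  The norm on matrices is the Frobenius norm.  The measurability conditions on \<open>H\<close> and \<open>I\<close> make the
  events whose probabilities occur below measurable.\<close>

definition has_ito_integral ::
  "'w measure \<Rightarrow> (real \<Rightarrow> 'w measure) \<Rightarrow> (real \<Rightarrow> 'w \<Rightarrow> real ^ 'k) \<Rightarrow>
   (real \<Rightarrow> 'w \<Rightarrow> real ^ 'k ^ 'n) \<Rightarrow> (real \<Rightarrow> 'w \<Rightarrow> real ^ 'n) \<Rightarrow> bool" where
  "has_ito_integral M F W H I \<longleftrightarrow>
     progressively_measurable F H \<and>
     (\<forall>t\<ge>0. AE w in M. (\<integral>\<^sup>+s\<in>{0..t}. ennreal ((norm (H s w))\<^sup>2) \<partial>lborel) < \<infinity>) \<and>
     (\<forall>t\<ge>0. I t \<in> borel_measurable (F t)) \<and>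
     (\<forall>w\<in>space M. continuous_on {0..} (\<lambda>t. I t w)) \<and>
     (\<exists>m t \<xi>.
        (\<forall>j::nat. simple_process M F (m j) (t j) (\<xi> j)) \<and>
        (\<forall>u\<ge>0. \<forall>\<epsilon>>0.
           (\<lambda>j. measure M {w \<in> space M.
              (\<integral>\<^sup>+s\<in>{0..u}. ennreal ((norm (simple_process_value (m j) (t j) (\<xi> j) s w - H s w))\<^sup>2)
                 \<partial>lborel) > ennreal \<epsilon>}) \<longlonglongrightarrow> 0 \<and>
           (\<lambda>j. measure M {w \<in> space M.
              norm (simple_process_integral W (m j) (t j) (\<xi> j) u w - I u w) > \<epsilon>}) \<longlonglongrightarrow> 0))"


section \<open>Maximal local strong solutions\<close>

text \<open>
  \<open>X t w\<close> is meaningful only for \<open>0 \<le> t < life w\<close>; its other values are irrelevant.  Being strong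
  means being adapted to the augmented filtration of the driving Wiener process \<open>W\<close>.  The
  equation is required up to each of a sequence of stopping times announcing \<open>life\<close>.  The
  restriction to finite stopping times is harmless, as \<open>\<rho> j\<close> can be replaced by \<open>min (\<rho> j) j\<close>.\<close>

definition local_strong_solution ::
  "'w measure \<Rightarrow> (real \<Rightarrow> 'w \<Rightarrow> real ^ 'k) \<Rightarrow> (real ^ 'n \<Rightarrow> real ^ 'n) \<Rightarrow>
   (real ^ 'n \<Rightarrow> real ^ 'k ^ 'n) \<Rightarrow> real ^ 'n \<Rightarrow>
   (real \<Rightarrow> 'w \<Rightarrow> real ^ 'n) \<Rightarrow> ('w \<Rightarrow> ereal) \<Rightarrow> bool" where
  "local_strong_solution M W b \<sigma> x0 X life \<longleftrightarrow>
     (let F = wiener_filtration M W in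
     (\<forall>w\<in>space M. 0 < life w) \<and>
     (\<forall>t\<ge>0. {w \<in> space M. life w \<le> ereal t} \<in> sets (F t)) \<and>
     (\<forall>w\<in>space M. X 0 w = x0) \<and>
     (\<forall>w\<in>space M. continuous_on {t. 0 \<le> t \<and> ereal t < life w} (\<lambda>t. X t w)) \<and>
     (\<forall>t\<ge>0. (\<lambda>w. if ereal t < life w then X t w else 0) \<in> borel_measurable (F t)) \<and>
     (\<exists>\<rho> :: nat \<Rightarrow> 'w \<Rightarrow> real.
        (\<forall>j. stopping_time F (\<rho> j)) \<and>
        (\<forall>j. \<forall>w\<in>space M. 0 \<le> \<rho> j w \<and> ereal (\<rho> j w) < life w) \<and>
        (AE w in M. incseq (\<lambda>j. \<rho> j w) \<and> (\<lambda>j. ereal (\<rho> j w)) \<longlonglongrightarrow> life w) \<and>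
        (\<forall>j. \<exists>I. has_ito_integral M F W (\<lambda>s w. if s \<le> \<rho> j w then \<sigma> (X s w) else 0) I \<and>
           (AE w in M. \<forall>t\<ge>0.
              X (min t (\<rho> j w)) w =
                x0 + integral {0..min t (\<rho> j w)} (\<lambda>s. b (X s w)) + I t w))))"

text \<open>Maximality is explosion: \<open>limsup \<parallel>X\<^sub>t\<parallel> = \<infinity>\<close> as \<open>t\<close> increases to a finite lifetime.\<close>

definition maximal_local_strong_solution ::
  "'w measure \<Rightarrow> (real \<Rightarrow> 'w \<Rightarrow> real ^ 'k) \<Rightarrow> (real ^ 'n \<Rightarrow> real ^ 'n) \<Rightarrow>
   (real ^ 'n \<Rightarrow> real ^ 'k ^ 'n) \<Rightarrow> real ^ 'n \<Rightarrow>
   (real \<Rightarrow> 'w \<Rightarrow> real ^ 'n) \<Rightarrow> ('w \<Rightarrow> ereal) \<Rightarrow> bool" where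
  "maximal_local_strong_solution M W b \<sigma> x0 X life \<longleftrightarrow>
     local_strong_solution M W b \<sigma> x0 X life \<and>
     (AE w in M. life w < \<infinity> \<longrightarrow>
        Limsup (at_left (real_of_ereal (life w))) (\<lambda>t. ereal (norm (X t w))) = \<infinity>)"


section \<open>Reach-avoid probability\<close>

definition reach_avoid_probability ::
  "'w measure \<Rightarrow> (real \<Rightarrow> 'w \<Rightarrow> 'a) \<Rightarrow> ('w \<Rightarrow> ereal) \<Rightarrow> 'a set \<Rightarrow> 'a set \<Rightarrow> real \<Rightarrow> real" where
  "reach_avoid_probability M X life D S T =
     measure M {w \<in> space M.
       \<exists>t\<in>{0..T}. ereal t < life w \<and> X t w \<in> S \<and> (\<forall>\<tau>\<in>{0..<t}. X \<tau> w \<in> D)}"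

end

theory Submission
  imports Defs
begin

text \<open>
  Put \<open>U = D - S\<close>, let \<open>\<theta>\<close> be the first exit time of \<open>X\<close> from \<open>U\<close>, cut off at \<open>T\<close> and at a time announcing
  the lifetime, and let \<open>Y\<^sub>t = X\<^bsub>min t \<theta>\<^esub>\<close>.  The function \<open>u t = E v(Y\<^sub>t)\<close> satisfies
  \<open>u t - u s \<le> (t - s) (\<alpha> u s + \<beta> + o(1))\<close>, uniformly in \<open>s\<close>: before \<open>\<theta>\<close> this is the bound on the
  generator, after \<open>\<theta>\<close> it is \<open>0 \<le> \<alpha> v + \<beta>\<close> on the boundary.  Gronwall's inequality bounds \<open>u T\<close>, and
  \<open>v(Y\<^sub>T)\<close> is at least the indicator of the reach-avoid event, except where the path was cut off inside
  \<open>U\<close> by the announcing time; since \<open>D\<close> is bounded and lifetimes end by explosion, the probability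
  of this exception tends to \<open>0\<close>.

  The estimate on \<open>u t - u s\<close> needs neither Ito's formula nor the Ito isometry: a second order
  Taylor expansion of \<open>v\<close> suffices once the first, second and fourth moments of the increments of the
  stopped stochastic integral are known.  They are read off from
  \<open>E[\<zeta> exp(i \<mu> x + \<mu>\<^sup>2 q / 2)] = E \<zeta>\<close>, where \<open>x\<close> is the increment, \<open>q\<close> its quadratic variation and \<open>\<zeta>\<close>
  is determined by the past.  This identity involves only bounded random variables, so it passes
  from simple processes to limits in probability.
\<close>

section \<open>Increments of the Wiener process\<close>

text \<open>A stochastic integral is given only as a limit in probability of integrals of simple
  processes, so none of its moments is available beforehand. Exponentials pass to such limits as
  long as they are bounded, and \<open>exp (q / 2)\<close> is bounded only if \<open>q\<close> is.
  Neither the approximating simple processes nor the integrand beyond the stopping time obey a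
  common bound. Hence \<open>q\<close> is capped at a constant \<open>c\<close>, at the price of an
  error carried by the event that \<open>q\<close> comes close to \<open>c\<close>. For a path
  stopped in a bounded set, \<open>q\<close> stays below a suitable \<open>c\<close> by at least 1
  and the error vanishes.

  The Taylor error is brought to the form: a small multiple of the squared increment plus a constant
  times its fourth power. Over a step of length \<open>h\<close> these have expectations of order
  \<open>h\<close> and \<open>h^2\<close>, so after \<open>T / h\<close> steps only the small
  multiple survives. The derivatives are taken at the left end of the step because they are then
  known at that time and can serve as the weight in the moment identities. The step estimate is
  required between any two times, not only from time 0, which makes Gronwall's inequality exact for
  both signs of \<alpha>.\<close>

lemma sets_wiener_filtration:
  "sets (wiener_filtration M W t) = sigma_sets (space M)
     ({W s -` A \<inter> space M | s A. s \<in> {0..t} \<and> A \<in> sets borel} \<union> null_sets M)"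
  unfolding wiener_filtration_def
  by (rule sets_measure_of) (use sets.sets_into_space in \<open>auto simp: null_sets_def\<close>)

lemma space_wiener_filtration [simp]: "space (wiener_filtration M W t) = space M"
  unfolding wiener_filtration_def
  by (rule space_measure_of) (use sets.sets_into_space in \<open>auto simp: null_sets_def\<close>)

locale wiener = prob_space M for M :: "'w measure" +
  fixes W :: "real \<Rightarrow> 'w \<Rightarrow> real ^ 'k"
  assumes wiener: "standard_wiener_process M W"
begin

abbreviation "F \<equiv> wiener_filtration M W"

lemma W_measurable: "0 \<le> t \<Longrightarrow> W t \<in> borel_measurable M"
  using wiener by (auto simp: standard_wiener_process_def)

lemma sets_F_subset: "sets (F t) \<subseteq> sets M"
  unfolding sets_wiener_filtration
  by (rule sets.sigma_sets_subset) (auto intro: measurable_sets[OF W_measurable])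

lemma measurable_F_imp: "f \<in> measurable (F t) N \<Longrightarrow> f \<in> measurable M N"
  by (rule measurable_from_subalg[of M "F t"]) (auto simp: subalgebra_def sets_F_subset)

lemma sets_F_mono: "s \<le> t \<Longrightarrow> sets (F s) \<subseteq> sets (F t)"
  unfolding sets_wiener_filtration
  by (rule sigma_sets_mono') (use order_trans in \<open>fastforce\<close>)

lemma measurable_F_mono: "f \<in> measurable (F s) N \<Longrightarrow> s \<le> t \<Longrightarrow> f \<in> measurable (F t) N"
  by (rule measurable_from_subalg[of "F t" "F s"]) (auto simp: subalgebra_def sets_F_mono)

lemma W_adapted: "0 \<le> s \<Longrightarrow> s \<le> t \<Longrightarrow> W s \<in> borel_measurable (F t)"
  by (rule measurableI) (auto simp: sets_wiener_filtration intro!: sigma_sets.Basic)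

text \<open>Insert \<open>0\<close> and \<open>s\<close> into the grid \<open>J\<close> and append
  \<open>t\<close>. Each \<open>W r - W 0\<close> is then a sum of initial increments along the
  sorted grid, while \<open>W t - W s\<close> is the last increment, so independence of these two
  blocks suffices. Values are measured from \<open>W 0\<close> because \<open>W 0 = 0\<close> holds
  only almost surely.\<close>

lemma indep_grid_increment:
  assumes J: "finite J" "J \<subseteq> {0..s}" and st: "0 \<le> s" "s < t"
    and A: "\<And>r. A r \<in> sets borel" and C: "C \<in> sets borel"
  shows "prob ({w\<in>space M. \<forall>r\<in>J. W r w - W 0 w \<in> A r} \<inter> {w\<in>space M. W t w - W s w \<in> C}) =
    prob {w\<in>space M. \<forall>r\<in>J. W r w - W 0 w \<in> A r} * prob {w\<in>space M. W t w - W s w \<in> C}"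
proof -
  define J' where "J' = insert 0 (insert s J)"
  have J': "finite J'" "J' \<subseteq> {0..s}" using J st by (auto simp: J'_def)
  define xs where "xs = sorted_list_of_set J'"
  have xs: "set xs = J'" "sorted xs" "distinct xs" using J' by (auto simp: xs_def)
  define n where "n = length xs - 1"
  have len: "length xs = Suc n" using xs(1) by (cases xs) (auto simp: n_def J'_def)
  \<comment> \<open>After the grid the sequence stays at \<open>t\<close>: the definition of a
    Wiener process asks for a monotone sequence indexed by all naturals, and increment number
    \<open>n\<close> then is the one from \<open>s\<close> to \<open>t\<close>.\<close>
  define \<tau> where "\<tau> i = (if i \<le> n then xs ! i else t)" for i
  have xs_le: "xs ! i \<in> {0..s}" if "i \<le> n" for i
    using that len xs(1) J'(2) nth_mem[of i xs] by auto
  have mono: "mono \<tau>"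
  proof (rule monoI)
    fix i j :: nat assume "i \<le> j"
    then show "\<tau> i \<le> \<tau> j"
      using xs_le[of i] st sorted_nth_mono[OF xs(2), of i j] len by (auto simp: \<tau>_def)
  qed
  have tau0: "\<tau> 0 = 0"
  proof -
    obtain i where i: "i < length xs" "xs ! i = 0"
      using xs(1) by (metis J'_def in_set_conv_nth insertI1)
    have "xs ! 0 \<le> xs ! i" using i len by (intro sorted_nth_mono[OF xs(2)]) auto
    then show ?thesis using xs_le[of 0] i by (auto simp: \<tau>_def)
  qed
  have taun: "\<tau> n = s"
  proof -
    obtain i where i: "i < length xs" "xs ! i = s"
      using xs(1) by (metis J'_def in_set_conv_nth insertI1 insertI2)
    have "xs ! i \<le> xs ! n" using i len by (intro sorted_nth_mono[OF xs(2)]) auto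
    then show ?thesis using xs_le[of n] i by (auto simp: \<tau>_def)
  qed
  have tauSn: "\<tau> (Suc n) = t" by (simp add: \<tau>_def)
  define X where "X i w = W (\<tau> (Suc i)) w - W (\<tau> i) w" for i w
  have ind: "indep_vars (\<lambda>_. borel) X {..<Suc n}"
    unfolding X_def using wiener tau0 mono by (auto simp: standard_wiener_process_def)
  have ind2: "indep_var (PiM {..<n} (\<lambda>_. borel)) (\<lambda>w. restrict (\<lambda>i. X i w) {..<n})
     (PiM {n} (\<lambda>_. borel)) (\<lambda>w. restrict (\<lambda>i. X i w) {n})"
    by (rule indep_var_restrict[OF ind]) auto
  have "\<exists>i\<le>n. r = xs ! i" if "r \<in> J" for r
    using that xs(1) len by (metis J'_def in_set_conv_nth insertI2 less_Suc_eq_le)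
  then obtain k where k: "\<And>r. r \<in> J \<Longrightarrow> k r \<le> n" "\<And>r. r \<in> J \<Longrightarrow> r = xs ! k r" by metis
  let ?P = "{f\<in>space (PiM {..<n} (\<lambda>_. borel)). \<forall>r\<in>J. (\<Sum>l<k r. f l) \<in> A r}"
  let ?Q = "{f\<in>space (PiM {n} (\<lambda>_. borel)). f n \<in> C}"
  have P: "?P \<in> sets (PiM {..<n} (\<lambda>_. borel :: (real^'k) measure))"
  proof -
    have "(\<lambda>f. \<Sum>l<k r. f l) \<in> borel_measurable (PiM {..<n} (\<lambda>_. borel :: (real^'k) measure))" if "r \<in> J" for r
      using k(1)[OF that] by (intro borel_measurable_sum measurable_component_singleton) auto
    then show ?thesis using A J(1) by measurable
  qed
  have Q: "?Q \<in> sets (PiM {n} (\<lambda>_. borel :: (real^'k) measure))"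
    using C by measurable
  have tel: "(\<Sum>l<j. X l w) = W (\<tau> j) w - W 0 w" for j w
    unfolding X_def using tau0 by (simp add: sum_lessThan_telescope[of "\<lambda>i. W (\<tau> i) w"])
  have Wr: "(\<Sum>l<k r. X l w) = W r w - W 0 w" if "r \<in> J" for r w
    using k[OF that] by (simp add: tel \<tau>_def)
  have Xn: "X n w = W t w - W s w" for w by (simp add: X_def taun tauSn)
  have e1: "(\<lambda>w. restrict (\<lambda>i. X i w) {..<n}) -` ?P \<inter> space M = {w\<in>space M. \<forall>r\<in>J. W r w - W 0 w \<in> A r}"
  proof -
    have "(\<Sum>l<k r. restrict (\<lambda>i. X i w) {..<n} l) = W r w - W 0 w" if "r \<in> J" for r w
      using Wr[OF that, of w] k(1)[OF that] by (subst sum.cong[OF refl, of _ _ "\<lambda>i. X i w"]) auto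
    then show ?thesis by (auto simp: space_PiM PiE_def)
  qed
  have e2: "(\<lambda>w. restrict (\<lambda>i. X i w) {n}) -` ?Q \<inter> space M = {w\<in>space M. W t w - W s w \<in> C}"
    by (auto simp: space_PiM PiE_def Xn)
  show ?thesis
    using indep_varD[OF ind2 P Q] unfolding e1[symmetric] e2[symmetric]
    by (simp add: mem_Times_iff vimage_def Int_def conj_ac cong: conj_cong)
qed

lemma AE_W0: "AE w in M. W 0 w = 0"
  using wiener by (auto simp: standard_wiener_process_def)

text \<open>A pi-system argument carries independence from finite grids to the augmented filtration.
  Describing the members of \<open>G\<close> only up to null sets lets \<open>G\<close> contain the
  null sets adjoined to the filtration, and also absorbs the exceptional set of
  \<open>W 0 = 0\<close>.\<close>

lemma indep_set_F_increment:
  assumes st: "0 \<le> s" "s < t"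
  shows "indep_set (sets (F s))
    (sigma_sets (space M) {(\<lambda>w. W t w - W s w) -` C \<inter> space M | C. C \<in> sets borel})"
proof -
  have meas: "{w\<in>space M. \<forall>r\<in>J. W r w - W 0 w \<in> A r} \<in> sets M"
    if "finite J" "J \<subseteq> {0..s}" "\<forall>r. A r \<in> sets borel" for J A
  proof -
    have "{w\<in>space M. W r w - W 0 w \<in> A r} \<in> sets M" if "r \<in> J" for r
    proof -
      have "(\<lambda>w. W r w - W 0 w) \<in> borel_measurable M"
        using that \<open>J \<subseteq> {0..s}\<close> by (intro borel_measurable_diff W_measurable) auto
      from measurable_sets[OF this, of "A r"] show ?thesis using \<open>\<forall>r. A r \<in> sets borel\<close>
        by (simp add: vimage_def Int_def conj_commute)
    qed
    then show ?thesis using \<open>finite J\<close> by (rule sets.sets_Collect_finite_All)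
  qed
  define G where "G = {B\<in>sets M. \<exists>J A. finite J \<and> J \<subseteq> {0..s} \<and> (\<forall>r. A r \<in> sets borel) \<and>
      (AE w in M. w \<in> B \<longleftrightarrow> (\<forall>r\<in>J. W r w - W 0 w \<in> A r))}"
  let ?H = "{(\<lambda>w. W t w - W s w) -` C \<inter> space M | C. C \<in> sets borel}"
  have H: "?H \<subseteq> sets M" using st by (auto intro!: measurable_sets[OF borel_measurable_diff] W_measurable)
  have ind: "indep_set G ?H"
  proof (rule indep_setI)
    fix a b assume "a \<in> G" "b \<in> ?H"
    then obtain J A C where *: "finite J" "J \<subseteq> {0..s}" "\<forall>r. A r \<in> sets borel"
      "AE w in M. w \<in> a \<longleftrightarrow> (\<forall>r\<in>J. W r w - W 0 w \<in> A r)" and C: "C \<in> sets borel"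
      and b: "b = (\<lambda>w. W t w - W s w) -` C \<inter> space M" and a: "a \<in> sets M" by (auto simp: G_def)
    let ?a = "{w\<in>space M. \<forall>r\<in>J. W r w - W 0 w \<in> A r}"
    have b': "b = {w\<in>space M. W t w - W s w \<in> C}" using b by auto
    have bs: "b \<in> sets M" using \<open>b \<in> ?H\<close> H by auto
    have "prob a = prob ?a"
      using a meas[OF *(1,2,3)] *(4) by (intro finite_measure_eq_AE) auto
    moreover have "prob (a \<inter> b) = prob (?a \<inter> b)"
      using a meas[OF *(1,2,3)] *(4) bs by (intro finite_measure_eq_AE) auto
    ultimately show "prob (a \<inter> b) = prob a * prob b"
      using indep_grid_increment[OF *(1,2) st _ C, of A] *(3) b' by auto
  qed (use H in \<open>auto simp: G_def\<close>)
  have stG: "Int_stable G"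
  proof (rule Int_stableI)
    fix a b assume "a \<in> G" "b \<in> G"
    then obtain J A K B where *: "finite J" "J \<subseteq> {0..s}" "\<forall>r. A r \<in> sets borel"
      "AE w in M. w \<in> a \<longleftrightarrow> (\<forall>r\<in>J. W r w - W 0 w \<in> A r)"
      and **: "finite K" "K \<subseteq> {0..s}" "\<forall>r. B r \<in> sets borel"
      "AE w in M. w \<in> b \<longleftrightarrow> (\<forall>r\<in>K. W r w - W 0 w \<in> B r)" and ab: "a \<in> sets M" "b \<in> sets M"
      by (auto simp: G_def)
    \<comment> \<open>A time that belongs to only one of the two grids receives the trivial
      condition \<open>UNIV\<close> from the other.\<close>
    let ?A = "\<lambda>r. (if r \<in> J then A r else UNIV) \<inter> (if r \<in> K then B r else UNIV)"
    have "AE w in M. w \<in> a \<inter> b \<longleftrightarrow> (\<forall>r\<in>J \<union> K. W r w - W 0 w \<in> ?A r)"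
      using *(4) **(4) by eventually_elim (auto split: if_splits)
    moreover have "\<forall>r. ?A r \<in> sets borel" using *(3) **(3) by auto
    moreover have "finite (J \<union> K)" "J \<union> K \<subseteq> {0..s}" using * ** by auto
    ultimately show "a \<inter> b \<in> G" unfolding G_def using ab
      by (intro CollectI conjI exI[of _ "J \<union> K"] exI[of _ ?A]) auto
  qed
  have stH: "Int_stable ?H"
  proof (rule Int_stableI)
    fix a b assume "a \<in> ?H" "b \<in> ?H"
    then obtain C D where "C \<in> sets borel" "D \<in> sets borel" "a = (\<lambda>w. W t w - W s w) -` C \<inter> space M"
      "b = (\<lambda>w. W t w - W s w) -` D \<inter> space M" by auto
    then have "a \<inter> b = (\<lambda>w. W t w - W s w) -` (C \<inter> D) \<inter> space M" "C \<inter> D \<in> sets borel" by auto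
    then show "a \<inter> b \<in> ?H" by blast
  qed
  have sub: "sets (F s) \<subseteq> sigma_sets (space M) G"
    unfolding sets_wiener_filtration
  proof (rule sigma_sets_mono', safe)
    fix r A assume r: "r \<in> {0..s}" "A \<in> sets (borel :: (real^'k) measure)"
    have "AE w in M. w \<in> W r -` A \<inter> space M \<longleftrightarrow> (\<forall>r'\<in>{r}. W r' w - W 0 w \<in> A)"
      using AE_W0 AE_space by eventually_elim auto
    then show "W r -` A \<inter> space M \<in> G" unfolding G_def
      using r by (auto intro!: measurable_sets[OF W_measurable] exI[of _ "{r}"] exI[of _ "\<lambda>_. A"])
  next
    fix B assume B: "B \<in> null_sets M"
    \<comment> \<open>A null set is almost surely empty, so an unsatisfiable condition at time
      \<open>0\<close> represents it.\<close>
    have "AE w in M. w \<in> B \<longleftrightarrow> (\<forall>r\<in>{0}. W r w - W 0 w \<in> {})"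
      using AE_not_in[OF B] by eventually_elim auto
    then show "B \<in> G" unfolding G_def
      using B st by (auto intro!: exI[of _ "{0}"] exI[of _ "\<lambda>_. {}"])
  qed
  have "indep_set (sigma_sets (space M) G) (sigma_sets (space M) ?H)"
    by (rule indep_set_sigma_sets[OF ind stG stH])
  then show ?thesis
    unfolding indep_set_def
    by (rule indep_sets_mono_sets) (use sub in \<open>auto split: bool.split\<close>)
qed

lemma indep_var_F_increment:
  assumes st: "0 \<le> s" "s < t" and Z: "Z \<in> measurable (F s) N" and g: "g \<in> measurable borel N'"
  shows "indep_var N Z N' (\<lambda>w. g (W t w - W s w))"
  unfolding indep_var_eq
proof (intro conjI)
  show "random_variable N Z" using Z by (rule measurable_F_imp)
  show "random_variable N' (\<lambda>w. g (W t w - W s w))"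
    using st by (intro measurable_compose[OF _ g] borel_measurable_diff W_measurable) auto
  have *: "(\<lambda>w. g (W t w - W s w)) -` A \<inter> space M = (\<lambda>w. W t w - W s w) -` (g -` A) \<inter> space M" for A
    by auto
  have "sigma_sets (space M) {(\<lambda>w. g (W t w - W s w)) -` A \<inter> space M |A. A \<in> sets N'} \<subseteq>
    sigma_sets (space M) {(\<lambda>w. W t w - W s w) -` A \<inter> space M |A. A \<in> sets borel}"
    unfolding * using measurable_sets_borel[OF g] by (intro sigma_sets_mono') blast
  moreover have "sigma_sets (space M) {Z -` A \<inter> space M |A. A \<in> sets N} \<subseteq> sets (F s)"
    using sets.sigma_sets_subset[of "{Z -` A \<inter> space M |A. A \<in> sets N}" "F s"] measurable_sets[OF Z]
    by auto
  ultimately show "indep_set (sigma_sets (space M) {Z -` A \<inter> space M |A. A \<in> sets N})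
     (sigma_sets (space M) {(\<lambda>w. g (W t w - W s w)) -` A \<inter> space M |A. A \<in> sets N'})"
    using indep_set_F_increment[OF st] unfolding indep_set_def
    by (elim indep_sets_mono_sets) (auto split: bool.split)
qed

text \<open>The components of the increment are independent, so the characteristic function
  factorises; division by \<open>sqrt (t - s)\<close> reduces each factor to the standard normal
  law.\<close>

lemma char_increment:
  assumes st: "0 \<le> s" "s < t"
  shows "(CLINT w|M. iexp (u \<bullet> (W t w - W s w))) = exp (- (t - s) * (norm u)\<^sup>2 / 2)"
proof -
  let ?Z = "\<lambda>i w. (W t w - W s w) $ i"
  have ind: "indep_vars (\<lambda>_. borel) ?Z UNIV"
    and dist: "\<And>i. distributed M lborel (?Z i) (normal_density 0 (sqrt (t - s)))"
    using wiener st by (auto simp: standard_wiener_process_def)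
  have one: "(CLINT w|M. iexp (u $ i * ?Z i w)) = exp (- (t - s) * (u $ i)\<^sup>2 / 2)" for i
  proof -
    let ?r = "sqrt (t - s)"
    have r: "?r > 0" using st by simp
    have d: "distributed M lborel (\<lambda>w. ?Z i w / ?r) std_normal_density"
      using dist[of i] normal_standard_normal_convert[OF r, of "?Z i" 0] by simp
    have "(CLINT w|M. iexp (u $ i * ?Z i w)) = (CLINT w|M. iexp ((u $ i * ?r) * (?Z i w / ?r)))"
      using r by (intro Bochner_Integration.integral_cong) (simp_all del: of_real_mult)
    also have "\<dots> = (CLINT x|distr M lborel (\<lambda>w. ?Z i w / ?r). iexp ((u $ i * ?r) * x))"
      using distributed_measurable[OF d] by (subst integral_distr) auto
    also have "distr M lborel (\<lambda>w. ?Z i w / ?r) = std_normal_distribution"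
      using d by (simp add: distributed_def)
    also have "(CLINT x|std_normal_distribution. iexp ((u $ i * ?r) * x)) = char std_normal_distribution (u $ i * ?r)"
      by (simp add: char_def)
    also have "\<dots> = exp (- (t - s) * (u $ i)\<^sup>2 / 2)"
      using st by (simp add: char_std_normal_distribution power_mult_distrib field_simps)
    finally show ?thesis .
  qed
  have "(CLINT w|M. iexp (u \<bullet> (W t w - W s w))) = (CLINT w|M. (\<Prod>i\<in>UNIV. iexp (u $ i * ?Z i w)))"
    by (intro Bochner_Integration.integral_cong)
       (simp_all add: inner_vec_def exp_sum[symmetric] sum_distrib_left)
  also have "\<dots> = (\<Prod>i\<in>UNIV. CLINT w|M. iexp (u $ i * ?Z i w))"
  proof (rule indep_vars_lebesgue_integral)
    show "indep_vars (\<lambda>_. borel) (\<lambda>i w. iexp (u $ i * ?Z i w)) UNIV"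
      by (rule indep_vars_compose2[OF ind]) measurable
    show "integrable M (\<lambda>w. iexp (u $ i * ?Z i w))" for i
    proof (rule integrable_const_bound[of _ 1])
      have [measurable]: "?Z i \<in> borel_measurable M"
        using ind by (simp add: indep_vars_def)
      show "(\<lambda>w. iexp (u $ i * ?Z i w)) \<in> borel_measurable M" by measurable
    qed (simp del: of_real_mult)
  qed auto
  also have "\<dots> = (\<Prod>i\<in>UNIV. complex_of_real (exp (- (t - s) * (u $ i)\<^sup>2 / 2)))"
    by (simp only: one)
  also have "\<dots> = exp (\<Sum>i\<in>UNIV. - (t - s) * (u $ i)\<^sup>2 / 2)"
    by (simp add: exp_sum of_real_prod)
  also have "(\<Sum>i\<in>UNIV. - (t - s) * (u $ i)\<^sup>2 / 2) = - (t - s) * (norm u)\<^sup>2 / 2"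
    unfolding power2_norm_eq_inner inner_vec_def
    by (simp add: sum_distrib_left sum_divide_distrib power2_eq_square)
  finally show ?thesis .
qed

text \<open>Conditioning on the past: \<eta> is frozen while the increment is integrated out.
  Independence enters as a product law, and Fubini's theorem performs the conditioning.\<close>

lemma integral_iexp_increment:
  fixes \<zeta> :: "'w \<Rightarrow> complex" and \<eta> :: "'w \<Rightarrow> real^'k"
  assumes st: "0 \<le> s" "s < t"
    and [measurable]: "\<zeta> \<in> borel_measurable (F s)" "\<eta> \<in> borel_measurable (F s)"
    and bd: "\<And>w. w \<in> space M \<Longrightarrow> norm (\<zeta> w) \<le> B"
  shows "(CLINT w|M. \<zeta> w * iexp (\<eta> w \<bullet> (W t w - W s w))) =
    (CLINT w|M. \<zeta> w * exp (- (t - s) * (norm (\<eta> w))\<^sup>2 / 2))"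
proof -
  \<comment> \<open>\<open>indep_var\<close> relates variables of one type, so the increment is
    padded with a dummy complex component.\<close>
  let ?D = "\<lambda>w. (0 :: complex, W t w - W s w)" and ?Z = "\<lambda>w. (\<zeta> w, \<eta> w)"
  have D[measurable]: "?D \<in> borel_measurable M"
    using st by (intro borel_measurable_Pair borel_measurable_diff W_measurable) auto
  have "?Z \<in> measurable (F s) borel" by measurable
  then have ind: "indep_var borel ?Z borel ?D"
    by (rule indep_var_F_increment[OF st, where g="\<lambda>x. (0, x)"]) measurable
  have Z[measurable]: "?Z \<in> borel_measurable M" using ind by (rule indep_var_rv1)
  let ?N = "distr M borel ?Z" and ?L = "distr M borel ?D"
  interpret N: prob_space ?N by (rule prob_space_distr) simp
  interpret L: prob_space ?L by (rule prob_space_distr) simp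
  interpret NL: pair_prob_space ?N ?L ..
  have eq: "?N \<Otimes>\<^sub>M ?L = distr M (borel \<Otimes>\<^sub>M borel) (\<lambda>w. (?Z w, ?D w))"
    using ind by (simp add: indep_var_distribution_eq)
  \<comment> \<open>The bound on \<zeta> is known only on \<open>space M\<close>. The truncation
    makes the integrand bounded on the whole product space, which gives the integrability for
    Fubini's theorem, and it leaves the attained values unchanged.\<close>
  define a b where "a p = (if norm (fst p) \<le> B then fst p else 0)"
    and "b p = (if norm (fst p) \<le> B then snd p else 0)" for p :: "complex \<times> (real^'k)"
  define \<pi> where "\<pi> p = snd p" for p :: "complex \<times> (real^'k)"
  have [measurable]: "a \<in> borel_measurable borel" "b \<in> borel_measurable borel" "\<pi> \<in> borel_measurable borel"
    unfolding a_def b_def \<pi>_def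
    by (rule measurable_If borel_measurable_continuous_onI;
        auto intro!: borel_measurable_continuous_onI borel_closed closed_Collect_le continuous_intros)+
  have ab: "a (?Z w) = \<zeta> w" "b (?Z w) = \<eta> w" if "w \<in> space M" for w
    using bd[OF that] by (simp_all add: a_def b_def)
  have na: "norm (a p) \<le> \<bar>B\<bar>" for p by (auto simp: a_def)
  let ?f = "\<lambda>p x. a p * iexp (b p \<bullet> \<pi> x)"
  have f[measurable]: "(\<lambda>(p, x). ?f p x) \<in> borel_measurable (borel \<Otimes>\<^sub>M borel)"
    unfolding split_beta' by measurable
  have int: "integrable (?N \<Otimes>\<^sub>M ?L) (\<lambda>(p, x). ?f p x)"
    by (rule NL.P.integrable_const_bound[of _ "\<bar>B\<bar>"])
       (auto simp: norm_mult na split_beta')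
  have "(CLINT w|M. \<zeta> w * iexp (\<eta> w \<bullet> (W t w - W s w))) = (CLINT w|M. (\<lambda>(p, x). ?f p x) (?Z w, ?D w))"
    by (intro Bochner_Integration.integral_cong) (auto simp: ab \<pi>_def)
  also have "\<dots> = (CLINT q|?N \<Otimes>\<^sub>M ?L. (\<lambda>(p, x). ?f p x) q)"
    unfolding eq by (subst integral_distr) auto
  also have "\<dots> = (CLINT p|?N. CLINT x|?L. ?f p x)"
    by (rule NL.integral_fst[symmetric, OF int])
  also have "\<dots> = (CLINT p|?N. a p * exp (- (t - s) * (norm (b p))\<^sup>2 / 2))"
  proof (intro Bochner_Integration.integral_cong refl)
    fix p
    have "(CLINT x|?L. iexp (b p \<bullet> \<pi> x)) = exp (- (t - s) * (norm (b p))\<^sup>2 / 2)"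
    proof -
      have "(\<lambda>x. iexp (b p \<bullet> \<pi> x)) \<in> borel_measurable borel" by measurable
      from integral_distr[OF D this] show ?thesis
        using char_increment[OF st, of "b p"] by (simp add: \<pi>_def)
    qed
    then show "(CLINT x|?L. ?f p x) = a p * exp (- (t - s) * (norm (b p))\<^sup>2 / 2)"
      by simp
  qed
  also have "\<dots> = (CLINT w|M. a (?Z w) * exp (- (t - s) * (norm (b (?Z w)))\<^sup>2 / 2))"
    by (subst integral_distr) auto
  also have "\<dots> = (CLINT w|M. \<zeta> w * exp (- (t - s) * (norm (\<eta> w))\<^sup>2 / 2))"
    by (intro Bochner_Integration.integral_cong) (auto simp: ab \<pi>_def)
  finally show ?thesis .
qed

end

section \<open>Exponential martingales of simple integrals\<close>

text \<open>The row vector \<open>l^T A\<close>. It turns the component of a vector-valued integral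
  in direction \<open>l\<close> into a scalar integral against \<open>W\<close>; its squared norm is
  the rate of the quadratic variation.\<close>

definition row_combination :: "real ^ 'n \<Rightarrow> real ^ 'k ^ 'n \<Rightarrow> real ^ 'k" where
  "row_combination l A = (\<Sum>i\<in>UNIV. l $ i *\<^sub>R A $ i)"

lemma row_combination_inner: "l \<bullet> (A *v d) = row_combination l A \<bullet> d"
  by (simp add: row_combination_def inner_vec_def matrix_vector_mult_def sum_distrib_left
      inner_sum_left sum_component sum_distrib_right mult.assoc) (subst sum.swap, rule refl)

lemma linear_row_combination: "linear (row_combination l)"
  by (rule linearI) (simp_all add: row_combination_def sum.distrib scaleR_add_right scaleR_sum_right mult.commute)

lemmas row_combination_simps = linear_sum[OF linear_row_combination]
  linear_add[OF linear_row_combination] linear_diff[OF linear_row_combination]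
  linear_scale[OF linear_row_combination] linear_0[OF linear_row_combination]

lemma norm_row_combination: "norm (row_combination l A) \<le> norm l * norm A"
proof -
  have "norm (row_combination l A) \<le> (\<Sum>i\<in>UNIV. \<bar>l $ i\<bar> * \<bar>norm (A $ i)\<bar>)"
    unfolding row_combination_def by (rule order_trans[OF norm_sum]) simp
  also have "\<dots> \<le> L2_set (\<lambda>i. l $ i) UNIV * L2_set (\<lambda>i. norm (A $ i)) UNIV"
    by (rule L2_set_mult_ineq)
  finally show ?thesis by (simp add: norm_vec_def L2_set_def)
qed

lemma continuous_row_combination: "continuous_on UNIV (row_combination l)"
  by (rule linear_continuous_on) (rule linear_conv_bounded_linear[THEN iffD1, OF linear_row_combination])

lemma measurable_row_combination [measurable]: "row_combination l \<in> borel_measurable borel"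
  by (rule borel_measurable_continuous_onI) (rule continuous_row_combination)

lemma set_integrable_bounded:
  fixes f :: "real \<Rightarrow> 'a::{banach, second_countable_topology}"
  assumes [measurable]: "f \<in> borel_measurable borel" and "\<And>r. norm (f r) \<le> C"
  shows "set_integrable lborel {a<..b} f"
proof -
  have "emeasure lborel {a<..b} < \<infinity>" by (cases "a \<le> b") auto
  then show ?thesis unfolding set_integrable_def
    by (intro integrableI_bounded_set_indicator[where B=C]) (use assms in auto)
qed

text \<open>No endpoint of the interval from \<open>u\<close> to \<open>u'\<close> lies strictly
  between \<open>a\<close> and \<open>b\<close>, so this interval either covers the one from
  \<open>a\<close> to \<open>b\<close> or misses it.\<close>

lemma min_increment_eq:
  fixes g :: "real \<Rightarrow> 'a::ab_group_add"
  assumes "a < b" "u \<le> u'" "u \<notin> {a<..<b}" "u' \<notin> {a<..<b}"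
  shows "(g (min u' b) - g (min u b)) - (g (min u' a) - g (min u a)) =
    (if u \<le> a \<and> b \<le> u' then g b - g a else 0)"
proof -
  consider "u' \<le> a" | "u \<le> a" "b \<le> u'" | "b \<le> u" using assms by force
  then show ?thesis using assms by cases (auto simp: min_absorb1 min_absorb2)
qed

context wiener
begin

text \<open>\<open>x\<close> and \<open>q\<close> play the roles of the increment of a martingale over \<open>(s, t]\<close> and of its quadratic
  variation.\<close>

definition exp_increment :: "real \<Rightarrow> real \<Rightarrow> ('w \<Rightarrow> real) \<Rightarrow> ('w \<Rightarrow> real) \<Rightarrow> bool" where
  "exp_increment s t x q \<longleftrightarrow> x \<in> borel_measurable (F t) \<and> q \<in> borel_measurable (F t) \<and>
     (\<exists>B. \<forall>w\<in>space M. 0 \<le> q w \<and> q w \<le> B) \<and>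
     (\<forall>\<zeta> B. \<zeta> \<in> borel_measurable (F s) \<longrightarrow> (\<forall>w\<in>space M. norm (\<zeta> w) \<le> B) \<longrightarrow>
       (CLINT w|M. \<zeta> w * (iexp (x w) * exp (q w / 2))) = (CLINT w|M. \<zeta> w))"

lemma exp_increment_refl: "exp_increment s s (\<lambda>_. 0) (\<lambda>_. 0)"
  by (auto simp: exp_increment_def)

text \<open>Integrating out the new Gaussian increment exactly cancels the new factor
  \<open>exp ((b - a) * (norm (\<eta> w))\<^sup>2 / 2)\<close>. This factor and those of the past
  are known at time \<open>a\<close>, hence may be collected in a weight; after the cancellation the
  identity up to time \<open>a\<close> remains.\<close>

lemma exp_increment_step:
  assumes ex: "exp_increment s a x q" and ab: "0 \<le> s" "s \<le> a" "a < b"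
    and eta[measurable]: "\<eta> \<in> borel_measurable (F a)" and C: "\<And>w. w \<in> space M \<Longrightarrow> norm (\<eta> w) \<le> C"
  shows "exp_increment s b (\<lambda>w. x w + \<eta> w \<bullet> (W b w - W a w)) (\<lambda>w. q w + (b - a) * (norm (\<eta> w))\<^sup>2)"
proof -
  have x[measurable]: "x \<in> borel_measurable (F a)" and q[measurable]: "q \<in> borel_measurable (F a)"
    using ex by (auto simp: exp_increment_def)
  obtain B where B: "\<And>w. w \<in> space M \<Longrightarrow> 0 \<le> q w \<and> q w \<le> B" using ex by (auto simp: exp_increment_def)
  have C0: "(norm (\<eta> w))\<^sup>2 \<le> C\<^sup>2" if "w \<in> space M" for w
    using C[OF that] by (intro power_mono) auto
  note mono = measurable_F_mono[of _ a _ b, OF _ less_imp_le[OF ab(3)]]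
  have mb[measurable]: "x \<in> borel_measurable (F b)" "q \<in> borel_measurable (F b)" "\<eta> \<in> borel_measurable (F b)"
    "W b \<in> borel_measurable (F b)" "W a \<in> borel_measurable (F b)"
    using mono[OF x] mono[OF q] mono[OF eta] ab W_adapted by auto
  show ?thesis unfolding exp_increment_def
  proof (intro conjI allI impI)
    show "(\<lambda>w. x w + \<eta> w \<bullet> (W b w - W a w)) \<in> borel_measurable (F b)" by measurable
    show "(\<lambda>w. q w + (b - a) * (norm (\<eta> w))\<^sup>2) \<in> borel_measurable (F b)" by measurable
    have "0 \<le> q w + (b - a) * (norm (\<eta> w))\<^sup>2 \<and> q w + (b - a) * (norm (\<eta> w))\<^sup>2 \<le> B + (b - a) * C\<^sup>2"
      if "w \<in> space M" for w
      using B[OF that] C0[OF that] ab by (auto intro!: add_mono mult_left_mono)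
    then show "\<exists>B. \<forall>w\<in>space M. 0 \<le> q w + (b - a) * (norm (\<eta> w))\<^sup>2 \<and> q w + (b - a) * (norm (\<eta> w))\<^sup>2 \<le> B"
      by auto
  next
    fix \<zeta> :: "'w \<Rightarrow> complex" and D
    assume z: "\<zeta> \<in> borel_measurable (F s)" and D: "\<forall>w\<in>space M. norm (\<zeta> w) \<le> D"
    have za[measurable]: "\<zeta> \<in> borel_measurable (F a)" using measurable_F_mono[OF z ab(2)] .
    define \<zeta>' where "\<zeta>' w = \<zeta> w * (iexp (x w) * exp (q w / 2)) * exp ((b - a) * (norm (\<eta> w))\<^sup>2 / 2)" for w
    have [measurable]: "\<zeta>' \<in> borel_measurable (F a)" unfolding \<zeta>'_def by measurable
    have bd: "norm (\<zeta>' w) \<le> D * exp (B / 2) * exp ((b - a) * C\<^sup>2 / 2)" if w: "w \<in> space M" for w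
      unfolding \<zeta>'_def norm_mult mult.assoc[symmetric]
      using D w B[OF w] C0[OF w] ab order_trans[OF norm_ge_zero D[rule_format, OF w]]
      by (intro mult_mono) (auto intro!: mult_left_mono)
    have "(CLINT w|M. \<zeta> w * (iexp (x w + \<eta> w \<bullet> (W b w - W a w)) * exp ((q w + (b - a) * (norm (\<eta> w))\<^sup>2) / 2)))
      = (CLINT w|M. \<zeta>' w * iexp (\<eta> w \<bullet> (W b w - W a w)))"
      by (intro Bochner_Integration.integral_cong refl)
         (simp add: \<zeta>'_def add_divide_distrib distrib_left exp_add mult_ac)
    also have "\<dots> = (CLINT w|M. \<zeta>' w * exp (- (b - a) * (norm (\<eta> w))\<^sup>2 / 2))"
      using ab by (intro integral_iexp_increment[OF _ _ _ _ bd]) auto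
    also have "\<dots> = (CLINT w|M. \<zeta> w * (iexp (x w) * exp (q w / 2)))"
      by (intro Bochner_Integration.integral_cong refl)
         (simp add: \<zeta>'_def of_real_mult[symmetric] exp_add[symmetric] del: of_real_mult,
          auto simp: algebra_simps)
    also have "\<dots> = (CLINT w|M. \<zeta> w)"
      using ex z D by (auto simp: exp_increment_def)
    finally show "(CLINT w|M. \<zeta> w * (iexp (x w + \<eta> w \<bullet> (W b w - W a w)) * exp ((q w + (b - a) * (norm (\<eta> w))\<^sup>2) / 2)))
      = (CLINT w|M. \<zeta> w)" .
  qed
qed

text \<open>The integrand is scaled down in the step in which \<open>q\<close> passes \<open>c\<close>, such that the quadratic variation of
  the modified integral is exactly \<open>min q c\<close>; this keeps the exponentials bounded uniformly in the
  simple process.\<close>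

lemma exp_increment_simple_integral:
  fixes \<xi> :: "nat \<Rightarrow> 'w \<Rightarrow> real ^ 'k ^ 'n" and \<Theta> :: "'w \<Rightarrow> real" and l :: "real ^ 'n"
  assumes simple: "simple_process M F m \<tau> \<xi>"
    and G: "finite G" "\<And>w. w \<in> space M \<Longrightarrow> \<Theta> w \<in> G"
    and stop: "\<And>p. 0 \<le> p \<Longrightarrow> {w\<in>space M. \<Theta> w \<le> p} \<in> sets (F p)"
    and st: "0 \<le> s" "s \<le> t" and c: "0 \<le> c"
  defines "f \<equiv> \<lambda>w r. if r \<le> \<Theta> w then (norm (row_combination l (simple_process_value m \<tau> \<xi> r w)))\<^sup>2 else 0"
  defines "q \<equiv> \<lambda>p w. LINT r:{s<..p}|lborel. f w r"
  defines "N \<equiv> simple_process_integral W m \<tau> \<xi>"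
  shows "q t \<in> borel_measurable (F t) \<and> (\<exists>x. exp_increment s t x (\<lambda>w. min (q t w) c) \<and>
    (\<forall>w\<in>space M. q t w \<le> c \<longrightarrow> x w = l \<bullet> (N (min t (\<Theta> w)) w - N (min s (\<Theta> w)) w)))"
proof -
  have tau: "\<And>i. i < m \<Longrightarrow> \<tau> i \<le> \<tau> (Suc i)" and xi: "\<And>i. i < m \<Longrightarrow> \<xi> i \<in> borel_measurable (F (\<tau> i))"
    using simple by (auto simp: simple_process_def)
  obtain B where B: "\<And>i w. i < m \<Longrightarrow> w \<in> space M \<Longrightarrow> norm (\<xi> i w) \<le> B"
    using simple unfolding simple_process_def by blast
  have nS: "norm (simple_process_value m \<tau> \<xi> r w) \<le> m * \<bar>B\<bar>" if "w \<in> space M" for r w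
  proof -
    have "norm (simple_process_value m \<tau> \<xi> r w) \<le> (\<Sum>i<m. \<bar>B\<bar>)"
      unfolding simple_process_value_def
      using B that by (intro order_trans[OF norm_sum] sum_mono)
        (auto simp: indicator_def intro: order_trans[OF _ abs_ge_self])
    then show ?thesis by simp
  qed
  have fm[measurable]: "f w \<in> borel_measurable borel" for w
    unfolding f_def simple_process_value_def by measurable
  have f0: "0 \<le> f w r" for w r by (simp add: f_def)
  have fb: "f w r \<le> (norm l * (m * \<bar>B\<bar>))\<^sup>2" if "w \<in> space M" for w r
    unfolding f_def using order_trans[OF norm_row_combination mult_left_mono[OF nS[OF that]]]
    by (auto intro!: power_mono)
  have fint: "set_integrable lborel {a<..b} (f w)" if "w \<in> space M" for w a b
    using fb[OF that] f0 by (intro set_integrable_bounded) auto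
  \<comment> \<open>Strictly between neighbouring points of this set the simple process has no
    breakpoint and \<Theta> no value, so a single Gaussian step crosses the gap.\<close>
  let ?G = "G \<union> \<tau> ` {..m}"
  define Q where "Q p \<longleftrightarrow> q p \<in> borel_measurable (F p) \<and> (\<forall>w\<in>space M. 0 \<le> q p w) \<and>
    (\<exists>x. exp_increment s p x (\<lambda>w. min (q p w) c) \<and>
    (\<forall>w\<in>space M. q p w \<le> c \<longrightarrow> x w = l \<bullet> (N (min p (\<Theta> w)) w - N (min s (\<Theta> w)) w)))" for p
  have Qs: "Q s"
    using exp_increment_refl[of s] c by (auto simp: Q_def q_def set_lebesgue_integral_def intro!: exI[of _ "\<lambda>_. 0"])
  have Qstep: "Q b" if Qa: "Q a" and ab: "s \<le> a" "a < b" and gap: "?G \<inter> {a<..<b} = {}" for a b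
  proof -
    obtain x where ex: "exp_increment s a x (\<lambda>w. min (q a w) c)"
      and x: "\<And>w. w \<in> space M \<Longrightarrow> q a w \<le> c \<Longrightarrow> x w = l \<bullet> (N (min a (\<Theta> w)) w - N (min s (\<Theta> w)) w)"
      using Qa by (auto simp: Q_def)
    have qa[measurable]: "q a \<in> borel_measurable (F a)" and qa0: "\<And>w. w \<in> space M \<Longrightarrow> 0 \<le> q a w"
      using Qa by (auto simp: Q_def)
    define Z where "Z w = (\<Sum>i<m. if \<tau> i \<le> a \<and> b \<le> \<tau> (Suc i) then \<xi> i w else 0)" for w
    have Z[measurable]: "Z \<in> borel_measurable (F a)" unfolding Z_def
    proof (rule borel_measurable_sum)
      fix i assume "i \<in> {..<m}"
      then show "(\<lambda>w. if \<tau> i \<le> a \<and> b \<le> \<tau> (Suc i) then \<xi> i w else 0) \<in> borel_measurable (F a)"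
        using measurable_F_mono[OF xi[of i], of a] by (cases "\<tau> i \<le> a \<and> b \<le> \<tau> (Suc i)") auto
    qed
    have nin: "\<tau> i \<notin> {a<..<b}" if "i \<le> m" for i using gap that by auto
    have SZ: "simple_process_value m \<tau> \<xi> r w = Z w" if "r \<in> {a<..b}" for r w
      unfolding simple_process_value_def Z_def
    proof (rule sum.cong[OF refl])
      fix i assume "i \<in> {..<m}"
      then have i: "i < m" by simp
      have "r \<in> {\<tau> i<..\<tau> (Suc i)} \<longleftrightarrow> \<tau> i \<le> a \<and> b \<le> \<tau> (Suc i)"
        using nin[of i] nin[of "Suc i"] i that tau[OF i] by (simp; linarith)
      then show "indicator {\<tau> i<..\<tau> (Suc i)} r *\<^sub>R \<xi> i w = (if \<tau> i \<le> a \<and> b \<le> \<tau> (Suc i) then \<xi> i w else 0)"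
        by (auto simp: indicator_def)
    qed
    have NZ: "N b w - N a w = Z w *v (W b w - W a w)" for w
    proof -
      have "N b w - N a w = (\<Sum>i<m. \<xi> i w *v ((W (min (\<tau> (Suc i)) b) w - W (min (\<tau> i) b) w) -
          (W (min (\<tau> (Suc i)) a) w - W (min (\<tau> i) a) w)))"
        unfolding N_def simple_process_integral_def
        by (simp add: sum_subtractf matrix_vector_mult_diff_distrib)
      also have "\<dots> = (\<Sum>i<m. (if \<tau> i \<le> a \<and> b \<le> \<tau> (Suc i) then \<xi> i w else 0) *v (W b w - W a w))"
      proof (rule sum.cong[OF refl])
        fix i assume "i \<in> {..<m}"
        then show "\<xi> i w *v ((W (min (\<tau> (Suc i)) b) w - W (min (\<tau> i) b) w) - (W (min (\<tau> (Suc i)) a) w - W (min (\<tau> i) a) w))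
          = (if \<tau> i \<le> a \<and> b \<le> \<tau> (Suc i) then \<xi> i w else 0) *v (W b w - W a w)"
          using min_increment_eq[OF ab(2) tau, of i "\<lambda>r. W r w"] nin[of i] nin[of "Suc i"] by simp
      qed
      also have "\<dots> = Z w *v (W b w - W a w)"
        unfolding Z_def by (induction m) (simp_all add: matrix_vector_mult_add_rdistrib)
      finally show ?thesis .
    qed
    define A where "A w = (if \<Theta> w \<le> a then 0 else 1 :: real)" for w
    have [measurable]: "A \<in> borel_measurable (F a)"
      unfolding A_def using stop[of a] st ab by (intro measurable_If) auto
    have Th: "\<Theta> w \<le> a \<or> b \<le> \<Theta> w" if "w \<in> space M" for w
      using gap G(2)[OF that] by force
    define V where "V w = row_combination l (Z w)" for w
    have [measurable]: "V \<in> borel_measurable (F a)" unfolding V_def by measurable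
    define d where "d w = (b - a) * (A w * (norm (V w))\<^sup>2)" for w
    have [measurable]: "d \<in> borel_measurable (F a)" unfolding d_def by measurable
    have d0: "0 \<le> d w" for w using ab by (simp add: d_def A_def)
    have qb: "q b w = q a w + d w" if w: "w \<in> space M" for w
    proof -
      have "{s<..b} = {s<..a} \<union> {a<..b}" using ab by auto
      then have "q b w = q a w + (LINT r:{a<..b}|lborel. f w r)"
        unfolding q_def using fint[OF w] by (simp add: set_integral_Un disjoint_iff)
      also have "(LINT r:{a<..b}|lborel. f w r) = (LINT r:{a<..b}|lborel. A w * (norm (V w))\<^sup>2)"
        using Th[OF w] SZ by (intro set_lebesgue_integral_cong) (auto simp: f_def A_def V_def)
      also have "\<dots> = d w"
        using ab by (simp add: d_def set_lebesgue_integral_def)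
      finally show ?thesis .
    qed
    \<comment> \<open>The square of this factor is the share of the gain \<open>d w\<close> that
      fits below the cap \<open>c\<close>. It is \<open>1\<close> as long as the cap is not exceeded
      and \<open>0\<close> once it is reached. For \<open>d w = 0\<close> division by zero yields
      \<open>0\<close>, which is consistent as nothing is gained.\<close>
    define g where "g w = sqrt ((min (q a w + d w) c - min (q a w) c) / d w)" for w
    have [measurable]: "g \<in> borel_measurable (F a)" unfolding g_def by measurable
    have mm: "0 \<le> min (q a w + d w) c - min (q a w) c" "min (q a w + d w) c - min (q a w) c \<le> d w" for w
      using d0[of w] by (auto simp: min_def)
    have g01: "0 \<le> g w" "g w \<le> 1" for w
      using mm[of w] d0[of w] by (auto simp: g_def divide_le_eq_1)
    have gd: "(g w)\<^sup>2 * d w = min (q a w + d w) c - min (q a w) c" for w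
      using mm[of w] d0[of w] by (cases "d w = 0") (auto simp: g_def)
    have nV: "norm (V w) \<le> norm l * (m * \<bar>B\<bar>)" if "w \<in> space M" for w
      unfolding V_def using order_trans[OF norm_row_combination mult_left_mono[OF nS[OF that, of b]]] SZ[of b w] ab
      by auto
    have ex': "exp_increment s b (\<lambda>w. x w + ((g w * A w) *\<^sub>R V w) \<bullet> (W b w - W a w))
       (\<lambda>w. min (q a w) c + (b - a) * (norm ((g w * A w) *\<^sub>R V w))\<^sup>2)"
    proof (rule exp_increment_step[OF ex st(1) ab])
      show "(\<lambda>w. (g w * A w) *\<^sub>R V w) \<in> borel_measurable (F a)" by measurable
      fix w assume "w \<in> space M"
      have "\<bar>g w * A w\<bar> \<le> 1" using g01[of w] by (auto simp: A_def)
      then show "norm ((g w * A w) *\<^sub>R V w) \<le> norm l * (m * \<bar>B\<bar>)"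
        using nV[OF \<open>w \<in> space M\<close>] mult_mono[of "\<bar>g w * A w\<bar>" 1 "norm (V w)"] by force
    qed
    have qmin: "min (q a w) c + (b - a) * (norm ((g w * A w) *\<^sub>R V w))\<^sup>2 = min (q b w) c" if "w \<in> space M" for w
    proof -
      have "(b - a) * (norm ((g w * A w) *\<^sub>R V w))\<^sup>2 = (g w)\<^sup>2 * d w"
        by (simp add: d_def A_def power_mult_distrib)
      then show ?thesis by (simp add: gd qb[OF that])
    qed
    have "(\<lambda>w. q a w + d w) \<in> borel_measurable (F b)"
      using ab by (intro measurable_F_mono[of _ a _ b]) auto
    then have qbm: "q b \<in> borel_measurable (F b)"
      by (rule measurable_cong[THEN iffD1, rotated]) (simp add: qb)
    have ex'': "exp_increment s b (\<lambda>w. x w + ((g w * A w) *\<^sub>R V w) \<bullet> (W b w - W a w)) (\<lambda>w. min (q b w) c)"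
    proof -
      have "(\<lambda>w. min (q b w) c) \<in> borel_measurable (F b)" using qbm by measurable
      then show ?thesis
        using ex' qmin unfolding exp_increment_def by (simp cong: Bochner_Integration.integral_cong)
    qed
    have "x w + ((g w * A w) *\<^sub>R V w) \<bullet> (W b w - W a w) = l \<bullet> (N (min b (\<Theta> w)) w - N (min s (\<Theta> w)) w)"
      if w: "w \<in> space M" and q: "q b w \<le> c" for w
    proof -
      have qc: "q a w \<le> c" using q qb[OF w] d0[of w] by simp
      have xw: "x w = l \<bullet> (N (min a (\<Theta> w)) w - N (min s (\<Theta> w)) w)" by (rule x[OF w qc])
      have "((g w * A w) *\<^sub>R V w) \<bullet> (W b w - W a w) = l \<bullet> (N (min b (\<Theta> w)) w - N (min a (\<Theta> w)) w)"
      proof (cases "\<Theta> w \<le> a")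
        case True
        then show ?thesis using ab by (simp add: A_def min_def)
      next
        case False
        then have "b \<le> \<Theta> w" using Th[OF w] by simp
        then have "N (min b (\<Theta> w)) w - N (min a (\<Theta> w)) w = Z w *v (W b w - W a w)"
          using NZ ab by (simp add: min_def)
        then have "l \<bullet> (N (min b (\<Theta> w)) w - N (min a (\<Theta> w)) w) = V w \<bullet> (W b w - W a w)"
          by (simp add: row_combination_inner V_def)
        moreover have "(g w * A w) *\<^sub>R V w = V w"
        \<comment> \<open>The path is not yet stopped at time \<open>a\<close>, so
          \<open>d w = 0\<close> forces \<open>V w = 0\<close>. Otherwise \<open>q\<close> remains
          within the cap and the scaling factor is \<open>1\<close>.\<close>
        proof (cases "d w = 0")
          case True
          then show ?thesis using ab False by (auto simp: d_def A_def)
        next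
          case dn: False
          have "g w = 1" using q qc qb[OF w] dn by (simp add: g_def min_def)
          then show ?thesis using False by (simp add: A_def)
        qed
        ultimately show ?thesis by simp
      qed
      then show ?thesis by (simp add: xw inner_diff_right)
    qed
    moreover have "\<forall>w\<in>space M. 0 \<le> q b w" using qb qa0 d0 by (auto intro: add_nonneg_nonneg)
    ultimately show "Q b" unfolding Q_def using ex'' qbm by blast
  qed
  have "s \<le> p \<Longrightarrow> Q p" for p
  \<comment> \<open>The induction counts the breakpoints strictly between \<open>s\<close> and
    \<open>p\<close>; the last of them splits off one step.\<close>
  proof (induction "card (?G \<inter> {s<..<p})" arbitrary: p rule: less_induct)
    case less
    let ?H = "?G \<inter> {s<..<p}"
    have fin: "finite ?H" using G by auto
    consider "p = s" | "s < p" "?H = {}" | "?H \<noteq> {}" using less.prems by force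
    then show ?case
    proof cases
      case 1 then show ?thesis using Qs by simp
    next
      case 2 then show ?thesis using Qstep[OF Qs] by auto
    next
      case 3
      define a where "a = Max ?H"
      have a: "a \<in> ?H" unfolding a_def by (rule Max_in[OF fin 3])
      have "card (?G \<inter> {s<..<a}) < card ?H" using a fin by (intro psubset_card_mono) auto
      then have "Q a" using less.hyps a by auto
      moreover have "?G \<inter> {a<..<p} = {}"
      proof (rule ccontr)
        assume "?G \<inter> {a<..<p} \<noteq> {}"
        then obtain z where z: "z \<in> ?G" "z \<in> {a<..<p}" by blast
        then have "z \<in> ?H" using a by auto
        then show False using Max_ge[OF fin, of z] z by (simp add: a_def)
      qed
      ultimately show ?thesis using Qstep[of a p] a by auto
    qed
  qed
  then show ?thesis using st unfolding Q_def by blast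
qed

end

section \<open>Passage to the limit\<close>

text \<open>Truncation at 1 turns convergence in probability into convergence of expectations, even
  if infinite values occur, and a sequence converging to 0 in mean has an almost surely convergent
  subsequence. Summing over the finite set \<open>J\<close> first makes the subsequence common to
  all indices.\<close>

lemma (in prob_space) AE_subseq_of_convergence_in_prob:
  fixes d :: "'i \<Rightarrow> nat \<Rightarrow> 'a \<Rightarrow> ennreal"
  assumes J: "finite J" and m[measurable]: "\<And>i j. i \<in> J \<Longrightarrow> d i j \<in> borel_measurable M"
    and lim: "\<And>i \<epsilon>. i \<in> J \<Longrightarrow> 0 < \<epsilon> \<Longrightarrow> (\<lambda>j. prob {w\<in>space M. d i j w > ennreal \<epsilon>}) \<longlonglongrightarrow> 0"
  shows "\<exists>r. strict_mono r \<and> (AE w in M. \<forall>i\<in>J. (\<lambda>j. d i (r j) w) \<longlonglongrightarrow> 0)"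
proof -
  define e where "e i j w = enn2real (min 1 (d i j w))" for i j w
  have [measurable]: "e i j \<in> borel_measurable M" if "i \<in> J" for i j
    unfolding e_def using m[OF that, of j] by measurable
  have min_lt: "min 1 (d i j w) < top" for i j w by (simp add: min_less_iff_disj)
  have e_eq: "ennreal (e i j w) = min 1 (d i j w)" for i j w
    using min_lt[of i j w] unfolding e_def by (intro ennreal_enn2real) auto
  have e01: "0 \<le> e i j w" "e i j w \<le> 1" for i j w
  proof -
    show "0 \<le> e i j w" by (simp add: e_def)
    have "ennreal (e i j w) \<le> ennreal 1" unfolding e_eq by simp
    then show "e i j w \<le> 1" by (simp add: ennreal_le_iff)
  qed
  have inte: "integrable M (e i j)" if "i \<in> J" for i j
    using that e01 by (intro integrable_const_bound[of _ 1]) auto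
  have Ee: "(\<lambda>j. expectation (e i j)) \<longlonglongrightarrow> 0" if i: "i \<in> J" for i
  proof (rule LIMSEQ_I)
    fix \<epsilon> :: real assume eps: "0 < \<epsilon>"
    obtain N where N: "\<And>j. j \<ge> N \<Longrightarrow> \<bar>prob {w\<in>space M. d i j w > ennreal (\<epsilon>/2)}\<bar> < \<epsilon>/2"
      using LIMSEQ_D[OF lim[OF i, of "\<epsilon>/2"], of "\<epsilon>/2"] eps by auto
    have "expectation (e i j) < \<epsilon>" if "j \<ge> N" for j
    proof -
      let ?A = "{w\<in>space M. d i j w > ennreal (\<epsilon>/2)}"
      have A: "?A \<in> sets M" using i by measurable
      have "expectation (e i j) \<le> expectation (\<lambda>w. \<epsilon>/2 + indicator ?A w)"
      proof (rule integral_mono[OF inte[OF i]])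
        show "integrable M (\<lambda>w. \<epsilon>/2 + indicator ?A w)" using A
          by (intro Bochner_Integration.integrable_add integrable_real_indicator) (auto simp: emeasure_eq_measure)
        fix w assume w: "w \<in> space M"
        show "e i j w \<le> \<epsilon>/2 + indicator ?A w"
        proof (cases "w \<in> ?A")
          case True then show ?thesis using e01[of i j w] eps by simp
        next
          case False
          then have "ennreal (e i j w) \<le> ennreal (\<epsilon>/2)" using w by (simp add: e_eq min_le_iff_disj not_less)
          then show ?thesis using False eps by (simp add: ennreal_le_iff)
        qed
      qed
      also have "\<dots> = \<epsilon>/2 + prob ?A" using A
        by (subst Bochner_Integration.integral_add)
           (auto simp: prob_space emeasure_eq_measure intro!: integrable_real_indicator)
      finally show ?thesis using N[OF that] by simp
    qed
    moreover have "0 \<le> expectation (e i j)" for j by (intro integral_nonneg_AE) (simp add: e01)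
    ultimately show "\<exists>N. \<forall>j\<ge>N. norm (expectation (e i j) - 0) < \<epsilon>" by auto
  qed
  define u where "u j w = (\<Sum>i\<in>J. e i j w)" for j w
  have u0: "0 \<le> u j w" for j w unfolding u_def by (intro sum_nonneg e01)
  have "(\<lambda>j. expectation (\<lambda>w. norm (u j w))) \<longlonglongrightarrow> 0"
  proof -
    have "expectation (\<lambda>w. norm (u j w)) = (\<Sum>i\<in>J. expectation (e i j))" for j
      using u0 inte unfolding u_def by (subst Bochner_Integration.integral_sum[symmetric]) auto
    moreover have "(\<lambda>j. \<Sum>i\<in>J. expectation (e i j)) \<longlonglongrightarrow> (\<Sum>i\<in>J. 0)"
      by (intro tendsto_sum Ee)
    ultimately show ?thesis by simp
  qed
  moreover have "integrable M (u j)" for j unfolding u_def by (intro Bochner_Integration.integrable_sum inte)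
  ultimately obtain r where r: "strict_mono r" "AE w in M. (\<lambda>j. u (r j) w) \<longlonglongrightarrow> 0"
    using tendsto_L1_AE_subseq[of M u] by auto
  have "AE w in M. \<forall>i\<in>J. (\<lambda>j. d i (r j) w) \<longlonglongrightarrow> 0"
    using r(2)
  proof eventually_elim
    case (elim w)
    show ?case
    proof
      fix i assume i: "i \<in> J"
      have "(\<lambda>j. e i (r j) w) \<longlonglongrightarrow> 0"
      proof (rule tendsto_sandwich[OF _ _ tendsto_const elim])
        show "\<forall>\<^sub>F j in sequentially. 0 \<le> e i (r j) w" using e01 by simp
        show "\<forall>\<^sub>F j in sequentially. e i (r j) w \<le> u (r j) w"
          unfolding u_def using i J e01 by (intro always_eventually allI member_le_sum) auto
      qed
      then have *: "(\<lambda>j. min 1 (d i (r j) w)) \<longlonglongrightarrow> 0"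
        unfolding e_eq[symmetric] using tendsto_ennrealI by fastforce
      have "\<forall>\<^sub>F j in sequentially. min 1 (d i (r j) w) < 1"
        using order_tendstoD(2)[OF *, of 1] by simp
      then have "\<forall>\<^sub>F j in sequentially. min 1 (d i (r j) w) = d i (r j) w"
        by eventually_elim (auto simp: min_def split: if_splits)
      then show "(\<lambda>j. d i (r j) w) \<longlonglongrightarrow> 0"
        using * by (rule Lim_transform_eventually[rotated])
    qed
  qed
  with r(1) show ?thesis by auto
qed

section \<open>Convergence of quadratic variations\<close>

lemma abs_norm_square_diff_le:
  fixes x y :: "'a::real_normed_vector"
  assumes "0 < \<delta>"
  shows "\<bar>(norm x)\<^sup>2 - (norm y)\<^sup>2\<bar> \<le> (1 + 1/\<delta>) * (norm (x - y))\<^sup>2 + \<delta> * (norm y)\<^sup>2"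
proof -
  let ?d = "norm (x - y)"
  have "norm x \<le> norm y + ?d" "norm y \<le> norm x + ?d"
    using norm_triangle_sub[of x y] norm_triangle_sub[of y x] by (auto simp: norm_minus_commute)
  then have "\<bar>norm x - norm y\<bar> \<le> ?d" by linarith
  then have "\<bar>(norm x)\<^sup>2 - (norm y)\<^sup>2\<bar> \<le> ?d * (2 * norm y + ?d)"
  proof -
    assume a: "\<bar>norm x - norm y\<bar> \<le> ?d"
    have "\<bar>(norm x)\<^sup>2 - (norm y)\<^sup>2\<bar> = \<bar>norm x - norm y\<bar> * (norm x + norm y)"
      by (simp add: power2_eq_square square_diff_square_factored abs_mult mult.commute)
    also have "\<dots> \<le> ?d * (2 * norm y + ?d)" using a by (intro mult_mono) auto
    finally show ?thesis .
  qed
  moreover have "2 * (norm y * ?d) \<le> ?d\<^sup>2 / \<delta> + \<delta> * (norm y)\<^sup>2"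
  proof -
    have "0 \<le> (?d - \<delta> * norm y)\<^sup>2 / \<delta>" using assms by simp
    also have "\<dots> = ?d\<^sup>2 / \<delta> + \<delta> * (norm y)\<^sup>2 - 2 * (norm y * ?d)"
      using assms by (simp add: power2_eq_square field_simps)
    finally show ?thesis by simp
  qed
  ultimately show ?thesis by (simp add: power2_eq_square algebra_simps)
qed

text \<open>The squares are compared with a free weight \<delta>. With \<open>?D j\<close> the
  squared distance and \<open>?B\<close> the squared norm of the limit, the choice
  \<open>\<delta> = sqrt (?D j)\<close> balances the two terms into
  \<open>?D j + sqrt (?D j) * (1 + ?B)\<close>, which tends to \<open>0\<close>.\<close>

lemma tendsto_integral_norm_square:
  fixes a :: "nat \<Rightarrow> 'b \<Rightarrow> 'a::euclidean_space"
  assumes [measurable]: "\<And>j. a j \<in> borel_measurable N" "b \<in> borel_measurable N"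
    and lim: "(\<lambda>j. \<integral>\<^sup>+x. ennreal ((norm (a j x - b x))\<^sup>2) \<partial>N) \<longlonglongrightarrow> 0"
    and fin: "(\<integral>\<^sup>+x. ennreal ((norm (b x))\<^sup>2) \<partial>N) < \<infinity>"
  shows "(\<lambda>j. LINT x|N. (norm (a j x))\<^sup>2) \<longlonglongrightarrow> (LINT x|N. (norm (b x))\<^sup>2)"
proof -
  let ?D = "\<lambda>j. LINT x|N. (norm (a j x - b x))\<^sup>2"
  let ?B = "LINT x|N. (norm (b x))\<^sup>2"
  have ib: "integrable N (\<lambda>x. (norm (b x))\<^sup>2)"
    using fin by (intro integrableI_bounded) auto
  have B0: "0 \<le> ?B" by simp
  have ev: "\<forall>\<^sub>F j in sequentially. (\<integral>\<^sup>+x. ennreal ((norm (a j x - b x))\<^sup>2) \<partial>N) < \<infinity>"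
    using order_tendstoD(2)[OF lim, of \<infinity>] by simp
  have D: "?D \<longlonglongrightarrow> 0"
  proof -
    have "(\<lambda>j. enn2real (\<integral>\<^sup>+x. ennreal ((norm (a j x - b x))\<^sup>2) \<partial>N)) \<longlonglongrightarrow> enn2real 0"
      using tendsto_enn2real[of _ 0] lim by simp
    moreover have "?D j = enn2real (\<integral>\<^sup>+x. ennreal ((norm (a j x - b x))\<^sup>2) \<partial>N)" for j
      by (rule integral_eq_nn_integral) auto
    ultimately show ?thesis by simp
  qed
  have D0: "0 \<le> ?D j" for j by simp
  have bound: "\<forall>\<^sub>F j in sequentially. norm ((LINT x|N. (norm (a j x))\<^sup>2) - ?B) \<le> ?D j + sqrt (?D j) * (1 + ?B)"
    using ev
  proof eventually_elim
    case (elim j)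
    have id: "integrable N (\<lambda>x. (norm (a j x - b x))\<^sup>2)" using elim by (intro integrableI_bounded) auto
    have ia: "integrable N (\<lambda>x. (norm (a j x))\<^sup>2)"
    proof (rule Bochner_Integration.integrable_bound[of _ "\<lambda>x. 2 * (norm (a j x - b x))\<^sup>2 + 2 * (norm (b x))\<^sup>2"])
      show "AE x in N. norm ((norm (a j x))\<^sup>2) \<le> norm (2 * (norm (a j x - b x))\<^sup>2 + 2 * (norm (b x))\<^sup>2)"
      proof (rule AE_I2)
        fix x
        have "(norm (a j x))\<^sup>2 \<le> 2 * (norm (a j x - b x))\<^sup>2 + 2 * (norm (b x))\<^sup>2"
          using abs_norm_square_diff_le[of 1 "a j x" "b x"] by simp
        then show "norm ((norm (a j x))\<^sup>2) \<le> norm (2 * (norm (a j x - b x))\<^sup>2 + 2 * (norm (b x))\<^sup>2)"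
          unfolding real_norm_def by (subst (1 2) abs_of_nonneg) auto
      qed
    qed (use id ib in auto)
    have le: "norm ((LINT x|N. (norm (a j x))\<^sup>2) - ?B) \<le> (1 + 1/\<delta>) * ?D j + \<delta> * ?B" if "0 < \<delta>" for \<delta>
    proof -
      have "norm ((LINT x|N. (norm (a j x))\<^sup>2) - ?B) = norm (LINT x|N. (norm (a j x))\<^sup>2 - (norm (b x))\<^sup>2)"
        using ia ib by simp
      also have "\<dots> \<le> (LINT x|N. norm ((norm (a j x))\<^sup>2 - (norm (b x))\<^sup>2))" by (rule integral_norm_bound)
      also have "\<dots> \<le> (LINT x|N. (1 + 1/\<delta>) * (norm (a j x - b x))\<^sup>2 + \<delta> * (norm (b x))\<^sup>2)"
        using ia ib id abs_norm_square_diff_le[OF that] by (intro integral_mono) auto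
      also have "\<dots> = (1 + 1/\<delta>) * ?D j + \<delta> * ?B" using id ib by simp
      finally show ?thesis .
    qed
    show ?case
    \<comment> \<open>If the distance is \<open>0\<close> then \<open>sqrt (?D j)\<close> is not
      admissible as a weight, and arbitrarily small weights are used instead.\<close>
    proof (cases "?D j = 0")
      case True
      have "norm ((LINT x|N. (norm (a j x))\<^sup>2) - ?B) \<le> 0 + e" if "0 < e" for e
      proof -
        have "norm ((LINT x|N. (norm (a j x))\<^sup>2) - ?B) \<le> e / (1 + ?B) * ?B"
          using le[of "e / (1 + ?B)"] True B0 that by simp
        also have "\<dots> \<le> e"
        proof -
          have p: "0 < 1 + ?B" using B0 by linarith
          show ?thesis using that by (simp add: pos_divide_le_eq[OF p] distrib_left)
        qed
        finally show ?thesis by simp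
      qed
      then have "norm ((LINT x|N. (norm (a j x))\<^sup>2) - ?B) \<le> 0" by (rule field_le_epsilon)
      then show ?thesis using True by simp
    next
      case False
      then have p: "0 < ?D j" using D0[of j] by linarith
      have "?D j / sqrt (?D j) = sqrt (?D j)" using p by (simp add: real_div_sqrt)
      then show ?thesis using le[of "sqrt (?D j)"] p by (simp add: algebra_simps)
    qed
  qed
  have "(\<lambda>j. ?D j + sqrt (?D j) * (1 + ?B)) \<longlonglongrightarrow> 0 + sqrt 0 * (1 + ?B)"
    by (intro tendsto_intros D)
  then have "(\<lambda>j. (LINT x|N. (norm (a j x))\<^sup>2) - ?B) \<longlonglongrightarrow> 0"
    by (intro Lim_null_comparison[OF bound]) simp
  then show ?thesis by (simp add: LIM_zero_iff)
qed

lemma continuous_on_matrix_vector_mult_pair: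
  "continuous_on UNIV (\<lambda>p. fst p *v (snd p :: real ^ 'k) :: real ^ 'n)"
  unfolding matrix_vector_mult_def by (intro continuous_intros)

lemma borel_measurable_matrix_vector_mult [measurable (raw)]:
  fixes f :: "'a \<Rightarrow> real ^ 'k ^ 'n"
  assumes "f \<in> borel_measurable N" "g \<in> borel_measurable N"
  shows "(\<lambda>x. f x *v g x) \<in> borel_measurable N"
  using borel_measurable_continuous_Pair[OF assms continuous_on_matrix_vector_mult_pair] by simp

context wiener
begin

text \<open>Progressive measurability speaks of the time interval \<open>{0..u}\<close> only.
  Clamping the time to it yields a process that is jointly measurable on the whole line and has the
  same values on \<open>{0..u}\<close>.\<close>

lemma progressive_clamp_measurable:
  fixes H :: "real \<Rightarrow> 'w \<Rightarrow> 'a::topological_space"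
  assumes H: "progressively_measurable F H" and u: "0 \<le> u"
  shows "(\<lambda>(r, w). H (max 0 (min u r)) w) \<in> borel_measurable (borel \<Otimes>\<^sub>M M)"
proof -
  have H': "(\<lambda>(s, w). H s w) \<in> borel_measurable (restrict_space borel {0..u} \<Otimes>\<^sub>M F u)"
    using H u by (auto simp: progressively_measurable_def)
  have 1: "(\<lambda>p. max 0 (min u (fst p))) \<in> (borel \<Otimes>\<^sub>M M) \<rightarrow>\<^sub>M restrict_space borel {0..u}"
    using u by (intro measurable_restrict_space2) (auto)
  have "(\<lambda>w. w) \<in> M \<rightarrow>\<^sub>M F u"
    by (rule measurableI) (use sets_F_subset sets.sets_into_space in \<open>auto intro: sets.Int\<close>)
  then have 2: "snd \<in> (borel \<Otimes>\<^sub>M M) \<rightarrow>\<^sub>M F u" using measurable_compose[OF measurable_snd] by blast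
  show ?thesis using measurable_compose[OF measurable_Pair[OF 1 2] H'] by (simp add: split_beta')
qed

lemma stop_measurable:
  assumes "\<And>w. w \<in> space M \<Longrightarrow> 0 \<le> \<Theta> w" "\<And>p. 0 \<le> p \<Longrightarrow> {w\<in>space M. \<Theta> w \<le> p} \<in> sets (F p)"
  shows "\<Theta> \<in> borel_measurable M"
  unfolding borel_measurable_iff_le
proof
  fix p :: real
  show "{w \<in> space M. \<Theta> w \<le> p} \<in> sets M"
  proof (cases "0 \<le> p")
    case False
    then have "{w \<in> space M. \<Theta> w \<le> p} = {}" using assms(1) by force
    then show ?thesis by (simp only: sets.empty_sets)
  qed (use assms(2) sets_F_subset in blast)
qed

lemma exp_incrementD:
  assumes "exp_increment s t x q"
  shows "x \<in> borel_measurable (F t)"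
    and "\<lbrakk>\<zeta> \<in> borel_measurable (F s); \<And>w. w \<in> space M \<Longrightarrow> norm (\<zeta> w) \<le> B\<rbrakk> \<Longrightarrow>
      (CLINT w|M. \<zeta> w * (iexp (x w) * exp (q w / 2))) = (CLINT w|M. \<zeta> w)"
  using assms unfolding exp_increment_def by blast+

text \<open>As \<open>\<Theta>\<close> takes finitely many values, convergence of the integrals in probability at fixed times
  suffices, and no maximal inequality is needed.\<close>

lemma exp_increment_ito_integral_finite:
  fixes H :: "real \<Rightarrow> 'w \<Rightarrow> real ^ 'k ^ 'n" and \<Theta> :: "'w \<Rightarrow> real" and l :: "real ^ 'n"
  assumes ito: "has_ito_integral M F W H I"
    and G: "finite G" "G \<subseteq> {0..}" "\<And>w. w \<in> space M \<Longrightarrow> \<Theta> w \<in> G"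
    and stop: "\<And>p. 0 \<le> p \<Longrightarrow> {w\<in>space M. \<Theta> w \<le> p} \<in> sets (F p)"
    and st: "0 \<le> s" "s \<le> t" and c: "0 \<le> c"
    and z: "\<zeta> \<in> borel_measurable (F s)" and D: "\<And>w. w \<in> space M \<Longrightarrow> norm (\<zeta> w :: complex) \<le> D"
  defines "q \<equiv> \<lambda>w. LINT r:{s<..t}|lborel. (if r \<le> \<Theta> w then (norm (row_combination l (H r w)))\<^sup>2 else 0)"
  defines "y \<equiv> \<lambda>w. l \<bullet> (I (min t (\<Theta> w)) w - I (min s (\<Theta> w)) w)"
  defines "\<phi> \<equiv> \<lambda>x. min 1 (max 0 (2 * (x - c) + 1)) :: real"
  shows "y \<in> borel_measurable M" "q \<in> borel_measurable M"
    "norm ((CLINT w|M. \<zeta> w * (iexp (y w) * exp (min (q w) c / 2))) - (CLINT w|M. \<zeta> w))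
      \<le> (LINT w|M. 2 * \<bar>D\<bar> * exp (c / 2) * \<phi> (q w))"
proof -
  have H: "progressively_measurable F H" using ito by (simp add: has_ito_integral_def)
  have finH: "AE w in M. (\<integral>\<^sup>+r\<in>{0..t}. ennreal ((norm (H r w))\<^sup>2) \<partial>lborel) < \<infinity>"
    using ito st by (auto simp: has_ito_integral_def)
  have Im[measurable]: "I u \<in> borel_measurable M" if "0 \<le> u" for u
    using ito that measurable_F_imp[of "I u" u] unfolding has_ito_integral_def by blast
  from ito obtain m \<tau> \<xi> where simple: "\<And>j::nat. simple_process M F (m j) (\<tau> j) (\<xi> j)"
    and conv: "\<And>u \<epsilon>. 0 \<le> u \<Longrightarrow> 0 < \<epsilon> \<Longrightarrow> (\<lambda>j. measure M {w \<in> space M.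
              (\<integral>\<^sup>+s\<in>{0..u}. ennreal ((norm (simple_process_value (m j) (\<tau> j) (\<xi> j) s w - H s w))\<^sup>2)
                 \<partial>lborel) > ennreal \<epsilon>}) \<longlonglongrightarrow> 0"
     "\<And>u \<epsilon>. 0 \<le> u \<Longrightarrow> 0 < \<epsilon> \<Longrightarrow> (\<lambda>j. measure M {w \<in> space M.
              norm (simple_process_integral W (m j) (\<tau> j) (\<xi> j) u w - I u w) > \<epsilon>}) \<longlonglongrightarrow> 0"
    unfolding has_ito_integral_def by blast
  define S where "S j = simple_process_value (m j) (\<tau> j) (\<xi> j)" for j
  define N where "N j = simple_process_integral W (m j) (\<tau> j) (\<xi> j)" for j
  have tau0: "0 \<le> \<tau> j i" if "i \<le> m j" for i j
    using that
  proof (induction i)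
    case 0 then show ?case using simple[of j] by (simp add: simple_process_def)
  next
    case (Suc i)
    then have "\<tau> j i \<le> \<tau> j (Suc i)" using simple[of j] by (simp add: simple_process_def)
    then show ?case using Suc by simp
  qed
  have xi[measurable]: "\<xi> j i \<in> borel_measurable M" if "i < m j" for i j
    using simple[of j] that measurable_F_imp[of "\<xi> j i" "\<tau> j i"] by (auto simp: simple_process_def)
  have Sm[measurable]: "(\<lambda>(r, w). S j r w) \<in> borel_measurable (borel \<Otimes>\<^sub>M M)" for j
    unfolding S_def simple_process_value_def split_beta'
  proof (rule borel_measurable_sum)
    fix i assume "i \<in> {..<m j}"
    then have [measurable]: "\<xi> j i \<in> borel_measurable M" by simp
    show "(\<lambda>x. indicator {\<tau> j i<..\<tau> j (Suc i)} (fst x) *\<^sub>R \<xi> j i (snd x)) \<in> borel_measurable (borel \<Otimes>\<^sub>M M)"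
      by measurable
  qed
  have Nm[measurable]: "N j u \<in> borel_measurable M" if "0 \<le> u" for j u
    unfolding N_def simple_process_integral_def
  proof (rule borel_measurable_sum)
    fix i assume "i \<in> {..<m j}"
    then have i: "i < m j" by simp
    have [measurable]: "W (min (\<tau> j (Suc i)) u) \<in> borel_measurable M" "W (min (\<tau> j i) u) \<in> borel_measurable M"
      using tau0[of i j] tau0[of "Suc i" j] i that by (auto intro!: W_measurable)
    show "(\<lambda>w. \<xi> j i w *v (W (min (\<tau> j (Suc i)) u) w - W (min (\<tau> j i) u) w)) \<in> borel_measurable M"
      using xi[OF i] by measurable
  qed
  define Hc where "Hc r w = H (max 0 (min t r)) w" for r w
  have Hc: "Hc r w = H r w" if "r \<in> {0..t}" for r w using that by (auto simp: Hc_def min_def)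
  have Hm[measurable]: "(\<lambda>(r, w). Hc r w) \<in> borel_measurable (borel \<Otimes>\<^sub>M M)"
    unfolding Hc_def using progressive_clamp_measurable[OF H, of t] st by simp
  have Th0: "\<And>w. w \<in> space M \<Longrightarrow> 0 \<le> \<Theta> w" using G by force
  have Th[measurable]: "\<Theta> \<in> borel_measurable M" by (rule stop_measurable[OF Th0 stop])
  define a where "a j w r = (if s < r \<and> r \<le> t \<and> r \<le> \<Theta> w then row_combination l (S j r w) else 0)" for j w r
  define b where "b w r = (if s < r \<and> r \<le> t \<and> r \<le> \<Theta> w then row_combination l (Hc r w) else 0)" for w r
  have jm[measurable]: "(\<lambda>(w, r). a j w r) \<in> borel_measurable (M \<Otimes>\<^sub>M lborel)" 
      "(\<lambda>(w, r). b w r) \<in> borel_measurable (M \<Otimes>\<^sub>M lborel)" for j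
  proof -
    have 1: "(\<lambda>(w, r). (r, w)) \<in> (M \<Otimes>\<^sub>M lborel) \<rightarrow>\<^sub>M (borel \<Otimes>\<^sub>M M)" by measurable
    have [measurable]: "(\<lambda>p. S j (snd p) (fst p)) \<in> borel_measurable (M \<Otimes>\<^sub>M lborel)"
      "(\<lambda>p. Hc (snd p) (fst p)) \<in> borel_measurable (M \<Otimes>\<^sub>M lborel)"
      using measurable_compose[OF 1 Sm[of j]] measurable_compose[OF 1 Hm] by (simp_all add: split_beta')
    show "(\<lambda>(w, r). a j w r) \<in> borel_measurable (M \<Otimes>\<^sub>M lborel)"
      "(\<lambda>(w, r). b w r) \<in> borel_measurable (M \<Otimes>\<^sub>M lborel)"
      unfolding a_def b_def split_beta' by measurable
  qed
  have sec: "a j w \<in> borel_measurable lborel" "b w \<in> borel_measurable lborel" if "w \<in> space M" for j w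
    using measurable_Pair2[OF jm(1)[of j] that] measurable_Pair2[OF jm(2) that] by simp_all
  have qb: "q w = (LINT r|lborel. (norm (b w r))\<^sup>2)" for w
    unfolding q_def set_lebesgue_integral_def b_def
    using Hc st by (intro Bochner_Integration.integral_cong) (auto simp: indicator_def)
  define qj where "qj j w = (LINT r:{s<..t}|lborel. (if r \<le> \<Theta> w then (norm (row_combination l (S j r w)))\<^sup>2 else 0))" for j w
  have qja: "qj j w = (LINT r|lborel. (norm (a j w r))\<^sup>2)" for j w
    unfolding qj_def set_lebesgue_integral_def a_def
    by (intro Bochner_Integration.integral_cong) (auto simp: indicator_def)
  show qm[measurable]: "q \<in> borel_measurable M"
    unfolding qb[abs_def] by measurable
  have qjm[measurable]: "qj j \<in> borel_measurable M" for j
    unfolding qja[abs_def] by measurable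
  define T where "T = min t ` G \<union> min s ` G"
  have T: "finite T" "\<And>u. u \<in> T \<Longrightarrow> 0 \<le> u" using G st by (auto simp: T_def)
  have at: "(\<lambda>w. f (g w) w) \<in> borel_measurable M"
    if "\<And>u. u \<in> T \<Longrightarrow> f u \<in> borel_measurable M" "g \<in> borel_measurable M" "\<And>w. w \<in> space M \<Longrightarrow> g w \<in> T"
    for f :: "real \<Rightarrow> 'w \<Rightarrow> real^'n" and g
  proof -
    \<comment> \<open>A process evaluated at a random time with finitely many values is a finite sum
      over these values.\<close>
    have "(\<lambda>w. \<Sum>u\<in>T. if g w = u then f u w else 0) \<in> borel_measurable M"
    proof (rule borel_measurable_sum)
      fix u assume "u \<in> T"
      then have "f u \<in> borel_measurable M" by (rule that(1))
      moreover have "{w\<in>space M. g w = u} \<in> sets M"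
        using measurable_sets[OF that(2), of "{u}"] by (simp add: vimage_def Int_def conj_commute)
      ultimately show "(\<lambda>w. if g w = u then f u w else 0) \<in> borel_measurable M"
        by (intro measurable_If) auto
    qed
    moreover have "(\<Sum>u\<in>T. if g w = u then f u w else 0) = f (g w) w" if "w \<in> space M" for w
      using T(1) \<open>\<And>w. w \<in> space M \<Longrightarrow> g w \<in> T\<close>[OF that] by (simp add: sum.delta)
    ultimately show ?thesis by (simp cong: measurable_cong)
  qed
  have inT: "min t (\<Theta> w) \<in> T" "min s (\<Theta> w) \<in> T" if "w \<in> space M" for w
    using G(3)[OF that] by (auto simp: T_def)
  have at2: "(\<lambda>w. f (min t (\<Theta> w)) w) \<in> borel_measurable M" "(\<lambda>w. f (min s (\<Theta> w)) w) \<in> borel_measurable M"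
    if "\<And>u. u \<in> T \<Longrightarrow> f u \<in> borel_measurable M" for f :: "real \<Rightarrow> 'w \<Rightarrow> real^'n"
    by (rule at[of f "\<lambda>w. min t (\<Theta> w)", OF that _ inT(1)], assumption, measurable)
       (rule at[of f "\<lambda>w. min s (\<Theta> w)", OF that _ inT(2)], assumption, measurable)
  have [measurable]: "(\<lambda>w. I (min t (\<Theta> w)) w) \<in> borel_measurable M" "(\<lambda>w. I (min s (\<Theta> w)) w) \<in> borel_measurable M"
    using T(2) by (simp_all add: at2[of I])
  have [measurable]: "(\<lambda>w. N j (min t (\<Theta> w)) w) \<in> borel_measurable M" "(\<lambda>w. N j (min s (\<Theta> w)) w) \<in> borel_measurable M" for j
    using T(2) by (simp_all add: at2[of "N j"])
  show ym[measurable]: "y \<in> borel_measurable M" unfolding y_def by measurable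
  define yj where "yj j w = l \<bullet> (N j (min t (\<Theta> w)) w - N j (min s (\<Theta> w)) w)" for j w
  have yjm[measurable]: "yj j \<in> borel_measurable M" for j unfolding yj_def by measurable
  \<comment> \<open>The distance of the integrands (\<open>None\<close>) and the distances of the
    integrals at the relevant times (\<open>Some u\<close>) form one family, so that a single
    subsequence serves all of them.\<close>
  define d where "d i j w = (case i of None \<Rightarrow> (\<integral>\<^sup>+r\<in>{0..t}. ennreal ((norm (S j r w - Hc r w))\<^sup>2) \<partial>lborel)
     | Some u \<Rightarrow> ennreal (norm (N j u w - I u w)))" for i j w
  have dm: "d i j \<in> borel_measurable M" if "i \<in> insert None (Some ` T)" for i j
  proof (cases i)
    case None
    have 1: "(\<lambda>(w, r). (r, w)) \<in> (M \<Otimes>\<^sub>M lborel) \<rightarrow>\<^sub>M (borel \<Otimes>\<^sub>M M)" by measurable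
    have [measurable]: "(\<lambda>p. S j (snd p) (fst p)) \<in> borel_measurable (M \<Otimes>\<^sub>M lborel)"
      "(\<lambda>p. Hc (snd p) (fst p)) \<in> borel_measurable (M \<Otimes>\<^sub>M lborel)"
      using measurable_compose[OF 1 Sm[of j]] measurable_compose[OF 1 Hm] by (simp_all add: split_beta')
    have "(\<lambda>w. \<integral>\<^sup>+r. ennreal ((norm (S j r w - Hc r w))\<^sup>2) * indicator {0..t} r \<partial>lborel) \<in> borel_measurable M"
      by (rule lborel.borel_measurable_nn_integral) (simp add: split_beta')
    then show ?thesis by (simp add: d_def[abs_def] None)
  next
    case (Some u)
    then have "0 \<le> u" using that T by auto
    then show ?thesis using Nm[of u j] Im[of u] by (simp add: d_def[abs_def] Some)
  qed
  have dlim: "(\<lambda>j. prob {w\<in>space M. d i j w > ennreal \<epsilon>}) \<longlonglongrightarrow> 0"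
    if "i \<in> insert None (Some ` T)" "0 < \<epsilon>" for i \<epsilon>
  proof (cases i)
    case None
    have "d None j w = (\<integral>\<^sup>+s\<in>{0..t}. ennreal ((norm (S j s w - H s w))\<^sup>2) \<partial>lborel)" for j w
      unfolding d_def using Hc by (auto intro!: nn_integral_cong simp: indicator_def)
    then show ?thesis using conv(1)[of t \<epsilon>] st that by (simp add: None S_def)
  next
    case (Some u)
    then have "0 \<le> u" using that T by auto
    then show ?thesis using conv(2)[of u \<epsilon>] that by (simp add: d_def Some N_def ennreal_less_iff)
  qed
  obtain \<rho> where rho: "strict_mono \<rho>" "AE w in M. \<forall>i\<in>insert None (Some ` T). (\<lambda>j. d i (\<rho> j) w) \<longlonglongrightarrow> 0"
    using AE_subseq_of_convergence_in_prob[of "insert None (Some ` T)" d, OF _ dm dlim] T by auto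
  have AEc: "AE w in M. (\<lambda>j. yj (\<rho> j) w) \<longlonglongrightarrow> y w \<and> (\<lambda>j. qj (\<rho> j) w) \<longlonglongrightarrow> q w"
    using rho(2) finH AE_space
  proof eventually_elim
    case (elim w)
    have NI: "(\<lambda>j. N (\<rho> j) u w) \<longlonglongrightarrow> I u w" if "u \<in> T" for u
    proof -
      have "(\<lambda>j. ennreal (norm (N (\<rho> j) u w - I u w))) \<longlonglongrightarrow> 0"
        using elim(1) that by (auto simp: d_def)
      then have "(\<lambda>j. norm (N (\<rho> j) u w - I u w)) \<longlonglongrightarrow> 0"
        by (simp add: ennreal_tendsto_0_iff)
      then show ?thesis by (simp add: tendsto_norm_zero_iff LIM_zero_iff)
    qed
    have 1: "(\<lambda>j. yj (\<rho> j) w) \<longlonglongrightarrow> y w"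
      unfolding yj_def y_def using NI inT[OF elim(3)] by (intro tendsto_intros)
    have "(\<lambda>j. d None (\<rho> j) w) \<longlonglongrightarrow> 0" using elim(1) by auto
    then have dl: "(\<lambda>j. ennreal ((norm l)\<^sup>2) * d None (\<rho> j) w) \<longlonglongrightarrow> ennreal ((norm l)\<^sup>2) * 0"
      by (intro ennreal_tendsto_cmult) auto
    have le: "(\<integral>\<^sup>+r. ennreal ((norm (a (\<rho> j) w r - b w r))\<^sup>2) \<partial>lborel) \<le> ennreal ((norm l)\<^sup>2) * d None (\<rho> j) w" for j
    proof -
      have mS: "(\<lambda>r. S (\<rho> j) r w) \<in> borel_measurable lborel" "(\<lambda>r. Hc r w) \<in> borel_measurable lborel"
        using measurable_Pair1[OF Sm elim(3)] measurable_Pair1[OF Hm elim(3)] by simp_all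
      have "(\<integral>\<^sup>+r. ennreal ((norm (a (\<rho> j) w r - b w r))\<^sup>2) \<partial>lborel) \<le>
        (\<integral>\<^sup>+r. ennreal ((norm l)\<^sup>2) * (ennreal ((norm (S (\<rho> j) r w - Hc r w))\<^sup>2) * indicator {0..t} r) \<partial>lborel)"
      proof (rule nn_integral_mono)
        fix r
        have "norm (row_combination l (S (\<rho> j) r w) - row_combination l (Hc r w)) \<le> norm l * norm (S (\<rho> j) r w - Hc r w)"
          using norm_row_combination[of l "S (\<rho> j) r w - Hc r w"] by (simp add: row_combination_simps)
        then have "(norm (row_combination l (S (\<rho> j) r w) - row_combination l (Hc r w)))\<^sup>2 \<le> (norm l)\<^sup>2 * (norm (S (\<rho> j) r w - Hc r w))\<^sup>2"
          unfolding power_mult_distrib[symmetric] by (intro power_mono) auto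
        then show "ennreal ((norm (a (\<rho> j) w r - b w r))\<^sup>2) \<le> ennreal ((norm l)\<^sup>2) * (ennreal ((norm (S (\<rho> j) r w - Hc r w))\<^sup>2) * indicator {0..t} r)"
          using st by (auto simp: a_def b_def ennreal_mult[symmetric] indicator_def intro!: ennreal_leI)
      qed
      also have "\<dots> = ennreal ((norm l)\<^sup>2) * d None (\<rho> j) w"
        unfolding d_def using mS by (simp add: nn_integral_cmult)
      finally show ?thesis .
    qed
    have lim: "(\<lambda>j. \<integral>\<^sup>+r. ennreal ((norm (a (\<rho> j) w r - b w r))\<^sup>2) \<partial>lborel) \<longlonglongrightarrow> 0"
    proof (rule tendsto_sandwich[where f="\<lambda>_. 0" and h="\<lambda>j. ennreal ((norm l)\<^sup>2) * d None (\<rho> j) w"])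
      show "(\<lambda>j. ennreal ((norm l)\<^sup>2) * d None (\<rho> j) w) \<longlonglongrightarrow> 0" using dl by simp
      show "\<forall>\<^sub>F j in sequentially. (\<integral>\<^sup>+r. ennreal ((norm (a (\<rho> j) w r - b w r))\<^sup>2) \<partial>lborel) \<le> ennreal ((norm l)\<^sup>2) * d None (\<rho> j) w"
        by (rule always_eventually) (rule allI, rule le)
      show "(\<lambda>_. 0 :: ennreal) \<longlonglongrightarrow> 0" by (rule tendsto_const)
    qed (rule always_eventually, rule allI, rule zero_le)
    have "(\<integral>\<^sup>+r. ennreal ((norm (b w r))\<^sup>2) \<partial>lborel) \<le>
        (\<integral>\<^sup>+r. ennreal ((norm l)\<^sup>2) * (ennreal ((norm (Hc r w))\<^sup>2) * indicator {0..t} r) \<partial>lborel)"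
    proof (rule nn_integral_mono)
      fix r
      have "(norm (row_combination l (Hc r w)))\<^sup>2 \<le> (norm l)\<^sup>2 * (norm (Hc r w))\<^sup>2"
        unfolding power_mult_distrib[symmetric] using norm_row_combination by (intro power_mono) auto
      then show "ennreal ((norm (b w r))\<^sup>2) \<le> ennreal ((norm l)\<^sup>2) * (ennreal ((norm (Hc r w))\<^sup>2) * indicator {0..t} r)"
        using st by (auto simp: b_def ennreal_mult[symmetric] indicator_def intro!: ennreal_leI)
    qed
    also have "\<dots> = ennreal ((norm l)\<^sup>2) * (\<integral>\<^sup>+r\<in>{0..t}. ennreal ((norm (Hc r w))\<^sup>2) \<partial>lborel)"
      using measurable_Pair1[OF Hm elim(3)] by (simp add: nn_integral_cmult)
    also have "(\<integral>\<^sup>+r\<in>{0..t}. ennreal ((norm (Hc r w))\<^sup>2) \<partial>lborel) = (\<integral>\<^sup>+r\<in>{0..t}. ennreal ((norm (H r w))\<^sup>2) \<partial>lborel)"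
      using Hc by (auto intro!: nn_integral_cong simp: indicator_def)
    also have "ennreal ((norm l)\<^sup>2) * \<dots> < \<infinity>" using elim(2) by (simp add: ennreal_mult_less_top)
    finally have "(\<integral>\<^sup>+r. ennreal ((norm (b w r))\<^sup>2) \<partial>lborel) < \<infinity>" .
    from tendsto_integral_norm_square[OF sec(1)[OF elim(3)] sec(2)[OF elim(3)] lim this]
    have 2: "(\<lambda>j. qj (\<rho> j) w) \<longlonglongrightarrow> q w" by (simp add: qja qb)
    show ?case using 1 2 by simp
  qed
  \<comment> \<open>\<phi> is a continuous majorant of the indicator of \<open>{c..}\<close> that
    vanishes up to \<open>c - 1/2\<close>. Continuity lets the error term pass to the limit, which
    the indicator itself would not allow.\<close>
  have phi: "0 \<le> \<phi> x" "\<phi> x \<le> 1" "c \<le> x \<Longrightarrow> \<phi> x = 1" for x by (auto simp: \<phi>_def)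
  have [measurable]: "\<phi> \<in> borel_measurable borel" unfolding \<phi>_def by measurable
  have contphi: "isCont \<phi> x" for x unfolding \<phi>_def by (intro continuous_intros)
  have zM[measurable]: "\<zeta> \<in> borel_measurable M" using measurable_F_imp[OF z] .
  have D0: "0 \<le> D" if "w \<in> space M" for w using order_trans[OF norm_ge_zero D[OF that]] .
  let ?E = "\<lambda>y q w. \<zeta> w * (iexp (y w) * exp (min (q w) c / 2))"
  have Ebd: "norm (?E u v w) \<le> \<bar>D\<bar> * exp (c / 2)" if "w \<in> space M" for u v w
    using D[OF that] D0[OF that] by (auto simp: norm_mult intro!: mult_mono)
  have Em: "?E u v \<in> borel_measurable M" if [measurable]: "u \<in> borel_measurable M" "v \<in> borel_measurable M" for u v
    by measurable
  have Eint: "integrable M (?E u v)" if "u \<in> borel_measurable M" "v \<in> borel_measurable M" for u v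
    by (rule integrable_const_bound[OF _ Em[OF that]]) (use Ebd in auto)
  \<comment> \<open>The capped identity is exact for \<open>x\<close>, which differs from
    \<open>yj j\<close> only where \<open>qj j\<close> exceeds \<open>c\<close>; there each of the
    two exponentials is at most \<open>\<bar>D\<bar> * exp (c / 2)\<close>.\<close>
  have step: "norm ((CLINT w|M. ?E (yj j) (qj j) w) - (CLINT w|M. \<zeta> w)) \<le> (LINT w|M. 2 * \<bar>D\<bar> * exp (c / 2) * \<phi> (qj j w))" for j
  proof -
    have "\<exists>x. exp_increment s t x (\<lambda>w. min (qj j w) c) \<and> (\<forall>w\<in>space M. qj j w \<le> c \<longrightarrow> x w = yj j w)"
      unfolding qj_def yj_def S_def N_def
      by (rule conjunct2, rule exp_increment_simple_integral[OF simple G(1,3) stop st c]) assumption+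
    then obtain x where x: "exp_increment s t x (\<lambda>w. min (qj j w) c)"
      and xy: "\<And>w. w \<in> space M \<Longrightarrow> qj j w \<le> c \<Longrightarrow> x w = yj j w" by blast
    have xm[measurable]: "x \<in> borel_measurable M" using measurable_F_imp[OF exp_incrementD(1)[OF x]] .
    have "(CLINT w|M. \<zeta> w) = (CLINT w|M. ?E x (qj j) w)"
      using exp_incrementD(2)[OF x z D] by simp
    then have "norm ((CLINT w|M. ?E (yj j) (qj j) w) - (CLINT w|M. \<zeta> w)) = norm (CLINT w|M. ?E (yj j) (qj j) w - ?E x (qj j) w)"
      using Eint[OF yjm qjm] Eint[OF xm qjm] by simp
    also have "\<dots> \<le> (LINT w|M. norm (?E (yj j) (qj j) w - ?E x (qj j) w))" by (rule integral_norm_bound)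
    also have "\<dots> \<le> (LINT w|M. 2 * \<bar>D\<bar> * exp (c / 2) * \<phi> (qj j w))"
    proof (rule integral_mono)
      show "integrable M (\<lambda>w. norm (?E (yj j) (qj j) w - ?E x (qj j) w))"
        using Eint[OF yjm qjm] Eint[OF xm qjm] by simp
      show "integrable M (\<lambda>w. 2 * \<bar>D\<bar> * exp (c / 2) * \<phi> (qj j w))"
        by (intro integrable_mult_right integrable_const_bound[of _ 1]) (auto simp: phi)
      fix w assume w: "w \<in> space M"
      show "norm (?E (yj j) (qj j) w - ?E x (qj j) w) \<le> 2 * \<bar>D\<bar> * exp (c / 2) * \<phi> (qj j w)"
      proof (cases "qj j w \<le> c")
        case True then show ?thesis using xy[OF w] phi by simp
      next
        case False
        then show ?thesis using norm_triangle_ineq4[of "?E (yj j) (qj j) w" "?E x (qj j) w"]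
            Ebd[OF w, of "yj j" "qj j"] Ebd[OF w, of x "qj j"] phi(3)[of "qj j w"] by simp
      qed
    qed
    finally show ?thesis .
  qed
  have "(\<lambda>j. norm ((CLINT w|M. ?E (yj (\<rho> j)) (qj (\<rho> j)) w) - (CLINT w|M. \<zeta> w))) \<longlonglongrightarrow>
     norm ((CLINT w|M. ?E y q w) - (CLINT w|M. \<zeta> w))"
  proof (intro tendsto_norm tendsto_diff tendsto_const)
    show "(\<lambda>j. CLINT w|M. ?E (yj (\<rho> j)) (qj (\<rho> j)) w) \<longlonglongrightarrow> (CLINT w|M. ?E y q w)"
    proof (rule integral_dominated_convergence[where w="\<lambda>_. \<bar>D\<bar> * exp (c / 2)"])
      show "AE w in M. (\<lambda>j. ?E (yj (\<rho> j)) (qj (\<rho> j)) w) \<longlonglongrightarrow> ?E y q w"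
        using AEc by eventually_elim (intro tendsto_intros , simp_all)
      show "AE w in M. norm (?E (yj (\<rho> j)) (qj (\<rho> j)) w) \<le> \<bar>D\<bar> * exp (c / 2)" for j
        using Ebd by auto
    qed (use Em[OF ym qm] Em[OF yjm qjm] in auto)
  qed
  moreover have "(\<lambda>j. LINT w|M. 2 * \<bar>D\<bar> * exp (c / 2) * \<phi> (qj (\<rho> j) w)) \<longlonglongrightarrow> (LINT w|M. 2 * \<bar>D\<bar> * exp (c / 2) * \<phi> (q w))"
  proof (rule integral_dominated_convergence[where w="\<lambda>_. 2 * \<bar>D\<bar> * exp (c / 2)"])
    show "AE w in M. (\<lambda>j. 2 * \<bar>D\<bar> * exp (c / 2) * \<phi> (qj (\<rho> j) w)) \<longlonglongrightarrow> 2 * \<bar>D\<bar> * exp (c / 2) * \<phi> (q w)"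
      using AEc by eventually_elim (intro tendsto_intros isCont_tendsto_compose[OF contphi], auto)
    show "AE w in M. norm (2 * \<bar>D\<bar> * exp (c / 2) * \<phi> (qj (\<rho> j) w)) \<le> 2 * \<bar>D\<bar> * exp (c / 2)" for j
      using phi by (auto simp: abs_mult mult_left_le)
  qed auto
  ultimately show "norm ((CLINT w|M. ?E y q w) - (CLINT w|M. \<zeta> w)) \<le> (LINT w|M. 2 * \<bar>D\<bar> * exp (c / 2) * \<phi> (q w))"
    by (rule LIMSEQ_le) (use step in auto)
qed

text \<open>\<theta> is approximated from above by stopping times with finitely many values. The
  integrand is bounded only up to \<theta>, so the quadratic variation up to the approximating times
  is not controlled; this is why the finite case carries a cap and an error term. Path continuity of
  \<open>I\<close> gives the limit, in which the error disappears.\<close>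

lemma ito_integral_exp_martingale:
  fixes H :: "real \<Rightarrow> 'w \<Rightarrow> real ^ 'k ^ 'n" and \<theta> :: "'w \<Rightarrow> real" and l :: "real ^ 'n"
  assumes ito: "has_ito_integral M F W H I"
    and theta: "\<And>w. w \<in> space M \<Longrightarrow> 0 \<le> \<theta> w" "\<And>w. w \<in> space M \<Longrightarrow> \<theta> w \<le> T"
    and stop: "\<And>p. 0 \<le> p \<Longrightarrow> {w\<in>space M. \<theta> w \<le> p} \<in> sets (F p)"
    and K: "\<And>w r. w \<in> space M \<Longrightarrow> 0 \<le> r \<Longrightarrow> r \<le> \<theta> w \<Longrightarrow> norm (H r w) \<le> K"
    and st: "0 \<le> s" "s \<le> t"
  defines "q \<equiv> \<lambda>w. LINT r:{s<..t}|lborel. (if r \<le> \<theta> w then (norm (row_combination l (H r w)))\<^sup>2 else 0)"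
  defines "y \<equiv> \<lambda>w. l \<bullet> (I (min t (\<theta> w)) w - I (min s (\<theta> w)) w)"
  shows "y \<in> borel_measurable M" "q \<in> borel_measurable M"
    "\<And>w. w \<in> space M \<Longrightarrow> 0 \<le> q w \<and> q w \<le> (norm l * K)\<^sup>2 * (t - s)"
    "\<And>\<zeta> D. \<zeta> \<in> borel_measurable (F s) \<Longrightarrow> (\<And>w. w \<in> space M \<Longrightarrow> norm (\<zeta> w :: complex) \<le> D) \<Longrightarrow>
      (CLINT w|M. \<zeta> w * (iexp (y w) * exp (q w / 2))) = (CLINT w|M. \<zeta> w)"
proof -
  \<comment> \<open>One more than the bound on \<open>q\<close>, so that \<open>q\<close> stays
    below \<open>c - 1/2\<close>, where \<phi> is \<open>0\<close>.\<close>
  define c where "c = (norm l * K)\<^sup>2 * (t - s) + 1"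
  have c: "0 \<le> c" using st by (simp add: c_def)
  have H: "progressively_measurable F H" using ito by (simp add: has_ito_integral_def)
  have finH: "AE w in M. (\<integral>\<^sup>+r\<in>{0..t}. ennreal ((norm (H r w))\<^sup>2) \<partial>lborel) < \<infinity>"
    using ito st by (auto simp: has_ito_integral_def)
  have contI: "continuous_on {0..} (\<lambda>t. I t w)" if "w \<in> space M" for w
    using ito that unfolding has_ito_integral_def by blast
  define Hc where "Hc r w = H (max 0 (min t r)) w" for r w
  have Hc: "Hc r w = H r w" if "r \<in> {0..t}" for r w using that by (auto simp: Hc_def min_def)
  have Hm[measurable]: "(\<lambda>(r, w). Hc r w) \<in> borel_measurable (borel \<Otimes>\<^sub>M M)"
    unfolding Hc_def using progressive_clamp_measurable[OF H, of t] st by simp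
  have Th[measurable]: "\<theta> \<in> borel_measurable M" by (rule stop_measurable[OF theta(1) stop])
  define b where "b w r = (if s < r \<and> r \<le> t \<and> r \<le> \<theta> w then row_combination l (Hc r w) else 0)" for w r
  have jm[measurable]: "(\<lambda>(w, r). b w r) \<in> borel_measurable (M \<Otimes>\<^sub>M lborel)"
  proof -
    have 1: "(\<lambda>(w, r). (r, w)) \<in> (M \<Otimes>\<^sub>M lborel) \<rightarrow>\<^sub>M (borel \<Otimes>\<^sub>M M)" by measurable
    have [measurable]: "(\<lambda>p. Hc (snd p) (fst p)) \<in> borel_measurable (M \<Otimes>\<^sub>M lborel)"
      using measurable_compose[OF 1 Hm] by (simp_all add: split_beta')
    show ?thesis unfolding b_def split_beta' by measurable
  qed
  have qb: "q w = (LINT r|lborel. (norm (b w r))\<^sup>2)" for w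
    unfolding q_def set_lebesgue_integral_def b_def
    using Hc st by (intro Bochner_Integration.integral_cong) (auto simp: indicator_def)
  show qm[measurable]: "q \<in> borel_measurable M"
    unfolding qb[abs_def] by measurable
  show q0: "0 \<le> q w \<and> q w \<le> (norm l * K)\<^sup>2 * (t - s)" if w: "w \<in> space M" for w
  proof
    show "0 \<le> q w" by (simp add: qb)
    have "q w \<le> (LINT r|lborel. indicator {s<..t} r * (norm l * K)\<^sup>2)"
      unfolding q_def set_lebesgue_integral_def real_scaleR_def
    proof (rule integral_mono')
      show "integrable lborel (\<lambda>r. indicator {s<..t} r * (norm l * K)\<^sup>2)"
        using st by (intro integrable_mult_left integrable_real_indicator) auto
      fix r
      show "indicator {s<..t} r * (if r \<le> \<theta> w then (norm (row_combination l (H r w)))\<^sup>2 else 0) \<le> indicator {s<..t} r * (norm l * K)\<^sup>2"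
        using order_trans[OF norm_row_combination mult_left_mono[OF K[OF w, of r]], of l] st
        by (auto simp: indicator_def intro!: power_mono)
    qed simp
    also have "\<dots> = (norm l * K)\<^sup>2 * (t - s)" using st by simp
    finally show "q w \<le> (norm l * K)\<^sup>2 * (t - s)" .
  qed
  \<comment> \<open>Rounding up keeps a stopping time, as it only delays the decision. The grid is
    finite because \<theta> is bounded by \<open>T\<close>.\<close>
  define \<Theta> where "\<Theta> n w = real_of_int \<lceil>real (Suc n) * \<theta> w\<rceil> / real (Suc n)" for n w
  define G where "G n = (\<lambda>k. real_of_int k / real (Suc n)) ` {0..\<lceil>real (Suc n) * T\<rceil>}" for n
  have Thle: "\<theta> w \<le> \<Theta> n w" "\<Theta> n w \<le> \<theta> w + 1 / real (Suc n)" for n w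
  proof -
    show "\<theta> w \<le> \<Theta> n w" unfolding \<Theta>_def
      by (simp add: pos_le_divide_eq mult.commute del: of_nat_Suc)
    have "real_of_int \<lceil>real (Suc n) * \<theta> w\<rceil> \<le> real (Suc n) * \<theta> w + 1" by linarith
    then show "\<Theta> n w \<le> \<theta> w + 1 / real (Suc n)" unfolding \<Theta>_def
      by (simp add: pos_divide_le_eq distrib_left mult.commute del: of_nat_Suc)
  qed
  have Thlim: "(\<lambda>n. \<Theta> n w) \<longlonglongrightarrow> \<theta> w" for w
  proof (rule tendsto_sandwich[where f="\<lambda>_. \<theta> w" and h="\<lambda>n. \<theta> w + 1 / real (Suc n)"])
    have "(\<lambda>n. \<theta> w + 1 / real (Suc n)) \<longlonglongrightarrow> \<theta> w + 0"
      by (intro tendsto_intros LIMSEQ_Suc[OF lim_1_over_n])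
    then show "(\<lambda>n. \<theta> w + 1 / real (Suc n)) \<longlonglongrightarrow> \<theta> w" by simp
  qed (use Thle in auto)
  have G: "finite (G n)" "G n \<subseteq> {0..}" "\<And>w. w \<in> space M \<Longrightarrow> \<Theta> n w \<in> G n" for n
  proof -
    show "finite (G n)" "G n \<subseteq> {0..}" by (auto simp: G_def)
    fix w assume "w \<in> space M"
    then have "0 \<le> real (Suc n) * \<theta> w" "real (Suc n) * \<theta> w \<le> real (Suc n) * T"
      using theta[of w] by (auto intro!: mult_left_mono)
    then have "\<lceil>real (Suc n) * \<theta> w\<rceil> \<in> {0..\<lceil>real (Suc n) * T\<rceil>}"
      unfolding atLeastAtMost_iff by linarith
    then show "\<Theta> n w \<in> G n" unfolding G_def \<Theta>_def by (rule imageI)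
  qed
  have stopn: "{w\<in>space M. \<Theta> n w \<le> p} \<in> sets (F p)" if p: "0 \<le> p" for n p
  proof -
    \<comment> \<open>Rounding up is adjoint to rounding down: \<open>\<Theta> n w \<le> p\<close>
      says that \<open>\<theta> w \<le> p'\<close>, which is decided already at the time
      \<open>p' \<le> p\<close>.\<close>
    define p' where "p' = real_of_int \<lfloor>real (Suc n) * p\<rfloor> / real (Suc n)"
    have "real_of_int \<lfloor>real (Suc n) * p\<rfloor> \<le> real (Suc n) * p" by linarith
    then have pp: "0 \<le> p'" "p' \<le> p" using p
      by (simp_all add: p'_def pos_divide_le_eq mult.commute del: of_nat_Suc)
    have "\<Theta> n w \<le> p \<longleftrightarrow> \<theta> w \<le> p'" for w
    proof -
      have "\<Theta> n w \<le> p \<longleftrightarrow> real_of_int \<lceil>real (Suc n) * \<theta> w\<rceil> \<le> real (Suc n) * p"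
        by (simp add: \<Theta>_def pos_divide_le_eq mult.commute del: of_nat_Suc)
      also have "\<dots> \<longleftrightarrow> \<lceil>real (Suc n) * \<theta> w\<rceil> \<le> \<lfloor>real (Suc n) * p\<rfloor>" by linarith
      also have "\<dots> \<longleftrightarrow> real (Suc n) * \<theta> w \<le> real_of_int \<lfloor>real (Suc n) * p\<rfloor>" by linarith
      also have "\<dots> \<longleftrightarrow> \<theta> w \<le> p'" by (simp add: p'_def pos_le_divide_eq mult.commute del: of_nat_Suc)
      finally show ?thesis .
    qed
    then show ?thesis using stop[OF pp(1)] sets_F_mono[OF pp(2)] by auto
  qed
  define qn where "qn n w = (LINT r:{s<..t}|lborel. (if r \<le> \<Theta> n w then (norm (row_combination l (H r w)))\<^sup>2 else 0))" for n w
  define yn where "yn n w = l \<bullet> (I (min t (\<Theta> n w)) w - I (min s (\<Theta> n w)) w)" for n w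
  define \<phi> where "\<phi> x = min 1 (max 0 (2 * (x - c) + 1))" for x :: real
  have fin: "yn n \<in> borel_measurable M" "qn n \<in> borel_measurable M"
    "norm ((CLINT w|M. \<zeta> w * (iexp (yn n w) * exp (min (qn n w) c / 2))) - (CLINT w|M. \<zeta> w))
      \<le> (LINT w|M. 2 * \<bar>D\<bar> * exp (c / 2) * \<phi> (qn n w))"
    if z: "\<zeta> \<in> borel_measurable (F s)" and D: "\<And>w. w \<in> space M \<Longrightarrow> norm (\<zeta> w :: complex) \<le> D" for \<zeta> D n
    unfolding yn_def[abs_def] qn_def[abs_def] \<phi>_def[abs_def]
    using exp_increment_ito_integral_finite[OF ito G(1) G(2) G(3) stopn st c z D, where l=l] by simp_all
  have z0: "(\<lambda>_. 0 :: complex) \<in> borel_measurable (F s)" by simp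
  have yn[measurable]: "yn n \<in> borel_measurable M" and qn[measurable]: "qn n \<in> borel_measurable M" for n
    using fin(1,2)[OF z0, of 0 n] by simp_all
  have ylim: "(\<lambda>n. yn n w) \<longlonglongrightarrow> y w" if w: "w \<in> space M" for w
  proof -
    have "(\<lambda>n. I (min u (\<Theta> n w)) w) \<longlonglongrightarrow> I (min u (\<theta> w)) w" if "0 \<le> u" for u
    proof (rule continuous_on_tendsto_compose[OF contI[OF w]])
      show "(\<lambda>n. min u (\<Theta> n w)) \<longlonglongrightarrow> min u (\<theta> w)" by (intro tendsto_intros Thlim)
      show "min u (\<theta> w) \<in> {0..}" using that theta(1)[OF w] by simp
      show "\<forall>\<^sub>F n in sequentially. min u (\<Theta> n w) \<in> {0..}"
        using that order_trans[OF theta(1)[OF w] Thle(1)] by (intro always_eventually allI) simp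
    qed
    then show ?thesis unfolding yn_def y_def using st by (intro tendsto_intros) auto
  qed
  show ym[measurable]: "y \<in> borel_measurable M"
    by (rule borel_measurable_LIMSEQ_real[OF ylim yn])
  have qlim: "AE w in M. (\<lambda>n. qn n w) \<longlonglongrightarrow> q w"
    using finH AE_space
  proof eventually_elim
    case (elim w)
    \<comment> \<open>The integrand on the whole interval from \<open>s\<close> to \<open>t\<close>,
      regardless of \<theta>. Its square is integrable for almost every path and dominates the
      integrands stopped at any of the approximating times.\<close>
    define h where "h r = (if s < r \<and> r \<le> t then row_combination l (Hc r w) else 0)" for r
    have Hw[measurable]: "(\<lambda>r. Hc r w) \<in> borel_measurable lborel"
      using measurable_Pair1[OF Hm elim(2)] by simp
    have [measurable]: "h \<in> borel_measurable lborel" unfolding h_def by measurable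
    have "(\<integral>\<^sup>+r. ennreal ((norm (h r))\<^sup>2) \<partial>lborel) \<le>
        (\<integral>\<^sup>+r. ennreal ((norm l)\<^sup>2) * (ennreal ((norm (Hc r w))\<^sup>2) * indicator {0..t} r) \<partial>lborel)"
    proof (rule nn_integral_mono)
      fix r
      have "(norm (row_combination l (Hc r w)))\<^sup>2 \<le> (norm l)\<^sup>2 * (norm (Hc r w))\<^sup>2"
        unfolding power_mult_distrib[symmetric] using norm_row_combination by (intro power_mono) auto
      then show "ennreal ((norm (h r))\<^sup>2) \<le> ennreal ((norm l)\<^sup>2) * (ennreal ((norm (Hc r w))\<^sup>2) * indicator {0..t} r)"
        using st by (auto simp: h_def ennreal_mult[symmetric] indicator_def intro!: ennreal_leI)
    qed
    also have "\<dots> = ennreal ((norm l)\<^sup>2) * (\<integral>\<^sup>+r\<in>{0..t}. ennreal ((norm (Hc r w))\<^sup>2) \<partial>lborel)"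
      by (simp add: nn_integral_cmult)
    also have "(\<integral>\<^sup>+r\<in>{0..t}. ennreal ((norm (Hc r w))\<^sup>2) \<partial>lborel) = (\<integral>\<^sup>+r\<in>{0..t}. ennreal ((norm (H r w))\<^sup>2) \<partial>lborel)"
      using Hc by (auto intro!: nn_integral_cong simp: indicator_def)
    also have "ennreal ((norm l)\<^sup>2) * \<dots> < \<infinity>" using elim(1) by (simp add: ennreal_mult_less_top)
    finally have ih: "integrable lborel (\<lambda>r. (norm (h r))\<^sup>2)"
      by (intro integrableI_bounded) auto
    have qnh: "qn n w = (LINT r|lborel. indicator {..\<Theta> n w} r * (norm (h r))\<^sup>2)" for n
      unfolding qn_def set_lebesgue_integral_def h_def
      using Hc st by (intro Bochner_Integration.integral_cong) (auto simp: indicator_def)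
    have qh: "q w = (LINT r|lborel. indicator {..\<theta> w} r * (norm (h r))\<^sup>2)"
      unfolding q_def set_lebesgue_integral_def h_def
      using Hc st by (intro Bochner_Integration.integral_cong) (auto simp: indicator_def)
    show ?case unfolding qnh qh
    proof (rule integral_dominated_convergence[OF _ _ ih])
      show "AE r in lborel. (\<lambda>n. indicator {..\<Theta> n w} r * (norm (h r))\<^sup>2) \<longlonglongrightarrow> indicator {..\<theta> w} r * (norm (h r))\<^sup>2"
      proof (rule AE_I2)
        fix r
        have "\<forall>\<^sub>F n in sequentially. (indicator {..\<Theta> n w} r :: real) = indicator {..\<theta> w} r"
        \<comment> \<open>Approximation from above matters at \<open>r = \<theta> w\<close>: there
          all the indicators equal \<open>1\<close>.\<close>
        proof (cases "r \<le> \<theta> w")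
          case True
          then have "r \<le> \<Theta> n w" for n using Thle(1)[of w n] by linarith
          then show ?thesis using True by simp
        next
          case False
          then have "\<forall>\<^sub>F n in sequentially. \<Theta> n w < r" using order_tendstoD(2)[OF Thlim[of w], of r] by simp
          then show ?thesis by eventually_elim (use False in auto)
        qed
        then have "\<forall>\<^sub>F n in sequentially. indicator {..\<theta> w} r * (norm (h r))\<^sup>2 = indicator {..\<Theta> n w} r * (norm (h r))\<^sup>2"
          by eventually_elim simp
        then show "(\<lambda>n. indicator {..\<Theta> n w} r * (norm (h r))\<^sup>2) \<longlonglongrightarrow> indicator {..\<theta> w} r * (norm (h r))\<^sup>2"
          by (rule Lim_transform_eventually[OF tendsto_const])
      qed
    qed (auto simp: indicator_def)
  qed
  fix \<zeta> :: "'w \<Rightarrow> complex" and D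
  assume z: "\<zeta> \<in> borel_measurable (F s)" and D: "\<And>w. w \<in> space M \<Longrightarrow> norm (\<zeta> w) \<le> D"
  have [measurable]: "\<zeta> \<in> borel_measurable M" using measurable_F_imp[OF z] .
  have [measurable]: "\<phi> \<in> borel_measurable borel" unfolding \<phi>_def by measurable
  have contphi: "isCont \<phi> x" for x unfolding \<phi>_def by (intro continuous_intros)
  have phi: "0 \<le> \<phi> x" "\<phi> x \<le> 1" for x by (auto simp: \<phi>_def)
  have D0: "0 \<le> D" if "w \<in> space M" for w using order_trans[OF norm_ge_zero D[OF that]] .
  let ?E = "\<lambda>y q w. \<zeta> w * (iexp (y w) * exp (min (q w) c / 2))"
  have Ebd: "norm (?E u v w) \<le> \<bar>D\<bar> * exp (c / 2)" if "w \<in> space M" for u v w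
    using D[OF that] D0[OF that] by (auto simp: norm_mult intro!: mult_mono)
  have "(\<lambda>n. norm ((CLINT w|M. ?E (yn n) (qn n) w) - (CLINT w|M. \<zeta> w))) \<longlonglongrightarrow>
     norm ((CLINT w|M. ?E y q w) - (CLINT w|M. \<zeta> w))"
  proof (intro tendsto_norm tendsto_diff tendsto_const)
    show "(\<lambda>n. CLINT w|M. ?E (yn n) (qn n) w) \<longlonglongrightarrow> (CLINT w|M. ?E y q w)"
    proof (rule integral_dominated_convergence[where w="\<lambda>_. \<bar>D\<bar> * exp (c / 2)"])
      show "AE w in M. (\<lambda>n. ?E (yn n) (qn n) w) \<longlonglongrightarrow> ?E y q w"
        using qlim AE_space by eventually_elim (intro tendsto_intros ylim, simp_all)
      show "AE w in M. norm (?E (yn n) (qn n) w) \<le> \<bar>D\<bar> * exp (c / 2)" for n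
        using Ebd by auto
    qed auto
  qed
  moreover have "(\<lambda>n. LINT w|M. 2 * \<bar>D\<bar> * exp (c / 2) * \<phi> (qn n w)) \<longlonglongrightarrow> (LINT w|M. 2 * \<bar>D\<bar> * exp (c / 2) * \<phi> (q w))"
  proof (rule integral_dominated_convergence[where w="\<lambda>_. 2 * \<bar>D\<bar> * exp (c / 2)"])
    show "AE w in M. (\<lambda>n. 2 * \<bar>D\<bar> * exp (c / 2) * \<phi> (qn n w)) \<longlonglongrightarrow> 2 * \<bar>D\<bar> * exp (c / 2) * \<phi> (q w)"
      using qlim by eventually_elim (intro tendsto_intros isCont_tendsto_compose[OF contphi], simp_all)
    show "AE w in M. norm (2 * \<bar>D\<bar> * exp (c / 2) * \<phi> (qn n w)) \<le> 2 * \<bar>D\<bar> * exp (c / 2)" for n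
      using phi by (auto simp: abs_mult mult_left_le)
  qed auto
  ultimately have "norm ((CLINT w|M. ?E y q w) - (CLINT w|M. \<zeta> w)) \<le> (LINT w|M. 2 * \<bar>D\<bar> * exp (c / 2) * \<phi> (q w))"
    by (rule LIMSEQ_le) (use fin(3)[OF z D] in auto)
  also have "\<dots> = (LINT w|M. 0)"
  proof (rule Bochner_Integration.integral_cong[OF refl])
    fix w assume "w \<in> space M"
    then have "\<phi> (q w) = 0" using q0[of w] by (auto simp: \<phi>_def c_def max_def min_def)
    then show "2 * \<bar>D\<bar> * exp (c / 2) * \<phi> (q w) = 0" by simp
  qed
  finally have "(CLINT w|M. ?E y q w) = (CLINT w|M. \<zeta> w)" by simp
  moreover have "(CLINT w|M. ?E y q w) = (CLINT w|M. \<zeta> w * (iexp (y w) * exp (q w / 2)))"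
  proof (rule Bochner_Integration.integral_cong[OF refl])
    fix w assume "w \<in> space M"
    then have "min (q w) c = q w" using q0[of w] by (auto simp: c_def min_def)
    then show "?E y q w = \<zeta> w * (iexp (y w) * exp (q w / 2))" by simp
  qed
  ultimately show "(CLINT w|M. \<zeta> w * (iexp (y w) * exp (q w / 2))) = (CLINT w|M. \<zeta> w)" by simp
qed

end

section \<open>Moments from the exponential identity\<close>

lemma exp_minus_one_le: "0 \<le> p \<Longrightarrow> exp p - 1 \<le> p * exp (p::real)"
  using exp_ge_add_one_self[of "- p"] mult_left_mono[of "1 - p" "exp (- p)" "exp p"]
  by (simp add: exp_minus right_diff_distrib mult.commute)

lemma exp_minus_linear_le: 
  assumes "0 \<le> (p::real)" shows "exp p - 1 - p \<le> p\<^sup>2 * exp p"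
proof -
  have "exp p - 1 - p \<le> p * (exp p - 1)" using exp_minus_one_le[OF assms] by (simp add: algebra_simps)
  also have "\<dots> \<le> p * (p * exp p)" using exp_minus_one_le[OF assms] assms by (intro mult_left_mono)
  finally show ?thesis by (simp add: power2_eq_square)
qed

section \<open>Taylor bounds for sine and cosine\<close>

lemma Maclaurin_cos_bound:
  "\<bar>cos x - (\<Sum>m<n. cos_coeff m * x ^ m)\<bar> \<le> \<bar>x :: real\<bar> ^ n / fact n"
proof -
  obtain t where "cos x = (\<Sum>m<n. cos_coeff m * x ^ m) + (cos (t + 1/2 * real n * pi) / fact n) * x ^ n"
    using Maclaurin_cos_expansion[of x n] by blast
  then have "\<bar>cos x - (\<Sum>m<n. cos_coeff m * x ^ m)\<bar> = \<bar>cos (t + 1/2 * real n * pi)\<bar> * (\<bar>x\<bar> ^ n / fact n)"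
    by (simp add: abs_mult power_abs)
  also have "\<dots> \<le> 1 * (\<bar>x\<bar> ^ n / fact n)" by (intro mult_right_mono) auto
  finally show ?thesis by simp
qed

lemma abs_sin_minus_self_le: "\<bar>sin x - x\<bar> \<le> x\<^sup>2 / (2::real)"
  using Maclaurin_sin_bound[of x 2] by (simp add: sin_coeff_def numeral_2_eq_2 power2_eq_square)

lemma abs_cos_minus_quadratic_le: "\<bar>cos x - 1 + x\<^sup>2 / 2\<bar> \<le> \<bar>x::real\<bar> ^ 3 / 6"
  using Maclaurin_cos_bound[of x 3] by (simp add: cos_coeff_def eval_nat_numeral algebra_simps)

lemma cos_ge_quadratic: "0 \<le> cos x - 1 + x\<^sup>2 / (2::real)"
  using Maclaurin_cos_bound[of x 2] by (simp add: cos_coeff_def eval_nat_numeral abs_le_iff algebra_simps)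

lemma cos_ge_quartic: "x ^ 4 / 24 - \<bar>x::real\<bar> ^ 5 / 120 \<le> cos x - 1 + x\<^sup>2 / 2"
proof -
  have s: "{..<5::nat} = {0, 1, 2, 3, 4}" by auto
  have c: "(\<Sum>m<5. cos_coeff m * x ^ m) = 1 - x\<^sup>2 / 2 + x ^ 4 / 24"
    unfolding s by (simp add: cos_coeff_def fact_numeral)
  have f: "(fact 5 :: real) = 120" by (simp add: fact_numeral)
  show ?thesis using Maclaurin_cos_bound[of x 5] unfolding c f by linarith
qed

text \<open>Serves to compare coefficients of powers of \<mu>: after division by the leading power
  the remaining error is of order \<mu>.\<close>

lemma abs_le_scaled_imp_zero:
  fixes a :: real
  assumes "\<And>\<mu>. 0 < \<mu> \<Longrightarrow> \<mu> \<le> 1 \<Longrightarrow> \<bar>a\<bar> \<le> C * \<mu>"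
  shows "a = 0"
proof -
  have "(\<lambda>n. C * (1 / real (Suc n))) \<longlonglongrightarrow> C * 0"
    by (intro tendsto_intros LIMSEQ_Suc[OF lim_1_over_n])
  then have "\<bar>a\<bar> \<le> C * 0"
    by (rule LIMSEQ_le_const) (intro exI[of _ 0] allI impI assms, auto)
  then show ?thesis by simp
qed

context prob_space
begin

lemma abs_expectation_le:
  fixes f :: "'a \<Rightarrow> real"
  assumes "f \<in> borel_measurable M" "\<And>w. w \<in> space M \<Longrightarrow> \<bar>f w\<bar> \<le> C"
  shows "integrable M f" "\<bar>expectation f\<bar> \<le> C"
proof -
  show i: "integrable M f" by (rule integrable_const_bound[of _ C]) (use assms in auto)
  have "\<bar>expectation f\<bar> \<le> expectation (\<lambda>w. \<bar>f w\<bar>)" using integral_norm_bound[of M f] by simp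
  also have "\<dots> \<le> expectation (\<lambda>w. C)" using assms i by (intro integral_mono) auto
  finally show "\<bar>expectation f\<bar> \<le> C" by (simp add: prob_space)
qed

text \<open>Both sides are expanded in powers of \<mu> as \<mu> tends to 0. Order 1 of the imaginary
  part gives the first identity, order 2 of the real part the second, and order 4 with
  \<open>Z = 1\<close> the bound on the fourth moment. Boundedness of \<open>x\<close> and
  \<open>q\<close> makes the remainders uniform in the outcome.\<close>

lemma exp_martingale_moments:
  fixes x q Z :: "'a \<Rightarrow> real"
  assumes [measurable]: "x \<in> borel_measurable M" "q \<in> borel_measurable M" "Z \<in> borel_measurable M"
    and x: "\<And>w. w \<in> space M \<Longrightarrow> \<bar>x w\<bar> \<le> B" and q: "\<And>w. w \<in> space M \<Longrightarrow> 0 \<le> q w \<and> q w \<le> c"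
    and Z: "\<And>w. w \<in> space M \<Longrightarrow> \<bar>Z w\<bar> \<le> D"
    and eq: "\<And>\<mu>::real. (CLINT w|M. complex_of_real (Z w) * (iexp (\<mu> * x w) * exp (\<mu>\<^sup>2 * q w / 2))) = (CLINT w|M. complex_of_real (Z w))"
  shows "expectation (\<lambda>w. Z w * x w) = 0" "expectation (\<lambda>w. Z w * (x w)\<^sup>2) = expectation (\<lambda>w. Z w * q w)"
    "(\<And>w. w \<in> space M \<Longrightarrow> Z w = 1) \<Longrightarrow> expectation (\<lambda>w. (x w) ^ 4) \<le> 6 * c * expectation (\<lambda>w. (x w)\<^sup>2)"
proof -
  have ex: "\<exists>w. w \<in> space M" using not_empty by blast
  have B0: "0 \<le> B" and c0: "0 \<le> c" and D0: "0 \<le> D" using ex x q Z by force+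
  define p where "p \<mu> w = \<mu>\<^sup>2 * q w / 2" for \<mu> w
  have [measurable]: "p \<mu> \<in> borel_measurable M" for \<mu> unfolding p_def by measurable
  have p: "0 \<le> p \<mu> w" "p \<mu> w \<le> \<mu>\<^sup>2 * c / 2" if "w \<in> space M" for \<mu> w
    using q[OF that] by (auto simp: p_def intro!: mult_left_mono)
  have intb: "integrable M f" if "f \<in> borel_measurable M" "\<And>w. w \<in> space M \<Longrightarrow> \<bar>f w\<bar> \<le> C" for f :: "'a \<Rightarrow> real" and C
    by (rule abs_expectation_le(1)[OF that])
  have Zx: "integrable M (\<lambda>w. Z w * x w)" "integrable M (\<lambda>w. Z w * (x w)\<^sup>2)" "integrable M (\<lambda>w. Z w * q w)"
    "integrable M (\<lambda>w. (x w)\<^sup>2)" "integrable M (\<lambda>w. (x w) ^ 4)" "integrable M q" "integrable M Z"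
    "integrable M (\<lambda>w. \<bar>x w\<bar> ^ 5)"
  proof -
    show "integrable M (\<lambda>w. Z w * x w)" using Z x D0 by (intro intb[of _ "D * B"]) (auto simp: abs_mult intro!: mult_mono)
    show "integrable M (\<lambda>w. Z w * q w)" using Z q D0 by (intro intb[of _ "D * c"]) (auto simp: abs_mult intro!: mult_mono)
    have xp: "\<bar>x w\<bar> ^ k \<le> B ^ k" if "w \<in> space M" for w k using x[OF that] by (intro power_mono) auto
    show "integrable M (\<lambda>w. Z w * (x w)\<^sup>2)" using D0 Z xp[of _ 2]
      by (intro intb[of _ "D * B\<^sup>2"]) (auto simp: abs_mult intro!: mult_mono)
    show "integrable M (\<lambda>w. (x w)\<^sup>2)" using xp[of _ 2] by (intro intb[of _ "B\<^sup>2"]) auto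
    show "integrable M (\<lambda>w. (x w) ^ 4)" using xp[of _ 4] by (intro intb[of _ "B ^ 4"]) auto
    show "integrable M (\<lambda>w. \<bar>x w\<bar> ^ 5)" using xp[of _ 5] by (intro intb[of _ "B ^ 5"]) auto
    show "integrable M q" using q by (intro intb[of _ c]) auto
    show "integrable M Z" using Z by (intro intb[of _ D]) auto
  qed
  have pe: "p \<mu> w \<le> c / 2" "exp (p \<mu> w) \<le> exp (c / 2)" if "w \<in> space M" "0 < \<mu>" "\<mu> \<le> 1" for \<mu> w
  proof -
    have "\<mu>\<^sup>2 * c \<le> 1 * c" using that c0 by (intro mult_right_mono) (auto simp: power_le_one)
    then show "p \<mu> w \<le> c / 2" using p(2)[OF that(1), of \<mu>] by simp
    then show "exp (p \<mu> w) \<le> exp (c / 2)" by simp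
  qed
  have iE: "integrable M (\<lambda>w. Z w * (g (\<mu> * x w) * exp (p \<mu> w)))" if "0 < \<mu>" "\<mu> \<le> 1"
      and g[measurable]: "g \<in> borel_measurable borel" and "\<And>u. \<bar>g u\<bar> \<le> 1" for g :: "real \<Rightarrow> real" and \<mu>
  proof (rule intb[of _ "D * (1 * exp (c / 2))"])
    fix w assume w: "w \<in> space M"
    show "\<bar>Z w * (g (\<mu> * x w) * exp (p \<mu> w))\<bar> \<le> D * (1 * exp (c / 2))"
      unfolding abs_mult using Z[OF w] pe[OF w that(1,2)] that(4)[of "\<mu> * x w"] D0 by (intro mult_mono) auto
  qed measurable
  \<comment> \<open>These are the real and the imaginary part of the identity; \<open>Z\<close> is
    real, so the right-hand side has no imaginary part.\<close>
  have comp: "expectation (\<lambda>w. Z w * (cos (\<mu> * x w) * exp (p \<mu> w))) = expectation Z"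
      "expectation (\<lambda>w. Z w * (sin (\<mu> * x w) * exp (p \<mu> w))) = 0" if mu: "0 < \<mu>" "\<mu> \<le> 1" for \<mu>
  proof -
    let ?f = "\<lambda>w. complex_of_real (Z w) * (iexp (\<mu> * x w) * exp (\<mu>\<^sup>2 * q w / 2))"
    have re: "Re (?f w) = Z w * (cos (\<mu> * x w) * exp (p \<mu> w))" "Im (?f w) = Z w * (sin (\<mu> * x w) * exp (p \<mu> w))" for w
    proof -
      have e: "?f w = complex_of_real (Z w * exp (p \<mu> w)) * cis (\<mu> * x w)"
        by (simp add: p_def cis_conv_exp)
      show "Re (?f w) = Z w * (cos (\<mu> * x w) * exp (p \<mu> w))" "Im (?f w) = Z w * (sin (\<mu> * x w) * exp (p \<mu> w))"
        unfolding e times_complex.sel Re_complex_of_real Im_complex_of_real cis.sel by simp_all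
    qed
    have fi: "integrable M ?f"
    proof (rule integrable_const_bound[of _ "D * (1 * exp (c / 2))"])
      show "AE w in M. norm (?f w) \<le> D * (1 * exp (c / 2))"
      proof (rule AE_I2)
        fix w assume w: "w \<in> space M"
        show "norm (?f w) \<le> D * (1 * exp (c / 2))"
          unfolding norm_mult using Z[OF w] pe[OF w mu] D0 by (intro mult_mono) (auto simp: p_def)
      qed
    qed measurable
    have zi: "complex_integrable M (\<lambda>w. complex_of_real (Z w))" using Zx by simp
    have "Re (CLINT w|M. ?f w) = Re (CLINT w|M. complex_of_real (Z w))" by (simp only: eq)
    then show "expectation (\<lambda>w. Z w * (cos (\<mu> * x w) * exp (p \<mu> w))) = expectation Z"
      unfolding integral_Re[OF fi, symmetric] integral_Re[OF zi, symmetric] re by simp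
    have "Im (CLINT w|M. ?f w) = Im (CLINT w|M. complex_of_real (Z w))" by (simp only: eq)
    then show "expectation (\<lambda>w. Z w * (sin (\<mu> * x w) * exp (p \<mu> w))) = 0"
      unfolding integral_Im[OF fi, symmetric] integral_Im[OF zi, symmetric] re by simp
  qed
  have small: "\<bar>expectation f\<bar> \<le> C" if "\<And>w. w \<in> space M \<Longrightarrow> \<bar>f w\<bar> \<le> C" "f \<in> borel_measurable M"
    for f :: "'a \<Rightarrow> real" and C by (rule abs_expectation_le(2)[OF that(2,1)])
  have mx: "\<bar>\<mu> * x w\<bar> \<le> \<mu> * B" if "w \<in> space M" "0 < \<mu>" for w \<mu>
    using x[OF that(1)] that(2) by (simp add: abs_mult)
  show first: "expectation (\<lambda>w. Z w * x w) = 0"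
  proof (rule abs_le_scaled_imp_zero[where C="D * ((B\<^sup>2 / 2 + B * c / 2) * exp (c / 2))"])
    fix \<mu> :: real assume mu: "0 < \<mu>" "\<mu> \<le> 1"
    have "\<bar>expectation (\<lambda>w. Z w * (sin (\<mu> * x w) * exp (p \<mu> w)) - \<mu> * (Z w * x w))\<bar> \<le> D * (\<mu>\<^sup>2 * ((B\<^sup>2 / 2 + B * c / 2) * exp (c / 2)))"
    proof (rule small)
      fix w assume w: "w \<in> space M"
      let ?y = "\<mu> * x w"
      have yb: "\<bar>?y\<bar> \<le> \<mu> * B" by (rule mx[OF w mu(1)])
      have "?y\<^sup>2 \<le> (\<mu> * B)\<^sup>2" using yb by (rule power2_le_imp_le[OF _ ] | intro abs_le_square_iff[THEN iffD1]) (use B0 mu in auto)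
      have "\<bar>sin ?y * exp (p \<mu> w) - ?y\<bar> = \<bar>(sin ?y - ?y) * exp (p \<mu> w) + ?y * (exp (p \<mu> w) - 1)\<bar>"
        by (simp add: algebra_simps)
      also have "\<dots> \<le> \<bar>sin ?y - ?y\<bar> * exp (p \<mu> w) + \<bar>?y\<bar> * (exp (p \<mu> w) - 1)"
        using p(1)[OF w, of \<mu>] by (intro order_trans[OF abs_triangle_ineq]) (simp add: abs_mult)
      also have "\<dots> \<le> (\<mu> * B)\<^sup>2 / 2 * exp (c / 2) + (\<mu> * B) * ((\<mu>\<^sup>2 * c / 2) * exp (c / 2))"
      proof (intro add_mono mult_mono)
        show "\<bar>sin ?y - ?y\<bar> \<le> (\<mu> * B)\<^sup>2 / 2" using abs_sin_minus_self_le[of ?y] \<open>?y\<^sup>2 \<le> (\<mu> * B)\<^sup>2\<close> by simp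
        have "exp (p \<mu> w) - 1 \<le> p \<mu> w * exp (p \<mu> w)" using p(1)[OF w] by (rule exp_minus_one_le)
        also have "\<dots> \<le> (\<mu>\<^sup>2 * c / 2) * exp (c / 2)" using p[OF w, of \<mu>] pe[OF w mu] by (intro mult_mono) auto
        finally show "exp (p \<mu> w) - 1 \<le> (\<mu>\<^sup>2 * c / 2) * exp (c / 2)" .
      qed (use pe[OF w mu] yb p(1)[OF w, of \<mu>] mu B0 in auto)
      also have "\<dots> \<le> \<mu>\<^sup>2 * ((B\<^sup>2 / 2 + B * c / 2) * exp (c / 2))"
      proof -
        have "\<mu> * (\<mu>\<^sup>2 * (B * c / 2 * exp (c / 2))) \<le> 1 * (\<mu>\<^sup>2 * (B * c / 2 * exp (c / 2)))"
          using mu B0 c0 by (intro mult_right_mono) auto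
        then show ?thesis by (simp add: power2_eq_square algebra_simps)
      qed
      finally have *: "\<bar>sin ?y * exp (p \<mu> w) - ?y\<bar> \<le> \<mu>\<^sup>2 * ((B\<^sup>2 / 2 + B * c / 2) * exp (c / 2))" .
      have "\<bar>Z w * (sin ?y * exp (p \<mu> w)) - \<mu> * (Z w * x w)\<bar> = \<bar>Z w\<bar> * \<bar>sin ?y * exp (p \<mu> w) - ?y\<bar>"
        by (simp add: abs_mult[symmetric] algebra_simps)
      also have "\<dots> \<le> D * (\<mu>\<^sup>2 * ((B\<^sup>2 / 2 + B * c / 2) * exp (c / 2)))" using Z[OF w] * D0 by (intro mult_mono) auto
      finally show "\<bar>Z w * (sin ?y * exp (p \<mu> w)) - \<mu> * (Z w * x w)\<bar> \<le> D * (\<mu>\<^sup>2 * ((B\<^sup>2 / 2 + B * c / 2) * exp (c / 2)))" .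
    qed measurable
    also have "expectation (\<lambda>w. Z w * (sin (\<mu> * x w) * exp (p \<mu> w)) - \<mu> * (Z w * x w)) = - \<mu> * expectation (\<lambda>w. Z w * x w)"
      using iE[OF mu, of sin] Zx by (simp add: comp(2)[OF mu])
    finally have "\<mu> * \<bar>expectation (\<lambda>w. Z w * x w)\<bar> \<le> \<mu> * (D * ((B\<^sup>2 / 2 + B * c / 2) * exp (c / 2)) * \<mu>)"
      using mu by (simp add: abs_mult power2_eq_square mult_ac)
    then show "\<bar>expectation (\<lambda>w. Z w * x w)\<bar> \<le> D * ((B\<^sup>2 / 2 + B * c / 2) * exp (c / 2)) * \<mu>"
      using mu by simp
  qed
  \<comment> \<open>The three summands stem from the cubic error of the cosine, from its quadratic
    term times \<open>exp p - 1\<close>, and from \<open>exp p - 1 - p\<close>. For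
    \<open>\<mu> \<le> 1\<close> each contribution is at most of order
    \<open>\<mu> ^ 3\<close>.\<close>
  define C2 where "C2 = (B ^ 3 / 6 + B\<^sup>2 / 2 * (c / 2) + (c / 2)\<^sup>2) * exp (c / 2)"
  have "expectation (\<lambda>w. Z w * q w) / 2 - expectation (\<lambda>w. Z w * (x w)\<^sup>2) / 2 = 0"
  proof (rule abs_le_scaled_imp_zero[where C="D * C2"])
    fix \<mu> :: real assume mu: "0 < \<mu>" "\<mu> \<le> 1"
    have "\<bar>expectation (\<lambda>w. Z w * (cos (\<mu> * x w) * exp (p \<mu> w)) - Z w - \<mu>\<^sup>2 * (Z w * q w / 2 - Z w * (x w)\<^sup>2 / 2))\<bar> \<le> D * (\<mu> ^ 3 * C2)"
    proof (rule small)
      fix w assume w: "w \<in> space M"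
      let ?y = "\<mu> * x w" and ?p = "p \<mu> w"
      have yb: "\<bar>?y\<bar> \<le> \<mu> * B" by (rule mx[OF w mu(1)])
      have y2: "?y\<^sup>2 \<le> (\<mu> * B)\<^sup>2" using power_mono[OF yb, of 2] by simp
      have y3: "\<bar>?y\<bar> ^ 3 \<le> (\<mu> * B) ^ 3" using power_mono[OF yb, of 3] by simp
      have p0: "0 \<le> ?p" "?p \<le> \<mu>\<^sup>2 * c / 2" "exp ?p \<le> exp (c / 2)" using p[OF w, of \<mu>] pe[OF w mu] by auto
      have e1: "0 \<le> exp ?p - 1" "exp ?p - 1 \<le> (\<mu>\<^sup>2 * c / 2) * exp (c / 2)"
        using p0 order_trans[OF exp_minus_one_le[OF p0(1)] mult_mono[OF p0(2,3)]] by auto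
      have e2: "0 \<le> exp ?p - 1 - ?p" "exp ?p - 1 - ?p \<le> (\<mu>\<^sup>2 * c / 2)\<^sup>2 * exp (c / 2)"
      proof -
        show "0 \<le> exp ?p - 1 - ?p" using exp_ge_add_one_self[of ?p] by linarith
        show "exp ?p - 1 - ?p \<le> (\<mu>\<^sup>2 * c / 2)\<^sup>2 * exp (c / 2)"
          using p0 by (intro order_trans[OF exp_minus_linear_le mult_mono] power_mono) auto
      qed
      have "\<bar>cos ?y * exp ?p - 1 - (?p - ?y\<^sup>2 / 2)\<bar> =
        \<bar>(cos ?y - 1 + ?y\<^sup>2 / 2) * exp ?p - (?y\<^sup>2 / 2) * (exp ?p - 1) + (exp ?p - 1 - ?p)\<bar>"
        by (intro arg_cong[of _ _ abs]) (simp add: field_simps)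
      also have "\<dots> \<le> \<bar>cos ?y - 1 + ?y\<^sup>2 / 2\<bar> * exp ?p + (?y\<^sup>2 / 2) * (exp ?p - 1) + (exp ?p - 1 - ?p)"
        using e1 e2 abs_triangle_ineq4[of "(cos ?y - 1 + ?y\<^sup>2 / 2) * exp ?p" "(?y\<^sup>2 / 2) * (exp ?p - 1)"]
          abs_triangle_ineq[of "(cos ?y - 1 + ?y\<^sup>2 / 2) * exp ?p - (?y\<^sup>2 / 2) * (exp ?p - 1)" "exp ?p - 1 - ?p"]
        by (simp add: abs_mult)
      also have "\<dots> \<le> ((\<mu> * B) ^ 3 / 6) * exp (c / 2) + ((\<mu> * B)\<^sup>2 / 2) * ((\<mu>\<^sup>2 * c / 2) * exp (c / 2)) + (\<mu>\<^sup>2 * c / 2)\<^sup>2 * exp (c / 2)"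
      proof (intro add_mono mult_mono)
        show "\<bar>cos ?y - 1 + ?y\<^sup>2 / 2\<bar> \<le> (\<mu> * B) ^ 3 / 6" using abs_cos_minus_quadratic_le[of ?y] y3 by linarith
        show "?y\<^sup>2 / 2 \<le> (\<mu> * B)\<^sup>2 / 2" using y2 by linarith
      qed (use e1 e2 p0 mu B0 in auto)
      also have "\<dots> = (\<mu> ^ 3 * (B ^ 3 / 6) + \<mu> ^ 4 * (B\<^sup>2 / 2 * (c / 2)) + \<mu> ^ 4 * (c / 2)\<^sup>2) * exp (c / 2)"
        by (simp add: power2_eq_square eval_nat_numeral algebra_simps)
      also have "\<dots> \<le> (\<mu> ^ 3 * (B ^ 3 / 6) + \<mu> ^ 3 * (B\<^sup>2 / 2 * (c / 2)) + \<mu> ^ 3 * (c / 2)\<^sup>2) * exp (c / 2)"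
        using mu B0 c0 by (intro mult_right_mono add_mono) (auto intro!: power_decreasing)
      also have "\<dots> = \<mu> ^ 3 * C2" by (simp add: C2_def algebra_simps)
      finally have *: "\<bar>cos ?y * exp ?p - 1 - (?p - ?y\<^sup>2 / 2)\<bar> \<le> \<mu> ^ 3 * C2" .
      have "Z w * (cos ?y * exp ?p) - Z w - \<mu>\<^sup>2 * (Z w * q w / 2 - Z w * (x w)\<^sup>2 / 2) = Z w * (cos ?y * exp ?p - 1 - (?p - ?y\<^sup>2 / 2))"
        by (simp add: p_def power_mult_distrib algebra_simps)
      then have "\<bar>Z w * (cos ?y * exp ?p) - Z w - \<mu>\<^sup>2 * (Z w * q w / 2 - Z w * (x w)\<^sup>2 / 2)\<bar> = \<bar>Z w\<bar> * \<bar>cos ?y * exp ?p - 1 - (?p - ?y\<^sup>2 / 2)\<bar>"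
        by (simp only: abs_mult)
      also have "\<dots> \<le> D * (\<mu> ^ 3 * C2)" using Z[OF w] * D0 by (intro mult_mono) auto
      finally show "\<bar>Z w * (cos ?y * exp ?p) - Z w - \<mu>\<^sup>2 * (Z w * q w / 2 - Z w * (x w)\<^sup>2 / 2)\<bar> \<le> D * (\<mu> ^ 3 * C2)" .
    qed measurable
    also have "expectation (\<lambda>w. Z w * (cos (\<mu> * x w) * exp (p \<mu> w)) - Z w - \<mu>\<^sup>2 * (Z w * q w / 2 - Z w * (x w)\<^sup>2 / 2))
      = - \<mu>\<^sup>2 * (expectation (\<lambda>w. Z w * q w) / 2 - expectation (\<lambda>w. Z w * (x w)\<^sup>2) / 2)"
      using iE[OF mu, of cos] Zx by (simp add: comp(1)[OF mu])
    finally have "\<mu>\<^sup>2 * \<bar>expectation (\<lambda>w. Z w * q w) / 2 - expectation (\<lambda>w. Z w * (x w)\<^sup>2) / 2\<bar> \<le> \<mu>\<^sup>2 * (D * C2 * \<mu>)"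
      using mu by (simp add: abs_mult power2_eq_square power3_eq_cube mult_ac)
    then show "\<bar>expectation (\<lambda>w. Z w * q w) / 2 - expectation (\<lambda>w. Z w * (x w)\<^sup>2) / 2\<bar> \<le> D * C2 * \<mu>"
      using mu by simp
  qed
  then show second: "expectation (\<lambda>w. Z w * (x w)\<^sup>2) = expectation (\<lambda>w. Z w * q w)" by simp
  assume Z1: "\<And>w. w \<in> space M \<Longrightarrow> Z w = 1"
  have E2: "expectation q = expectation (\<lambda>w. (x w)\<^sup>2)"
    using second Z1 by (simp cong: Bochner_Integration.integral_cong)
  define m where "m = expectation (\<lambda>w. (x w)\<^sup>2)"
  have m0: "0 \<le> m" by (simp add: m_def)
  \<comment> \<open>The fourth order terms are bounded from one side only, as \<open>E e\<^sup>p \<ge> 1 + E p\<close>; this is all that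
    is needed.\<close>
  have key: "expectation (\<lambda>w. (x w) ^ 4) / 24 \<le> c / 4 * exp (\<mu>\<^sup>2 * c / 2) * m + \<mu> * (B ^ 5 / 120)" if mu: "0 < \<mu>" "\<mu> \<le> 1" for \<mu>
  proof -
    let ?y = "\<lambda>w. \<mu> * x w"
    have ic: "integrable M (\<lambda>w. cos (?y w) * exp (p \<mu> w))" 
      using iE[OF mu, of cos] Z1 by (simp cong: Bochner_Integration.integrable_cong)
    have Ec: "expectation (\<lambda>w. cos (?y w) * exp (p \<mu> w)) = 1"
      using comp(1)[OF mu] Z1 by (simp add: prob_space cong: Bochner_Integration.integral_cong)
    have ie: "integrable M (\<lambda>w. exp (p \<mu> w))" using pe[OF _ mu] by (intro intb[of _ "exp (c / 2)"]) auto
    have y2: "(?y w)\<^sup>2 \<le> B\<^sup>2" if "w \<in> space M" for w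
    proof -
      have "\<bar>?y w\<bar> \<le> B" using mx[OF that mu(1)] mu B0 mult_right_mono[of \<mu> 1 B] by simp
      then have "\<bar>?y w\<bar> ^ 2 \<le> B ^ 2" by (intro power_mono) auto
      then show ?thesis by simp
    qed
    have iy: "integrable M (\<lambda>w. (?y w)\<^sup>2 / 2 * exp (p \<mu> w))"
    proof (rule intb)
      fix w assume w: "w \<in> space M"
      have "(?y w)\<^sup>2 / 2 * exp (p \<mu> w) \<le> B\<^sup>2 / 2 * exp (c / 2)"
        using y2[OF w] pe[OF w mu] by (intro mult_mono) auto
      then show "\<bar>(?y w)\<^sup>2 / 2 * exp (p \<mu> w)\<bar> \<le> B\<^sup>2 / 2 * exp (c / 2)" by simp
    qed measurable
    have i1: "integrable M (\<lambda>w. p \<mu> w)" unfolding p_def using Zx by simp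
    have "expectation (\<lambda>w. (?y w) ^ 4 / 24 - \<bar>?y w\<bar> ^ 5 / 120) \<le> expectation (\<lambda>w. cos (?y w) * exp (p \<mu> w) - exp (p \<mu> w) + (?y w)\<^sup>2 / 2 * exp (p \<mu> w))"
    proof (rule integral_mono)
      show "integrable M (\<lambda>w. (?y w) ^ 4 / 24 - \<bar>?y w\<bar> ^ 5 / 120)"
        using Zx by (simp add: power_mult_distrib abs_mult)
      show "integrable M (\<lambda>w. cos (?y w) * exp (p \<mu> w) - exp (p \<mu> w) + (?y w)\<^sup>2 / 2 * exp (p \<mu> w))"
        using ic ie iy by simp
      fix w assume w: "w \<in> space M"
      \<comment> \<open>The bracket is nonnegative, so the factor
        \<open>exp (p \<mu> w) \<ge> 1\<close> only enlarges it, and the quartic lower bound of the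
        cosine carries over without loss.\<close>
      have "cos (?y w) - 1 + (?y w)\<^sup>2 / 2 \<le> (cos (?y w) - 1 + (?y w)\<^sup>2 / 2) * exp (p \<mu> w)"
        using mult_left_mono[of 1 "exp (p \<mu> w)", OF _ cos_ge_quadratic[of "?y w"]] p(1)[OF w, of \<mu>] by simp
      then show "(?y w) ^ 4 / 24 - \<bar>?y w\<bar> ^ 5 / 120 \<le> cos (?y w) * exp (p \<mu> w) - exp (p \<mu> w) + (?y w)\<^sup>2 / 2 * exp (p \<mu> w)"
        using cos_ge_quartic[of "?y w"] by (simp add: algebra_simps)
    qed
    also have "\<dots> = 1 - expectation (\<lambda>w. exp (p \<mu> w)) + expectation (\<lambda>w. (?y w)\<^sup>2 / 2 * exp (p \<mu> w))"
      using ic ie iy Ec by simp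
    also have "expectation (\<lambda>w. exp (p \<mu> w)) \<ge> expectation (\<lambda>w. 1 + p \<mu> w)"
      using ie i1 by (intro integral_mono) auto
    then have "1 - expectation (\<lambda>w. exp (p \<mu> w)) + expectation (\<lambda>w. (?y w)\<^sup>2 / 2 * exp (p \<mu> w)) \<le>
        1 - expectation (\<lambda>w. 1 + p \<mu> w) + expectation (\<lambda>w. (?y w)\<^sup>2 / 2 * exp (p \<mu> w))" by simp
    also have "expectation (\<lambda>w. 1 + p \<mu> w) = 1 + \<mu>\<^sup>2 * m / 2"
      using i1 Zx by (simp add: prob_space p_def E2 m_def)
    also have "expectation (\<lambda>w. (?y w)\<^sup>2 / 2 * exp (p \<mu> w)) \<le> expectation (\<lambda>w. (?y w)\<^sup>2 / 2 * (1 + (\<mu>\<^sup>2 * c / 2) * exp (\<mu>\<^sup>2 * c / 2)))"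
    proof (rule integral_mono[OF iy])
      show "integrable M (\<lambda>w. (?y w)\<^sup>2 / 2 * (1 + (\<mu>\<^sup>2 * c / 2) * exp (\<mu>\<^sup>2 * c / 2)))"
        using Zx by (simp add: power_mult_distrib)
      fix w assume w: "w \<in> space M"
      have "exp (p \<mu> w) - 1 \<le> (\<mu>\<^sup>2 * c / 2) * exp (\<mu>\<^sup>2 * c / 2)"
        using p[OF w, of \<mu>] by (intro order_trans[OF exp_minus_one_le mult_mono]) auto
      then show "(?y w)\<^sup>2 / 2 * exp (p \<mu> w) \<le> (?y w)\<^sup>2 / 2 * (1 + (\<mu>\<^sup>2 * c / 2) * exp (\<mu>\<^sup>2 * c / 2))"
        by (intro mult_left_mono) auto
    qed
    also have "expectation (\<lambda>w. (?y w)\<^sup>2 / 2 * (1 + (\<mu>\<^sup>2 * c / 2) * exp (\<mu>\<^sup>2 * c / 2))) =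
       \<mu>\<^sup>2 * m / 2 * (1 + (\<mu>\<^sup>2 * c / 2) * exp (\<mu>\<^sup>2 * c / 2))"
      by (simp add: m_def power_mult_distrib)
    \<comment> \<open>The terms of order \<open>\<mu>\<^sup>2\<close> cancel because
      \<open>q\<close> and \<open>x\<^sup>2\<close> have the same expectation.\<close>
    finally have "expectation (\<lambda>w. (?y w) ^ 4 / 24 - \<bar>?y w\<bar> ^ 5 / 120) \<le> \<mu> ^ 4 * (c / 4 * exp (\<mu>\<^sup>2 * c / 2) * m)"
      by (simp add: algebra_simps power2_eq_square eval_nat_numeral)
    moreover have "expectation (\<lambda>w. (?y w) ^ 4 / 24 - \<bar>?y w\<bar> ^ 5 / 120) = \<mu> ^ 4 * (expectation (\<lambda>w. (x w) ^ 4) / 24 - \<mu> * (expectation (\<lambda>w. \<bar>x w\<bar> ^ 5) / 120))"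
      using Zx mu by (simp add: power_mult_distrib abs_mult eval_nat_numeral algebra_simps)
    ultimately have "expectation (\<lambda>w. (x w) ^ 4) / 24 - \<mu> * (expectation (\<lambda>w. \<bar>x w\<bar> ^ 5) / 120) \<le> c / 4 * exp (\<mu>\<^sup>2 * c / 2) * m"
      using mu by simp
    moreover have "expectation (\<lambda>w. \<bar>x w\<bar> ^ 5) \<le> B ^ 5"
    proof -
      have "expectation (\<lambda>w. \<bar>x w\<bar> ^ 5) \<le> expectation (\<lambda>w. B ^ 5)"
        using Zx x by (intro integral_mono power_mono) auto
      then show ?thesis by (simp add: prob_space)
    qed
    then have "\<mu> * (expectation (\<lambda>w. \<bar>x w\<bar> ^ 5) / 120) \<le> \<mu> * (B ^ 5 / 120)"
      using mu by (intro mult_left_mono) auto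
    ultimately show ?thesis by linarith
  qed
  \<comment> \<open>As \<mu> tends to 0 the exponential factor tends to 1; the constant
    \<open>6 * c\<close> is \<open>24 * (c / 4)\<close>.\<close>
  have "(\<lambda>n. c / 4 * exp ((1 / real (Suc n))\<^sup>2 * c / 2) * m + (1 / real (Suc n)) * (B ^ 5 / 120)) \<longlonglongrightarrow>
     c / 4 * exp (0\<^sup>2 * c / 2) * m + 0 * (B ^ 5 / 120)"
    by (intro tendsto_intros LIMSEQ_Suc[OF lim_1_over_n]) auto
  then have "expectation (\<lambda>w. (x w) ^ 4) / 24 \<le> c / 4 * exp (0\<^sup>2 * c / 2) * m + 0 * (B ^ 5 / 120)"
    by (rule LIMSEQ_le_const) (intro exI[of _ 0] allI impI key, auto)
  then show "expectation (\<lambda>w. (x w) ^ 4) \<le> 6 * c * expectation (\<lambda>w. (x w)\<^sup>2)" by (simp add: m_def)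
qed

end

section \<open>Taylor expansion and the generator\<close>

lemma norm_matrix_vector_mult: "norm (A *v (d :: real ^ 'k)) \<le> norm (A :: real ^ 'k ^ 'n) * norm d"
proof -
  have "norm (A *v d) = L2_set (\<lambda>i. norm ((A *v d) $ i)) UNIV" by (simp add: norm_vec_def)
  also have "\<dots> \<le> L2_set (\<lambda>i. norm (A $ i) * norm d) UNIV"
  proof (rule L2_set_mono)
    fix i
    have "(A *v d) $ i = A $ i \<bullet> d" by (simp add: matrix_vector_mult_def inner_vec_def)
    then show "norm ((A *v d) $ i) \<le> norm (A $ i) * norm d" using Cauchy_Schwarz_ineq2 by simp
  qed simp
  also have "\<dots> = norm A * norm d" by (simp add: norm_vec_def L2_set_left_distrib)
  finally show ?thesis .
qed

lemma locally_lipschitz_continuous: "locally_lipschitz f \<Longrightarrow> continuous_on UNIV f"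
  unfolding continuous_on_eq_continuous_at[OF open_UNIV]
proof
  fix x assume "locally_lipschitz f"
  then obtain r L where r: "0 < r" "L-lipschitz_on (cball x r) f" unfolding locally_lipschitz_def by blast
  have "continuous_on (ball x r) f"
    using lipschitz_on_continuous_on[OF r(2)] ball_subset_cball by (rule continuous_on_subset)
  then show "continuous (at x) f" using r(1) by (simp add: continuous_on_eq_continuous_at)
qed

lemma twice_continuously_differentiableD:
  fixes v :: "real ^ 'n \<Rightarrow> real"
  assumes "twice_continuously_differentiable v"
  shows has_derivative_gradient: "(v has_derivative (\<lambda>h. gradient v x \<bullet> h)) (at x)"
    and has_derivative_hessian: "(gradient v has_derivative (\<lambda>h. hessian v x *v h)) (at x)"
    and continuous_hessian: "continuous_on UNIV (hessian v)"
    and continuous_gradient: "continuous_on UNIV (gradient v)"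
    and continuous_function: "continuous_on UNIV v"
proof -
  let ?D = "frechet_derivative v (at x)"
  have D: "(v has_derivative ?D) (at x)"
    using assms by (simp add: twice_continuously_differentiable_def frechet_derivative_works[symmetric])
  have lin: "linear ?D" using has_derivative_linear[OF D] .
  have "?D h = gradient v x \<bullet> h" for h
  proof -
    have "?D h = ?D (\<Sum>i\<in>UNIV. h $ i *s axis i 1)" by (simp add: basis_expansion)
    also have "\<dots> = (\<Sum>i\<in>UNIV. h $ i * ?D (axis i 1))"
      by (simp add: linear_sum[OF lin] scalar_mult_eq_scaleR linear_scale[OF lin])
    also have "\<dots> = gradient v x \<bullet> h" by (simp add: gradient_def inner_vec_def mult.commute)
    finally show ?thesis .
  qed
  then have "?D = (\<lambda>h. gradient v x \<bullet> h)" by auto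
  then show "(v has_derivative (\<lambda>h. gradient v x \<bullet> h)) (at x)" using D by simp
  have G: "(gradient v has_derivative frechet_derivative (gradient v) (at x)) (at x)" for x
    using assms by (simp add: twice_continuously_differentiable_def frechet_derivative_works[symmetric])
  have "hessian v x *v h = frechet_derivative (gradient v) (at x) h" for h
    unfolding hessian_def using fun_cong[OF matrix_vector_mul(2)[OF has_derivative_linear[OF G]], of x h] by simp
  then show "(gradient v has_derivative (\<lambda>h. hessian v x *v h)) (at x)" using G[of x] by simp
  show "continuous_on UNIV (hessian v)" using assms by (simp add: twice_continuously_differentiable_def)
  show "continuous_on UNIV (gradient v)"
    using G by (intro has_derivative_continuous_on[where f'="\<lambda>x. frechet_derivative (gradient v) (at x)"]) (auto intro: has_derivative_at_withinI)
  show "continuous_on UNIV v"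
    using assms by (auto simp: twice_continuously_differentiable_def continuous_on_eq_continuous_at differentiable_imp_continuous_within)
qed

text \<open>Maclaurin's formula for the restriction of \<open>v\<close> to the segment from
  \<open>x\<close> to \<open>x + d\<close>; in the proof, \<open>f\<close> lists this restriction
  and its first two derivatives.\<close>

lemma second_order_Taylor:
  fixes v :: "real ^ 'n \<Rightarrow> real"
  assumes v: "twice_continuously_differentiable v"
  shows "\<exists>t. 0 < t \<and> t < 1 \<and> v (x + d) = v x + gradient v x \<bullet> d + (d \<bullet> (hessian v (x + t *\<^sub>R d) *v d)) / 2"
proof -
  define f where "f m t = (if m = 0 then v (x + t *\<^sub>R d) else if m = Suc 0 then gradient v (x + t *\<^sub>R d) \<bullet> d
    else d \<bullet> (hessian v (x + t *\<^sub>R d) *v d))" for m :: nat and t :: real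
  have f: "f 0 = (\<lambda>t. v (x + t *\<^sub>R d))" "f (Suc 0) = (\<lambda>t. gradient v (x + t *\<^sub>R d) \<bullet> d)"
      "f (Suc (Suc 0)) = (\<lambda>t. d \<bullet> (hessian v (x + t *\<^sub>R d) *v d))"
    by (rule ext, simp add: f_def)+
  have l: "((\<lambda>t. x + t *\<^sub>R d) has_derivative (\<lambda>h. h *\<^sub>R d)) (at t)" for t
    by (auto intro!: derivative_eq_intros)
  have "\<exists>t>0. t < 1 \<and> v (x + 1 *\<^sub>R d) = (\<Sum>m<2. f m 0 / fact m * 1 ^ m) + f 2 t / fact 2 * 1 ^ 2"
  proof (rule Maclaurin)
    show "f 0 = (\<lambda>t. v (x + t *\<^sub>R d))" by (rule f)
    show "\<forall>m t. m < 2 \<and> 0 \<le> t \<and> t \<le> 1 \<longrightarrow> DERIV (f m) t :> f (Suc m) t"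
    proof (intro allI impI)
      fix m t assume "m < (2::nat) \<and> 0 \<le> t \<and> t \<le> (1::real)"
      then consider "m = 0" | "m = 1" by linarith
      then show "DERIV (f m) t :> f (Suc m) t"
      proof cases
        case 1
        have "((\<lambda>t. v (x + t *\<^sub>R d)) has_derivative (\<lambda>h. gradient v (x + t *\<^sub>R d) \<bullet> (h *\<^sub>R d))) (at t)"
          by (rule has_derivative_compose[OF l has_derivative_gradient[OF v]])
        then show ?thesis using 1 by (simp add: f has_field_derivative_def mult.commute[of _ "gradient v _ \<bullet> d"])
      next
        case 2
        have "((\<lambda>t. gradient v (x + t *\<^sub>R d)) has_derivative (\<lambda>h. hessian v (x + t *\<^sub>R d) *v (h *\<^sub>R d))) (at t)"
          by (rule has_derivative_compose[OF l has_derivative_hessian[OF v]])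
        then have "((\<lambda>t. gradient v (x + t *\<^sub>R d) \<bullet> d) has_derivative (\<lambda>h. (hessian v (x + t *\<^sub>R d) *v (h *\<^sub>R d)) \<bullet> d)) (at t)"
          by (rule has_derivative_inner_left)
        moreover have "(\<lambda>h. (hessian v (x + t *\<^sub>R d) *v (h *\<^sub>R d)) \<bullet> d) = (*) (d \<bullet> (hessian v (x + t *\<^sub>R d) *v d))"
          by (auto simp: matrix_vector_mult_scaleR inner_commute)
        ultimately show ?thesis using 2 by (simp add: f has_field_derivative_def)
      qed
    qed
  qed auto
  then show ?thesis by (auto simp: f numeral_2_eq_2 lessThan_Suc)
qed

text \<open>Near the diagonal uniform continuity bounds \<open>g\<close> by \<epsilon>; at distance
  at least \<delta> a global bound \<open>B\<close> is at most \<open>B / \<delta>\<^sup>2\<close>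
  times the squared distance. A modulus of continuity is thus traded for a quadratic term, whose
  expectation is controlled by second moments.\<close>

lemma compact_diagonal_modulus:
  fixes g :: "'a::real_normed_vector \<Rightarrow> 'a \<Rightarrow> 'b::real_normed_vector"
  assumes K: "compact K" and g: "continuous_on (K \<times> K) (\<lambda>p. g (fst p) (snd p))"
    and diag: "\<And>x. x \<in> K \<Longrightarrow> g x x = 0" and \<epsilon>: "0 < \<epsilon>"
  shows "\<exists>C\<ge>0. \<forall>x\<in>K. \<forall>y\<in>K. norm (g x y) \<le> \<epsilon> + C * (norm (x - y))\<^sup>2"
proof -
  have KK: "compact (K \<times> K)" using K by (rule compact_Times[OF K])
  have "uniformly_continuous_on (K \<times> K) (\<lambda>p. g (fst p) (snd p))"
    by (rule compact_uniformly_continuous[OF g KK])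
  then obtain \<delta> where d: "0 < \<delta>" "\<And>p p'. p \<in> K \<times> K \<Longrightarrow> p' \<in> K \<times> K \<Longrightarrow> dist p' p < \<delta> \<Longrightarrow>
      dist (g (fst p') (snd p')) (g (fst p) (snd p)) < \<epsilon>"
    using \<epsilon> unfolding uniformly_continuous_on_def by metis
  have "bounded ((\<lambda>p. g (fst p) (snd p)) ` (K \<times> K))"
    by (rule compact_imp_bounded[OF compact_continuous_image[OF g KK]])
  then obtain B where B: "0 < B" "\<And>x y. x \<in> K \<Longrightarrow> y \<in> K \<Longrightarrow> norm (g x y) \<le> B"
    unfolding bounded_pos by force
  show ?thesis
  proof (intro exI[of _ "B / \<delta>\<^sup>2"] conjI ballI)
    show "0 \<le> B / \<delta>\<^sup>2" using B by simp
    fix x y assume xy: "x \<in> K" "y \<in> K"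
    show "norm (g x y) \<le> \<epsilon> + B / \<delta>\<^sup>2 * (norm (x - y))\<^sup>2"
    proof (cases "norm (x - y) < \<delta>")
      case True
      then have "dist (x, y) (x, x) < \<delta>" by (simp add: dist_prod_def dist_norm norm_minus_commute)
      then have "norm (g x y) < \<epsilon>" using d(2)[of "(x, x)" "(x, y)"] xy diag by simp
      then show ?thesis using B by (smt (verit) divide_nonneg_nonneg mult_nonneg_nonneg zero_le_power2)
    next
      case False
      then have "\<delta>\<^sup>2 \<le> (norm (x - y))\<^sup>2" using d(1) by (intro power_mono) auto
      then have "B / \<delta>\<^sup>2 * \<delta>\<^sup>2 \<le> B / \<delta>\<^sup>2 * (norm (x - y))\<^sup>2" using B by (intro mult_left_mono) auto
      then show ?thesis using B(2)[OF xy] d(1) \<epsilon> by simp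
    qed
  qed
qed

text \<open>The remainder is governed by the oscillation of the Hessian along the segment. Its bound
  by \<epsilon> plus a multiple of the squared distance produces the fourth power. Convexity keeps
  the intermediate point in \<open>K\<close>.\<close>

lemma second_order_remainder:
  fixes v :: "real ^ 'n \<Rightarrow> real"
  assumes v: "twice_continuously_differentiable v" and K: "compact K" "convex K" and \<epsilon>: "0 < \<epsilon>"
  shows "\<exists>C\<ge>0. \<forall>x\<in>K. \<forall>y\<in>K.
    \<bar>v y - v x - gradient v x \<bullet> (y - x) - ((y - x) \<bullet> (hessian v x *v (y - x))) / 2\<bar> \<le> \<epsilon> * (norm (y - x))\<^sup>2 + C * (norm (y - x)) ^ 4"
proof -
  have "continuous_on (K \<times> K) (\<lambda>p. hessian v (snd p) - hessian v (fst p))"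
    by (intro continuous_intros continuous_on_compose2[OF continuous_hessian[OF v]]) auto
  from compact_diagonal_modulus[OF K(1) this _ \<epsilon>]
  obtain C where C: "0 \<le> C" "\<And>x y. x \<in> K \<Longrightarrow> y \<in> K \<Longrightarrow> norm (hessian v y - hessian v x) \<le> \<epsilon> + C * (norm (x - y))\<^sup>2" by auto
  show ?thesis
  proof (intro exI[of _ C] conjI ballI C(1))
    fix x y assume xy: "x \<in> K" "y \<in> K"
    define d where "d = y - x"
    obtain t where t: "0 < t" "t < 1" "v (x + d) = v x + gradient v x \<bullet> d + (d \<bullet> (hessian v (x + t *\<^sub>R d) *v d)) / 2"
      using second_order_Taylor[OF v] by blast
    let ?z = "x + t *\<^sub>R d"
    have "?z = (1 - t) *\<^sub>R x + t *\<^sub>R y" by (simp add: d_def algebra_simps)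
    then have z: "?z \<in> K" using K(2) xy t by (simp add: convexD)
    have "v y - v x - gradient v x \<bullet> d - (d \<bullet> (hessian v x *v d)) / 2 = (d \<bullet> ((hessian v ?z - hessian v x) *v d)) / 2"
      using t(3) by (simp add: d_def matrix_vector_mult_diff_rdistrib inner_diff_right field_simps)
    then have "\<bar>v y - v x - gradient v x \<bullet> d - (d \<bullet> (hessian v x *v d)) / 2\<bar> \<le> \<bar>d \<bullet> ((hessian v ?z - hessian v x) *v d)\<bar>" by simp
    also have "\<dots> \<le> norm d * (norm (hessian v ?z - hessian v x) * norm d)"
      by (rule order_trans[OF Cauchy_Schwarz_ineq2 mult_left_mono[OF norm_matrix_vector_mult]]) simp
    also have "\<dots> \<le> norm d * ((\<epsilon> + C * (norm d)\<^sup>2) * norm d)"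
    proof (intro mult_left_mono mult_right_mono)
      have "norm (x - ?z) \<le> norm d" using t by (simp add: mult_left_le_one_le)
      then have "C * (norm (x - ?z))\<^sup>2 \<le> C * (norm d)\<^sup>2" using C(1) by (intro mult_left_mono power_mono) auto
      then show "norm (hessian v ?z - hessian v x) \<le> \<epsilon> + C * (norm d)\<^sup>2" using C(2)[OF xy(1) z] by linarith
    qed auto
    also have "\<dots> = \<epsilon> * (norm d)\<^sup>2 + C * (norm d) ^ 4" by (simp add: eval_nat_numeral algebra_simps)
    finally show "\<bar>v y - v x - gradient v x \<bullet> (y - x) - ((y - x) \<bullet> (hessian v x *v (y - x))) / 2\<bar> \<le> \<epsilon> * (norm (y - x))\<^sup>2 + C * (norm (y - x)) ^ 4"
      by (simp add: d_def)
  qed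
qed

text \<open>Derivatives of \<open>v\<close> at \<open>x\<close>, coefficients of the equation at \<open>y\<close>: this is what a Taylor expansion at the left
  end of a time interval produces.\<close>

definition mixed_generator ::
  "(real ^ 'n \<Rightarrow> real ^ 'n) \<Rightarrow> (real ^ 'n \<Rightarrow> real ^ 'k ^ 'n) \<Rightarrow> (real ^ 'n \<Rightarrow> real) \<Rightarrow> real ^ 'n \<Rightarrow> real ^ 'n \<Rightarrow> real" where
  "mixed_generator b \<sigma> v x y =
     gradient v x \<bullet> b y + (\<Sum>i\<in>UNIV. \<Sum>j\<in>UNIV. hessian v x $ i $ j * (\<sigma> y $ i \<bullet> \<sigma> y $ j)) / 2"

text \<open>The trace is rewritten as the entries of the Hessian against inner products of the rows
  of \<sigma>, the form in which covariations of the components arise.\<close>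

lemma mixed_generator_diag: "mixed_generator b \<sigma> v x x = generator b \<sigma> v x"
proof -
  have "trace (transpose (\<sigma> x) ** hessian v x ** \<sigma> x) =
      (\<Sum>k\<in>UNIV. \<Sum>j\<in>UNIV. (\<Sum>i\<in>UNIV. \<sigma> x $ i $ k * hessian v x $ i $ j) * \<sigma> x $ j $ k)"
    by (simp add: trace_def matrix_matrix_mult_def transpose_def)
  also have "\<dots> = (\<Sum>k\<in>UNIV. \<Sum>j\<in>UNIV. \<Sum>i\<in>UNIV. hessian v x $ i $ j * (\<sigma> x $ i $ k * \<sigma> x $ j $ k))"
    by (simp add: sum_distrib_right sum_distrib_left mult_ac)
  also have "\<dots> = (\<Sum>j\<in>UNIV. \<Sum>k\<in>UNIV. \<Sum>i\<in>UNIV. hessian v x $ i $ j * (\<sigma> x $ i $ k * \<sigma> x $ j $ k))"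
    by (rule sum.swap)
  also have "\<dots> = (\<Sum>j\<in>UNIV. \<Sum>i\<in>UNIV. \<Sum>k\<in>UNIV. hessian v x $ i $ j * (\<sigma> x $ i $ k * \<sigma> x $ j $ k))"
    by (rule sum.cong[OF refl], rule sum.swap)
  also have "\<dots> = (\<Sum>i\<in>UNIV. \<Sum>j\<in>UNIV. \<Sum>k\<in>UNIV. hessian v x $ i $ j * (\<sigma> x $ i $ k * \<sigma> x $ j $ k))"
    by (rule sum.swap)
  also have "\<dots> = (\<Sum>i\<in>UNIV. \<Sum>j\<in>UNIV. hessian v x $ i $ j * (\<sigma> x $ i \<bullet> \<sigma> x $ j))"
    by (simp add: inner_vec_def sum_distrib_left)
  finally show ?thesis by (simp add: mixed_generator_def generator_def)
qed

lemma continuous_mixed_generator: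
  assumes "twice_continuously_differentiable v" "continuous_on UNIV b" "continuous_on UNIV \<sigma>"
  shows "continuous_on UNIV (\<lambda>p. mixed_generator b \<sigma> v (fst p) (snd p))"
  unfolding mixed_generator_def
  by (intro continuous_intros continuous_on_compose2[OF continuous_gradient[OF assms(1)]]
      continuous_on_compose2[OF continuous_hessian[OF assms(1)]] continuous_on_compose2[OF assms(2)] 
      continuous_on_compose2[OF assms(3)]) auto

section \<open>The stopped diffusion\<close>

lemma row_combination_scale: "row_combination (c *\<^sub>R l) A = c *\<^sub>R row_combination l A"
  by (simp add: row_combination_def scaleR_sum_right)

lemma row_combination_axis: "row_combination (axis i 1) A = A $ i"
  by (simp add: row_combination_def axis_def if_distrib[of "\<lambda>x. x *\<^sub>R _"] cong: if_cong)

lemma row_combination_add_left: "row_combination (l + l') A = row_combination l A + row_combination l' A"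
  by (simp add: row_combination_def scaleR_add_left sum.distrib)

lemma set_integral_Ioc_bound:
  fixes f :: "real \<Rightarrow> 'a::{banach, second_countable_topology}"
  assumes "s \<le> t" and bd: "\<And>r. s < r \<Longrightarrow> r \<le> t \<Longrightarrow> norm (f r) \<le> C"
  shows "norm (LINT r:{s<..t}|lborel. f r) \<le> C * (t - s)"
proof (cases "s = t")
  case False
  then have "0 \<le> C" using order_trans[OF norm_ge_zero bd[of t]] assms by simp
  have "norm (LINT r:{s<..t}|lborel. f r) \<le> (LINT r|lborel. norm (indicator {s<..t} r *\<^sub>R f r))"
    unfolding set_lebesgue_integral_def by (rule integral_norm_bound)
  also have "\<dots> \<le> (LINT r|lborel. indicator {s<..t} r * C)"
  proof (rule integral_mono')
    show "integrable lborel (\<lambda>r. indicator {s<..t} r * C)"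
      using assms by (intro integrable_mult_left integrable_real_indicator) auto
  qed (use bd \<open>0 \<le> C\<close> in \<open>auto simp: indicator_def\<close>)
  also have "\<dots> = C * (t - s)" using assms by simp
  finally show ?thesis .
qed (simp add: set_lebesgue_integral_def)

text \<open>A discretisation of time for measurability proofs: it takes countably many values, and
  rounding down never leaves the range in which a path is defined and already known.\<close>

lemma floor_grid:
  fixes r :: real
  shows "real_of_int \<lfloor>real (Suc n) * r\<rfloor> / real (Suc n) \<le> r"
    and "(\<lambda>n. real_of_int \<lfloor>real (Suc n) * r\<rfloor> / real (Suc n)) \<longlonglongrightarrow> r"
proof -
  let ?g = "\<lambda>n. real_of_int \<lfloor>real (Suc n) * r\<rfloor> / real (Suc n)"
  have *: "real_of_int \<lfloor>real (Suc n) * r\<rfloor> \<le> real (Suc n) * r"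
    "real (Suc n) * r - 1 \<le> real_of_int \<lfloor>real (Suc n) * r\<rfloor>" for n by linarith+
  show le: "?g n \<le> r" for n
    using *(1)[of n] by (simp add: pos_divide_le_eq mult.commute del: of_nat_Suc)
  have ge: "r - 1 / real (Suc n) \<le> ?g n" for n
  proof -
    have "r - 1 / real (Suc n) = (real (Suc n) * r - 1) / real (Suc n)"
      by (simp add: diff_divide_distrib del: of_nat_Suc)
    then show ?thesis using *(2)[of n] by (simp add: divide_right_mono del: of_nat_Suc)
  qed
  show "?g \<longlonglongrightarrow> r"
  proof (rule tendsto_sandwich[where f="\<lambda>n. r - 1 / real (Suc n)" and h="\<lambda>_. r"])
    have "(\<lambda>n. r - 1 / real (Suc n)) \<longlonglongrightarrow> r - 0"
      by (intro tendsto_intros LIMSEQ_Suc[OF lim_1_over_n])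
    then show "(\<lambda>n. r - 1 / real (Suc n)) \<longlonglongrightarrow> r" by simp
  qed (use le ge in \<open>auto simp del: of_nat_Suc\<close>)
qed

text \<open>What the growth estimate uses of the exit problem: up to \<theta> the path is confined
  to a ball, so every continuous function of it is bounded, and the equation holds up to a time
  \<rho> that is not before \<theta>.\<close>

locale stopped_diffusion = wiener M W for M :: "'w measure" and W :: "real \<Rightarrow> 'w \<Rightarrow> real ^ 'k" +
  fixes b :: "real ^ 'n \<Rightarrow> real ^ 'n" and \<sigma> :: "real ^ 'n \<Rightarrow> real ^ 'k ^ 'n"
    and X :: "real \<Rightarrow> 'w \<Rightarrow> real ^ 'n" and \<theta> \<rho> :: "'w \<Rightarrow> real" and I :: "real \<Rightarrow> 'w \<Rightarrow> real ^ 'n"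
    and x0 :: "real ^ 'n" and R T :: real
  assumes b: "continuous_on UNIV b" and \<sigma>: "continuous_on UNIV \<sigma>" and R: "0 \<le> R" and T: "0 \<le> T"
    and ito: "has_ito_integral M F W (\<lambda>r w. if r \<le> \<rho> w then \<sigma> (X r w) else 0) I"
    and theta: "\<And>w. w \<in> space M \<Longrightarrow> 0 \<le> \<theta> w" "\<And>w. w \<in> space M \<Longrightarrow> \<theta> w \<le> T" "\<And>w. w \<in> space M \<Longrightarrow> \<theta> w \<le> \<rho> w"
    and stop: "\<And>p. 0 \<le> p \<Longrightarrow> {w\<in>space M. \<theta> w \<le> p} \<in> sets (F p)"
    and contX: "\<And>w. w \<in> space M \<Longrightarrow> continuous_on {0..\<theta> w} (\<lambda>r. X r w)"
    and inR: "\<And>w r. w \<in> space M \<Longrightarrow> 0 \<le> r \<Longrightarrow> r \<le> \<theta> w \<Longrightarrow> norm (X r w) \<le> R"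
    and adapted: "\<And>s. 0 \<le> s \<Longrightarrow> (\<lambda>w. X (min s (\<theta> w)) w) \<in> borel_measurable (F s)"
    and sde: "AE w in M. \<forall>t\<ge>0. X (min t (\<rho> w)) w = x0 + integral {0..min t (\<rho> w)} (\<lambda>s. b (X s w)) + I t w"
begin

text \<open>The clamp at \<open>0\<close> continues the path constantly to negative times, which
  makes it continuous on the whole line.\<close>

definition Y :: "real \<Rightarrow> 'w \<Rightarrow> real ^ 'n" where
  "Y s w = X (max 0 (min s (\<theta> w))) w"

lemma Y_eq: "w \<in> space M \<Longrightarrow> 0 \<le> r \<Longrightarrow> Y r w = X (min r (\<theta> w)) w"
  using theta(1)[of w] by (simp add: Y_def max_def)

lemma Y_continuous: "w \<in> space M \<Longrightarrow> continuous_on UNIV (\<lambda>s. Y s w)"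
  unfolding Y_def using theta(1)[of w]
  by (intro continuous_on_compose2[OF contX] continuous_intros) auto

lemma Y_bounded: "w \<in> space M \<Longrightarrow> norm (Y s w) \<le> R"
  unfolding Y_def using theta(1)[of w] by (intro inR) auto

lemma Y_adapted: "0 \<le> s \<Longrightarrow> Y s \<in> borel_measurable (F s)"
proof -
  assume s: "0 \<le> s"
  have "X (min s (\<theta> w)) w = Y s w" if "w \<in> space (F s)" for w
    using Y_eq[of w s] that s by simp
  then show ?thesis
    using adapted[OF s] measurable_cong[of "F s" "\<lambda>w. X (min s (\<theta> w)) w" "Y s" borel] by simp
qed

lemma Y_measurable: "Y s \<in> borel_measurable M"
proof (cases "0 \<le> s")
  case True then show ?thesis using measurable_F_imp[OF Y_adapted] by blast
next
  case False
  then have "Y s w = Y 0 w" if "w \<in> space M" for w using theta(1)[OF that] by (simp add: Y_def)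
  then show ?thesis using measurable_F_imp[OF Y_adapted[of 0]] by (simp cong: measurable_cong)
qed

text \<open>A continuous process is the limit of its time discretisations, and each of these uses
  only countably many times.\<close>

lemma Y_jointly_measurable: "(\<lambda>p. Y (snd p) (fst p)) \<in> borel_measurable (M \<Otimes>\<^sub>M lborel)"
proof (rule borel_measurable_LIMSEQ_metric)
  let ?g = "\<lambda>n r. real_of_int \<lfloor>real (Suc n) * r\<rfloor> / real (Suc n)"
  fix n :: nat
  show "(\<lambda>p. Y (?g n (snd p)) (fst p)) \<in> borel_measurable (M \<Otimes>\<^sub>M lborel)"
  proof (rule measurable_compose_countable[where f="\<lambda>k p. Y (real_of_int k / real (Suc n)) (fst p)" and g="\<lambda>p. \<lfloor>real (Suc n) * snd p\<rfloor>"])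
    show "(\<lambda>p. Y (real_of_int k / real (Suc n)) (fst p)) \<in> borel_measurable (M \<Otimes>\<^sub>M lborel)" for k
      using measurable_compose[OF measurable_fst Y_measurable] .
    show "(\<lambda>p. \<lfloor>real (Suc n) * snd p\<rfloor>) \<in> M \<Otimes>\<^sub>M lborel \<rightarrow>\<^sub>M count_space UNIV" by measurable
  qed
  fix p :: "'w \<times> real" assume p: "p \<in> space (M \<Otimes>\<^sub>M lborel)"
  have "(\<lambda>n. ?g n (snd p)) \<longlonglongrightarrow> snd p" by (rule floor_grid(2))
  then show "(\<lambda>n. Y (?g n (snd p)) (fst p)) \<longlonglongrightarrow> Y (snd p) (fst p)"
    using p by (intro continuous_on_tendsto_compose[OF Y_continuous]) (auto simp: space_pair_measure)
qed

lemma theta_measurable [measurable]: "\<theta> \<in> borel_measurable M"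
  by (rule stop_measurable[OF theta(1) stop])

text \<open>Written with \<open>Y\<close> because it agrees with \<open>X\<close> on
  \<open>{0..\<theta> w}\<close> and is bounded and jointly measurable at all times.\<close>

definition stopped_integral :: "(real ^ 'n \<Rightarrow> 'c::{banach, second_countable_topology}) \<Rightarrow> real \<Rightarrow> real \<Rightarrow> 'w \<Rightarrow> 'c" where
  "stopped_integral f s t w = (LINT r:{s<..t}|lborel. (if r \<le> \<theta> w then f (Y r w) else 0))"

lemma stopped_integrand_measurable:
  fixes f :: "real ^ 'n \<Rightarrow> 'c::{banach, second_countable_topology}"
  assumes f: "continuous_on UNIV f"
  shows "(\<lambda>p. if snd p \<le> \<theta> (fst p) then f (Y (snd p) (fst p)) else 0) \<in> borel_measurable (M \<Otimes>\<^sub>M lborel)"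
proof -
  have [measurable]: "f \<in> borel_measurable borel" using f by (rule borel_measurable_continuous_onI)
  note [measurable] = Y_jointly_measurable
  show ?thesis by measurable
qed

lemma stopped_integral_measurable:
  fixes f :: "real ^ 'n \<Rightarrow> 'c::{banach, second_countable_topology}"
  assumes f: "continuous_on UNIV f"
  shows "stopped_integral f s t \<in> borel_measurable M"
  unfolding stopped_integral_def[abs_def] set_lebesgue_integral_def
  using stopped_integrand_measurable[OF f]
  by (intro lborel.borel_measurable_lebesgue_integral) (simp add: split_beta')

lemma stopped_integrand_integrable:
  fixes f :: "real ^ 'n \<Rightarrow> 'c::{banach, second_countable_topology}"
  assumes f: "continuous_on UNIV f" and w: "w \<in> space M" and C: "\<And>y. norm y \<le> R \<Longrightarrow> norm (f y) \<le> C"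
  shows "set_integrable lborel {s<..t} (\<lambda>r. if r \<le> \<theta> w then f (Y r w) else 0)"
proof (rule set_integrable_bounded)
  show "(\<lambda>r. if r \<le> \<theta> w then f (Y r w) else 0) \<in> borel_measurable borel"
    using measurable_Pair2[OF stopped_integrand_measurable[OF f] w]
    unfolding fst_conv snd_conv measurable_lborel1 by simp
  show "norm (if r \<le> \<theta> w then f (Y r w) else 0) \<le> \<bar>C\<bar>" for r
    using order_trans[OF C[OF Y_bounded[OF w]] abs_ge_self] by auto
qed

lemma stopped_integral_bound:
  fixes f :: "real ^ 'n \<Rightarrow> 'c::{banach, second_countable_topology}"
  assumes w: "w \<in> space M" and C: "\<And>y. norm y \<le> R \<Longrightarrow> norm (f y) \<le> C" and st: "s \<le> t"
  shows "norm (stopped_integral f s t w) \<le> C * (t - s)"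
  unfolding stopped_integral_def
  using C[OF Y_bounded[OF w]] order_trans[OF norm_ge_zero C[of 0]] R st
  by (intro set_integral_Ioc_bound) auto

lemma bounded_on_range:
  fixes f :: "real ^ 'n \<Rightarrow> 'c::real_normed_vector"
  assumes "continuous_on UNIV f"
  obtains B where "0 \<le> B" "\<And>y. norm y \<le> R \<Longrightarrow> norm (f y) \<le> B"
proof -
  have "bounded (f ` cball 0 R)"
    by (intro compact_imp_bounded compact_continuous_image continuous_on_subset[OF assms]) auto
  then obtain B where "0 < B" "\<forall>y\<in>cball 0 R. norm (f y) \<le> B" unfolding bounded_pos by auto
  then show thesis by (intro that[of B]) auto
qed

lemma Y_increment_integrable: "integrable M (\<lambda>w. norm (Y t w - Y s w) ^ k)"
proof (rule abs_expectation_le(1))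
  show "(\<lambda>w. norm (Y t w - Y s w) ^ k) \<in> borel_measurable M"
    using Y_measurable[of t] Y_measurable[of s] by measurable
  fix w assume w: "w \<in> space M"
  have "norm (Y t w - Y s w) \<le> R + R"
    using Y_bounded[OF w, of t] Y_bounded[OF w, of s] norm_triangle_ineq4[of "Y t w" "Y s w"] by simp
  then have "norm (Y t w - Y s w) ^ k \<le> (R + R) ^ k" by (intro power_mono) auto
  then show "\<bar>norm (Y t w - Y s w) ^ k\<bar> \<le> (R + R) ^ k" by simp
qed

text \<open>Up to a null set this is the increment of the stopped stochastic integral. Obtained from
  the path and its drift, it is bounded uniformly over \<open>space M\<close> for times up to
  \<open>T\<close>, whereas \<open>I\<close> is tied to the path only almost surely.\<close>

definition martingale_part :: "real \<Rightarrow> real \<Rightarrow> 'w \<Rightarrow> real ^ 'n" where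
  "martingale_part s t w = Y t w - Y s w - stopped_integral b s t w"

lemma martingale_part_measurable: "martingale_part s t \<in> borel_measurable M"
  unfolding martingale_part_def[abs_def]
  by (intro borel_measurable_diff Y_measurable stopped_integral_measurable b)

text \<open>The equation is evaluated at the times \<open>min s (\<theta> w)\<close> and
  \<open>min t (\<theta> w)\<close>, which do not exceed \<open>\<rho> w\<close>, and subtracted;
  the drift integrals leave \<open>stopped_integral b s t w\<close>.\<close>

lemma martingale_part_eq_ito:
  assumes st: "0 \<le> s" "s \<le> t"
  shows "AE w in M. martingale_part s t w = I (min t (\<theta> w)) w - I (min s (\<theta> w)) w"
  using sde AE_space
proof eventually_elim
  case (elim w)
  note w = elim(2)
  let ?p = "min s (\<theta> w)" and ?p' = "min t (\<theta> w)" and ?f = "\<lambda>r. b (X r w)"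
  have p: "0 \<le> ?p" "?p \<le> ?p'" "?p' \<le> \<theta> w" using st theta(1)[OF w] by auto
  have contf: "continuous_on {0..?p'} ?f"
    by (rule continuous_on_compose2[OF b continuous_on_subset[OF contX[OF w]]]) (use p in auto)
  have e: "Y u w = x0 + integral {0..min u (\<theta> w)} ?f + I (min u (\<theta> w)) w" if "0 \<le> u" for u
  proof -
    have "min (min u (\<theta> w)) (\<rho> w) = min u (\<theta> w)" using theta(3)[OF w] by simp
    then show ?thesis using elim(1)[rule_format, of "min u (\<theta> w)"] that theta(1)[OF w] by (simp add: Y_eq[OF w])
  qed
  have comb: "integral {0..?p} ?f + integral {?p..?p'} ?f = integral {0..?p'} ?f"
    using p contf by (intro Henstock_Kurzweil_Integration.integral_combine integrable_continuous_real) auto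
  have "set_integrable lborel {?p..?p'} ?f"
    using contf p by (intro borel_integrable_atLeastAtMost' continuous_on_subset[OF contf]) auto
  from set_borel_integral_eq_integral(2)[OF this]
  have "integral {?p..?p'} ?f = (LINT r|lborel. indicator {?p..?p'} r *\<^sub>R ?f r)"
    by (simp add: set_lebesgue_integral_def)
  also have "\<dots> = stopped_integral b s t w"
    unfolding stopped_integral_def set_lebesgue_integral_def
  proof (rule integral_cong_AE)
    \<comment> \<open>The closed interval and the part of \<open>{s<..t}\<close> up to
      \<open>\<theta> w\<close> differ at most in the left endpoint.\<close>
    show "AE r in lborel. indicator {?p..?p'} r *\<^sub>R ?f r = indicator {s<..t} r *\<^sub>R (if r \<le> \<theta> w then b (Y r w) else 0)"
      using AE_lborel_singleton[of ?p]
    proof eventually_elim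
      case (elim r)
      then show ?case using st by (auto simp: indicator_def Y_eq[OF w] min_def split: if_splits)
    qed
    show "(\<lambda>r. indicator {?p..?p'} r *\<^sub>R ?f r) \<in> borel_measurable lborel"
      using \<open>set_integrable lborel {?p..?p'} ?f\<close> unfolding set_integrable_def by (rule borel_measurable_integrable)
    have [measurable]: "(\<lambda>r. if r \<le> \<theta> w then b (Y r w) else 0) \<in> borel_measurable borel"
      using measurable_Pair2[OF stopped_integrand_measurable[OF b] w]
      unfolding fst_conv snd_conv measurable_lborel1 by simp
    show "(\<lambda>r. indicator {s<..t} r *\<^sub>R (if r \<le> \<theta> w then b (Y r w) else 0)) \<in> borel_measurable lborel"
      by measurable
  qed
  finally show ?case using e[of t] e[of s] comb st by (simp add: martingale_part_def algebra_simps)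
qed

lemma martingale_part_bounded:
  obtains B where "0 \<le> B" "\<And>w s t. w \<in> space M \<Longrightarrow> 0 \<le> s \<Longrightarrow> s \<le> t \<Longrightarrow> t \<le> T \<Longrightarrow> norm (martingale_part s t w) \<le> B"
proof -
  obtain Kb where Kb: "0 \<le> Kb" "\<And>y. norm y \<le> R \<Longrightarrow> norm (b y) \<le> Kb" by (rule bounded_on_range[OF b]) blast
  show thesis
  proof (rule that[of "R + R + Kb * T"])
    show "0 \<le> R + R + Kb * T" using R Kb(1) T by simp
    fix w s t assume *: "w \<in> space M" "0 \<le> s" "s \<le> t" "t \<le> T"
    have "norm (martingale_part s t w) \<le> norm (Y t w) + norm (Y s w) + norm (stopped_integral b s t w)"
      unfolding martingale_part_def by (intro order_trans[OF norm_triangle_ineq4] add_mono norm_triangle_ineq4 order_refl)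
    also have "\<dots> \<le> R + R + Kb * (t - s)"
      using * by (intro add_mono Y_bounded stopped_integral_bound Kb)
    also have "\<dots> \<le> R + R + Kb * T" using * Kb by (intro add_mono mult_left_mono) auto
    finally show "norm (martingale_part s t w) \<le> R + R + Kb * T" .
  qed
qed

text \<open>The exponential identity is applied to the multiples of \<open>l\<close> by an arbitrary
  real \<mu>. The quadratic variation scales with \<open>\<mu>\<^sup>2\<close>, so the identity
  acquires the parameter from which the moments are read off.\<close>

lemma martingale_part_moments:
  fixes l :: "real ^ 'n" and Z :: "'w \<Rightarrow> real"
  assumes st: "0 \<le> s" "s \<le> t" "t \<le> T" and Z: "Z \<in> borel_measurable (F s)" "\<And>w. w \<in> space M \<Longrightarrow> \<bar>Z w\<bar> \<le> D"
    and Ks: "\<And>y. norm y \<le> R \<Longrightarrow> norm (\<sigma> y) \<le> Ks"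
  defines "q \<equiv> stopped_integral (\<lambda>y. (norm (row_combination l (\<sigma> y)))\<^sup>2) s t"
  shows "expectation (\<lambda>w. Z w * (l \<bullet> martingale_part s t w)) = 0"
    "expectation (\<lambda>w. Z w * (l \<bullet> martingale_part s t w)\<^sup>2) = expectation (\<lambda>w. Z w * q w)"
    "expectation (\<lambda>w. (l \<bullet> martingale_part s t w) ^ 4) \<le> 6 * ((norm l * Ks)\<^sup>2 * (t - s)) * expectation (\<lambda>w. (l \<bullet> martingale_part s t w)\<^sup>2)"
    "expectation (\<lambda>w. (l \<bullet> martingale_part s t w)\<^sup>2) \<le> (norm l * Ks)\<^sup>2 * (t - s)"
proof -
  obtain B where B: "0 \<le> B" "\<And>w s t. w \<in> space M \<Longrightarrow> 0 \<le> s \<Longrightarrow> s \<le> t \<Longrightarrow> t \<le> T \<Longrightarrow> norm (martingale_part s t w) \<le> B"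
    by (rule martingale_part_bounded) blast
  let ?H = "\<lambda>r w. if r \<le> \<rho> w then \<sigma> (X r w) else 0"
  have K: "norm (?H r w) \<le> Ks" if "w \<in> space M" "0 \<le> r" "r \<le> \<theta> w" for r w
    using Ks[OF inR[OF that]] theta(3)[OF that(1)] that by simp
  have contq: "continuous_on UNIV (\<lambda>y. (norm (row_combination l (\<sigma> y)))\<^sup>2)"
    by (intro continuous_intros continuous_on_compose2[OF continuous_row_combination \<sigma>]) auto
  have qm[measurable]: "q \<in> borel_measurable M" unfolding q_def by (rule stopped_integral_measurable[OF contq])
  note [measurable] = martingale_part_measurable[of s t]
  have ZM[measurable]: "Z \<in> borel_measurable M" using measurable_F_imp[OF Z(1)] .
  have main: "0 \<le> q w \<and> q w \<le> (norm l * Ks)\<^sup>2 * (t - s)" if w: "w \<in> space M" for w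
  proof
    show "0 \<le> q w" unfolding q_def stopped_integral_def set_lebesgue_integral_def by (intro integral_nonneg_AE) auto
    have "norm (q w) \<le> (norm l * Ks)\<^sup>2 * (t - s)"
      unfolding q_def
    proof (rule stopped_integral_bound[OF w _ st(2)])
      fix y :: "real ^ 'n" assume "norm y \<le> R"
      then show "norm ((norm (row_combination l (\<sigma> y)))\<^sup>2) \<le> (norm l * Ks)\<^sup>2"
        using order_trans[OF norm_row_combination mult_left_mono[OF Ks]] by (auto intro!: power_mono)
    qed
    then show "q w \<le> (norm l * Ks)\<^sup>2 * (t - s)" by simp
  qed
  have eq: "(CLINT w|M. complex_of_real (z w) * (iexp (\<mu> * (l \<bullet> martingale_part s t w)) * exp (\<mu>\<^sup>2 * q w / 2))) = (CLINT w|M. complex_of_real (z w))"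
    if z: "z \<in> borel_measurable (F s)" "\<And>w. w \<in> space M \<Longrightarrow> \<bar>z w\<bar> \<le> D" for \<mu> :: real and z :: "'w \<Rightarrow> real" and D
  proof -
    have zc: "(\<lambda>w. complex_of_real (z w)) \<in> borel_measurable (F s)" using z(1) by measurable
    let ?q = "\<lambda>w. LINT r:{s<..t}|lborel. if r \<le> \<theta> w then (norm (row_combination (\<mu> *\<^sub>R l) (?H r w)))\<^sup>2 else 0"
    let ?y = "\<lambda>w. (\<mu> *\<^sub>R l) \<bullet> (I (min t (\<theta> w)) w - I (min s (\<theta> w)) w)"
    note em = ito_integral_exp_martingale[OF ito theta(1,2) stop K st(1,2), where l="\<mu> *\<^sub>R l"]
    have [measurable]: "?y \<in> borel_measurable M" "?q \<in> borel_measurable M" by (rule em(1), assumption+) (rule em(2), assumption+)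
    \<comment> \<open>For \<open>r \<le> \<theta> w\<close> the cut-off of the integrand at
      \<open>\<rho> w\<close> is inactive.\<close>
    have qq: "?q w = \<mu>\<^sup>2 * q w" if w: "w \<in> space M" for w
    proof -
      have "?q w = (LINT r:{s<..t}|lborel. \<mu>\<^sup>2 * (if r \<le> \<theta> w then (norm (row_combination l (\<sigma> (Y r w))))\<^sup>2 else 0))"
        using st theta(3)[OF w]
        by (intro set_lebesgue_integral_cong) (auto simp: row_combination_scale power_mult_distrib Y_eq[OF w])
      then show ?thesis by (simp add: q_def stopped_integral_def)
    qed
    have "(CLINT w|M. complex_of_real (z w) * (iexp (\<mu> * (l \<bullet> martingale_part s t w)) * exp (\<mu>\<^sup>2 * q w / 2))) =
      (CLINT w|M. complex_of_real (z w) * (iexp (?y w) * exp (?q w / 2)))"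
    proof (rule integral_cong_AE)
      show "AE w in M. complex_of_real (z w) * (iexp (\<mu> * (l \<bullet> martingale_part s t w)) * exp (\<mu>\<^sup>2 * q w / 2)) = complex_of_real (z w) * (iexp (?y w) * exp (?q w / 2))"
        using martingale_part_eq_ito[OF st(1,2)] AE_space by eventually_elim (simp only: qq inner_scaleR_left)
      note [measurable] = measurable_F_imp[OF z(1)]
      show "(\<lambda>w. complex_of_real (z w) * (iexp (\<mu> * (l \<bullet> martingale_part s t w)) * exp (\<mu>\<^sup>2 * q w / 2))) \<in> borel_measurable M" by measurable
      show "(\<lambda>w. complex_of_real (z w) * (iexp (?y w) * exp (?q w / 2))) \<in> borel_measurable M" by measurable
    qed
    also have "\<dots> = (CLINT w|M. complex_of_real (z w))"
      by (rule em(4), assumption+, rule zc, simp only: norm_of_real, rule z(2))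
    finally show ?thesis .
  qed
  have xB: "\<bar>l \<bullet> martingale_part s t w\<bar> \<le> norm l * B" if "w \<in> space M" for w
    by (rule order_trans[OF Cauchy_Schwarz_ineq2 mult_left_mono[OF B(2)[OF that st]]]) simp
  have xm: "(\<lambda>w. l \<bullet> martingale_part s t w) \<in> borel_measurable M" by measurable
  show "expectation (\<lambda>w. Z w * (l \<bullet> martingale_part s t w)) = 0"
    "expectation (\<lambda>w. Z w * (l \<bullet> martingale_part s t w)\<^sup>2) = expectation (\<lambda>w. Z w * q w)"
    using exp_martingale_moments(1,2)[OF xm qm ZM xB main Z(2) eq[OF Z]] by simp_all
  \<comment> \<open>The remaining two claims carry no weight and come from the constant weight
    \<open>1\<close>.\<close>
  have one: "(\<lambda>_. 1 :: real) \<in> borel_measurable (F s)" by simp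
  have one': "\<bar>1 :: real\<bar> \<le> 1" if "w \<in> space M" for w by simp
  have oneM: "(\<lambda>_. 1 :: real) \<in> borel_measurable M" by simp
  show "expectation (\<lambda>w. (l \<bullet> martingale_part s t w) ^ 4) \<le> 6 * ((norm l * Ks)\<^sup>2 * (t - s)) * expectation (\<lambda>w. (l \<bullet> martingale_part s t w)\<^sup>2)"
    by (rule exp_martingale_moments(3)[OF xm qm oneM xB main one' eq[OF one one']]) simp_all
  have "expectation (\<lambda>w. 1 * (l \<bullet> martingale_part s t w)\<^sup>2) = expectation (\<lambda>w. 1 * q w)"
    by (rule exp_martingale_moments(2)[OF xm qm oneM xB main one' eq[OF one one']]) simp_all
  then have "expectation (\<lambda>w. (l \<bullet> martingale_part s t w)\<^sup>2) = expectation q" by simp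
  also have "\<dots> \<le> (norm l * Ks)\<^sup>2 * (t - s)"
    using abs_expectation_le(2)[OF qm, of "(norm l * Ks)\<^sup>2 * (t - s)"] main by (auto simp: abs_le_iff)
  finally show "expectation (\<lambda>w. (l \<bullet> martingale_part s t w)\<^sup>2) \<le> (norm l * Ks)\<^sup>2 * (t - s)" .
qed

end

lemma inner_matrix_vector_mult_sum: "d \<bullet> (A *v d') = (\<Sum>i\<in>UNIV. \<Sum>j\<in>UNIV. A $ i $ j * (d $ i * d' $ j))"
  for A :: "real ^ 'n ^ 'n"
  by (simp add: inner_vec_def matrix_vector_mult_def sum_distrib_left mult_ac)

lemma mult_le_weighted_squares:
  fixes a c \<delta> :: real
  assumes "0 < \<delta>" shows "a * c \<le> \<delta> * c\<^sup>2 + a\<^sup>2 / \<delta>"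
proof -
  have "0 \<le> (\<delta> * c - a)\<^sup>2 / \<delta>" using assms by simp
  also have "\<dots> = \<delta> * c\<^sup>2 + a\<^sup>2 / \<delta> - 2 * (a * c)" using assms by (simp add: power2_eq_square field_simps)
  finally have "2 * (a * c) \<le> \<delta> * c\<^sup>2 + a\<^sup>2 / \<delta>" by simp
  moreover have "0 \<le> \<delta> * c\<^sup>2 + a\<^sup>2 / \<delta>" using assms by simp
  ultimately show ?thesis by linarith
qed

lemma norm_add_square_le: "(norm (x + y))\<^sup>2 \<le> 2 * (norm x)\<^sup>2 + 2 * (norm (y::'a::real_inner))\<^sup>2"
proof -
  have "(norm (x + y))\<^sup>2 + (norm (x - y))\<^sup>2 = 2 * (norm x)\<^sup>2 + 2 * (norm y)\<^sup>2"
    by (simp add: power2_norm_eq_inner algebra_simps inner_commute)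
  then show ?thesis by (smt (verit) zero_le_power2)
qed

section \<open>Covariations and moment bounds of the increments\<close>

context stopped_diffusion
begin

text \<open>Polarisation: the identity for squares, applied to the sum of two unit vectors and to
  each of them, gives the identity for products.\<close>

lemma martingale_part_covariation:
  assumes st: "0 \<le> s" "s \<le> t" "t \<le> T" and Z: "Z \<in> borel_measurable (F s)" "\<And>w. w \<in> space M \<Longrightarrow> \<bar>Z w\<bar> \<le> D"
  shows "expectation (\<lambda>w. Z w * (martingale_part s t w $ i * martingale_part s t w $ j)) =
    expectation (\<lambda>w. Z w * stopped_integral (\<lambda>y. \<sigma> y $ i \<bullet> \<sigma> y $ j) s t w)"
proof -
  obtain Ks where Ks: "0 \<le> Ks" "\<And>y. norm y \<le> R \<Longrightarrow> norm (\<sigma> y) \<le> Ks" by (rule bounded_on_range[OF \<sigma>]) blast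
  obtain B where B: "0 \<le> B" "\<And>w s t. w \<in> space M \<Longrightarrow> 0 \<le> s \<Longrightarrow> s \<le> t \<Longrightarrow> t \<le> T \<Longrightarrow> norm (martingale_part s t w) \<le> B"
    by (rule martingale_part_bounded) blast
  note [measurable] = martingale_part_measurable[of s t] measurable_F_imp[OF Z(1)]
  let ?q = "\<lambda>l. stopped_integral (\<lambda>y. (norm (row_combination l (\<sigma> y)))\<^sup>2) s t"
  have contq: "continuous_on UNIV (\<lambda>y. (norm (row_combination l (\<sigma> y)))\<^sup>2)" for l
    by (intro continuous_intros continuous_on_compose2[OF continuous_row_combination \<sigma>]) auto
  have contc: "continuous_on UNIV (\<lambda>y. \<sigma> y $ i \<bullet> \<sigma> y $ j)"
    by (intro continuous_intros \<sigma>)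
  note [measurable] = stopped_integral_measurable[OF contq, where s=s and t=t] stopped_integral_measurable[OF contc, where s=s and t=t]
  have qb: "norm ((norm (row_combination l (\<sigma> y)))\<^sup>2) \<le> (norm l * Ks)\<^sup>2" if "norm y \<le> R" for y l
    using order_trans[OF norm_row_combination mult_left_mono[OF Ks(2)[OF that]], of l] by (auto intro!: power_mono)
  have cb: "norm (\<sigma> y $ i \<bullet> \<sigma> y $ j) \<le> Ks * Ks" if "norm y \<le> R" for y
  proof -
    have "norm (\<sigma> y $ k) \<le> Ks" for k using order_trans[OF Finite_Cartesian_Product.norm_nth_le Ks(2)[OF that]] .
    then show ?thesis by (auto intro!: order_trans[OF Cauchy_Schwarz_ineq2] mult_mono simp: Ks)
  qed
  let ?a = "axis i 1 :: real ^ 'n" and ?c = "axis j 1 :: real ^ 'n"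
  have D0: "0 \<le> D" if "w \<in> space M" for w using order_trans[OF abs_ge_zero Z(2)[OF that]] .
  have il: "integrable M (\<lambda>w. Z w * (l \<bullet> martingale_part s t w)\<^sup>2)" for l
  proof (rule abs_expectation_le(1))
    fix w assume w: "w \<in> space M"
    have "\<bar>l \<bullet> martingale_part s t w\<bar> \<le> norm l * B"
      by (rule order_trans[OF Cauchy_Schwarz_ineq2 mult_left_mono[OF B(2)[OF w st]]]) simp
    then have "\<bar>l \<bullet> martingale_part s t w\<bar>\<^sup>2 \<le> (norm l * B)\<^sup>2" by (intro power_mono) auto
    then show "\<bar>Z w * (l \<bullet> martingale_part s t w)\<^sup>2\<bar> \<le> D * (norm l * B)\<^sup>2"
      unfolding abs_mult using Z(2)[OF w] D0[OF w] by (intro mult_mono) auto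
  qed measurable
  have iq: "integrable M (\<lambda>w. Z w * ?q l w)" for l
  proof (rule abs_expectation_le(1))
    fix w assume w: "w \<in> space M"
    have "norm (?q l w) \<le> (norm l * Ks)\<^sup>2 * (t - s)" by (rule stopped_integral_bound[OF w qb st(2)])
    then show "\<bar>Z w * ?q l w\<bar> \<le> D * ((norm l * Ks)\<^sup>2 * (t - s))"
      unfolding abs_mult using Z(2)[OF w] D0[OF w] by (intro mult_mono) auto
  qed measurable
  have E: "expectation (\<lambda>w. Z w * (l \<bullet> martingale_part s t w)\<^sup>2) = expectation (\<lambda>w. Z w * ?q l w)" for l
    by (rule martingale_part_moments(2)[OF st Z Ks(2)])
  have l: "Z w * (martingale_part s t w $ i * martingale_part s t w $ j) =
    (Z w * ((?a + ?c) \<bullet> martingale_part s t w)\<^sup>2 - Z w * (?a \<bullet> martingale_part s t w)\<^sup>2 - Z w * (?c \<bullet> martingale_part s t w)\<^sup>2) / 2" for w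
    by (simp add: inner_axis' inner_add_left power2_eq_square algebra_simps)
  have r: "Z w * stopped_integral (\<lambda>y. \<sigma> y $ i \<bullet> \<sigma> y $ j) s t w = (Z w * ?q (?a + ?c) w - Z w * ?q ?a w - Z w * ?q ?c w) / 2"
    if w: "w \<in> space M" for w
  proof -
    let ?f = "\<lambda>l r. if r \<le> \<theta> w then (norm (row_combination l (\<sigma> (Y r w))))\<^sup>2 else 0"
    have int: "set_integrable lborel {s<..t} (?f l)" for l
      by (rule stopped_integrand_integrable[OF contq w qb])
    have "?q (?a + ?c) w - ?q ?a w - ?q ?c w = (LINT r:{s<..t}|lborel. ?f (?a + ?c) r - ?f ?a r - ?f ?c r)"
      unfolding stopped_integral_def
      by (simp add: set_integral_diff int set_integral_diff(1)[OF int int])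
    also have "\<dots> = (LINT r:{s<..t}|lborel. 2 * (if r \<le> \<theta> w then \<sigma> (Y r w) $ i \<bullet> \<sigma> (Y r w) $ j else 0))"
      by (intro set_lebesgue_integral_cong)
         (auto simp: row_combination_add_left row_combination_axis power2_norm_eq_inner algebra_simps inner_commute)
    also have "\<dots> = 2 * stopped_integral (\<lambda>y. \<sigma> y $ i \<bullet> \<sigma> y $ j) s t w"
      unfolding stopped_integral_def by (rule set_integral_mult_right)
    finally have "stopped_integral (\<lambda>y. \<sigma> y $ i \<bullet> \<sigma> y $ j) s t w = (?q (?a + ?c) w - ?q ?a w - ?q ?c w) / 2" by simp
    then show ?thesis by (simp only:) (simp add: algebra_simps)
  qed
  have "expectation (\<lambda>w. Z w * (martingale_part s t w $ i * martingale_part s t w $ j)) =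
    (expectation (\<lambda>w. Z w * ((?a + ?c) \<bullet> martingale_part s t w)\<^sup>2) - expectation (\<lambda>w. Z w * (?a \<bullet> martingale_part s t w)\<^sup>2) - expectation (\<lambda>w. Z w * (?c \<bullet> martingale_part s t w)\<^sup>2)) / 2"
    unfolding l using il by simp
  also have "\<dots> = (expectation (\<lambda>w. Z w * ?q (?a + ?c) w) - expectation (\<lambda>w. Z w * ?q ?a w) - expectation (\<lambda>w. Z w * ?q ?c w)) / 2"
    unfolding E ..
  also have "\<dots> = expectation (\<lambda>w. (Z w * ?q (?a + ?c) w - Z w * ?q ?a w - Z w * ?q ?c w) / 2)"
    using iq by simp
  also have "\<dots> = expectation (\<lambda>w. Z w * stopped_integral (\<lambda>y. \<sigma> y $ i \<bullet> \<sigma> y $ j) s t w)"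
    by (rule Bochner_Integration.integral_cong[OF refl]) (simp add: r)
  finally show ?thesis .
qed

text \<open>The martingale part has second and fourth moments of order \<open>t - s\<close> and
  \<open>(t - s)\<^sup>2\<close>. The drift part is itself of order \<open>t - s\<close>, hence
  smaller; its surplus powers of \<open>t - s\<close> are absorbed by powers of
  \<open>T\<close>.\<close>

lemma increment_moments:
  obtains C where "0 \<le> C"
    "\<And>s t. 0 \<le> s \<Longrightarrow> s \<le> t \<Longrightarrow> t \<le> T \<Longrightarrow> expectation (\<lambda>w. (norm (martingale_part s t w))\<^sup>2) \<le> C * (t - s)"
    "\<And>s t. 0 \<le> s \<Longrightarrow> s \<le> t \<Longrightarrow> t \<le> T \<Longrightarrow> expectation (\<lambda>w. (norm (Y t w - Y s w))\<^sup>2) \<le> C * (t - s)"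
    "\<And>s t. 0 \<le> s \<Longrightarrow> s \<le> t \<Longrightarrow> t \<le> T \<Longrightarrow> expectation (\<lambda>w. (norm (Y t w - Y s w)) ^ 4) \<le> C * (t - s)\<^sup>2"
proof -
  obtain Ks where Ks: "0 \<le> Ks" "\<And>y. norm y \<le> R \<Longrightarrow> norm (\<sigma> y) \<le> Ks" by (rule bounded_on_range[OF \<sigma>]) blast
  obtain Kb where Kb: "0 \<le> Kb" "\<And>y. norm y \<le> R \<Longrightarrow> norm (b y) \<le> Kb" by (rule bounded_on_range[OF b]) blast
  obtain B where B: "0 \<le> B" "\<And>w s t. w \<in> space M \<Longrightarrow> 0 \<le> s \<Longrightarrow> s \<le> t \<Longrightarrow> t \<le> T \<Longrightarrow> norm (martingale_part s t w) \<le> B"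
    by (rule martingale_part_bounded) blast
  define n where "n = real CARD('n)"
  have n1: "1 \<le> n" by (simp add: n_def Suc_leI)
  define C2 where "C2 = n * Ks\<^sup>2"
  \<comment> \<open>One factor \<open>n\<close> bounds the square of a sum of \<open>n\<close> terms
    by \<open>n\<close> times the sum of their squares, the other counts the components.\<close>
  define C4 where "C4 = n * (n * (6 * Ks\<^sup>2 * Ks\<^sup>2))"
  have C24: "0 \<le> C2" "0 \<le> C4" using n1 by (simp_all add: C2_def C4_def)
  have main: "expectation (\<lambda>w. (norm (martingale_part s t w))\<^sup>2) \<le> C2 * (t - s)" "expectation (\<lambda>w. (norm (martingale_part s t w)) ^ 4) \<le> C4 * (t - s)\<^sup>2"
     "expectation (\<lambda>w. (norm (Y t w - Y s w))\<^sup>2) \<le> (2 * Kb\<^sup>2 * T + 2 * C2) * (t - s)"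
     "expectation (\<lambda>w. (norm (Y t w - Y s w)) ^ 4) \<le> (8 * Kb ^ 4 * T\<^sup>2 + 8 * C4) * (t - s)\<^sup>2"
    if st: "0 \<le> s" "s \<le> t" "t \<le> T" for s t
  proof -
    note [measurable] = martingale_part_measurable[of s t] Y_measurable
    have one: "(\<lambda>_. 1 :: real) \<in> borel_measurable (F s)" "\<And>w. w \<in> space M \<Longrightarrow> \<bar>1::real\<bar> \<le> 1" by simp_all
    have nB: "(norm (martingale_part s t w)) ^ k \<le> B ^ k" if "w \<in> space M" for k w using B(2)[OF that st] by (intro power_mono) auto
    have cB: "\<bar>martingale_part s t w $ i\<bar> ^ k \<le> B ^ k" if "w \<in> space M" for k w i
      using order_trans[OF component_le_norm_cart B(2)[OF that st]] by (intro power_mono) auto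
    have i2: "integrable M (\<lambda>w. (martingale_part s t w $ i)\<^sup>2)" and i4: "integrable M (\<lambda>w. (martingale_part s t w $ i) ^ 4)" for i
    proof -
      have [measurable]: "(\<lambda>w. martingale_part s t w $ i) \<in> borel_measurable M"
        by (rule measurable_compose[OF martingale_part_measurable borel_measurable_continuous_onI]) (intro continuous_intros)
      show "integrable M (\<lambda>w. (martingale_part s t w $ i)\<^sup>2)" using cB[of _ i 2] by (intro abs_expectation_le(1)[of _ "B\<^sup>2"]) auto
      show "integrable M (\<lambda>w. (martingale_part s t w $ i) ^ 4)" using cB[of _ i 4] by (intro abs_expectation_le(1)[of _ "B ^ 4"]) (auto simp: power_abs)
    qed
    have e2: "expectation (\<lambda>w. (martingale_part s t w $ i)\<^sup>2) \<le> Ks\<^sup>2 * (t - s)" for i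
      using martingale_part_moments(4)[OF st one Ks(2), where l="axis i 1"] by (simp add: inner_axis')
    have e4: "expectation (\<lambda>w. (martingale_part s t w $ i) ^ 4) \<le> 6 * Ks\<^sup>2 * Ks\<^sup>2 * (t - s)\<^sup>2" for i
    proof -
      have "expectation (\<lambda>w. (martingale_part s t w $ i) ^ 4) \<le> 6 * (Ks\<^sup>2 * (t - s)) * expectation (\<lambda>w. (martingale_part s t w $ i)\<^sup>2)"
        using martingale_part_moments(3)[OF st one Ks(2), where l="axis i 1"] by (simp add: inner_axis')
      also have "\<dots> \<le> 6 * (Ks\<^sup>2 * (t - s)) * (Ks\<^sup>2 * (t - s))"
        using e2[of i] st by (intro mult_left_mono) auto
      finally show ?thesis by (simp add: power2_eq_square mult_ac)
    qed
    have n2: "(norm x)\<^sup>2 = (\<Sum>i\<in>UNIV. (x $ i)\<^sup>2)" for x :: "real ^ 'n"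
      unfolding power2_norm_eq_inner inner_vec_def by (simp add: power2_eq_square)
    have n4: "(norm x) ^ 4 \<le> n * (\<Sum>i\<in>UNIV. (x $ i) ^ 4)" for x :: "real ^ 'n"
    proof -
      have "(norm x) ^ 4 = (\<Sum>i\<in>UNIV. (x $ i)\<^sup>2)\<^sup>2" unfolding n2[symmetric] by simp
      also have "\<dots> \<le> (\<Sum>i\<in>(UNIV :: 'n set). ((x $ i)\<^sup>2)\<^sup>2) * n"
        unfolding n_def by (rule sum_squared_le_sum_of_squares)
      finally show ?thesis by (simp add: mult.commute)
    qed
    show m2: "expectation (\<lambda>w. (norm (martingale_part s t w))\<^sup>2) \<le> C2 * (t - s)"
    proof -
      have "expectation (\<lambda>w. (norm (martingale_part s t w))\<^sup>2) = (\<Sum>i\<in>UNIV. expectation (\<lambda>w. (martingale_part s t w $ i)\<^sup>2))"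
        unfolding n2 using i2 by (intro Bochner_Integration.integral_sum)
      also have "\<dots> \<le> (\<Sum>i\<in>(UNIV :: 'n set). Ks\<^sup>2 * (t - s))" by (intro sum_mono e2)
      finally show ?thesis by (simp add: C2_def n_def)
    qed
    have in4: "integrable M (\<lambda>w. (norm (martingale_part s t w)) ^ 4)" using nB by (intro abs_expectation_le(1)[of _ "B ^ 4"]) auto
    have in2: "integrable M (\<lambda>w. (norm (martingale_part s t w))\<^sup>2)" using nB by (intro abs_expectation_le(1)[of _ "B\<^sup>2"]) auto
    show m4: "expectation (\<lambda>w. (norm (martingale_part s t w)) ^ 4) \<le> C4 * (t - s)\<^sup>2"
    proof -
      have "expectation (\<lambda>w. (norm (martingale_part s t w)) ^ 4) \<le> expectation (\<lambda>w. n * (\<Sum>i\<in>UNIV. (martingale_part s t w $ i) ^ 4))"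
        using n4 i4 in4 by (intro integral_mono) auto
      also have "\<dots> = n * (\<Sum>i\<in>UNIV. expectation (\<lambda>w. (martingale_part s t w $ i) ^ 4))"
        using i4 by (simp add: Bochner_Integration.integral_sum)
      also have "\<dots> \<le> n * (\<Sum>i\<in>(UNIV :: 'n set). 6 * Ks\<^sup>2 * Ks\<^sup>2 * (t - s)\<^sup>2)"
        using n1 by (intro mult_left_mono sum_mono e4) auto
      finally show ?thesis by (simp add: C4_def n_def mult_ac)
    qed
    have dec: "Y t w - Y s w = stopped_integral b s t w + martingale_part s t w" for w by (simp add: martingale_part_def)
    have A: "norm (stopped_integral b s t w) \<le> Kb * (t - s)" if "w \<in> space M" for w
      by (rule stopped_integral_bound[OF that Kb(2) st(2)])
    have A2: "(norm (stopped_integral b s t w))\<^sup>2 \<le> Kb\<^sup>2 * (t - s)\<^sup>2" if "w \<in> space M" for w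
      using power_mono[OF A[OF that], of 2] by (simp add: power_mult_distrib)
    have d2: "(norm (Y t w - Y s w))\<^sup>2 \<le> 2 * (Kb\<^sup>2 * (t - s)\<^sup>2) + 2 * (norm (martingale_part s t w))\<^sup>2" if "w \<in> space M" for w
      unfolding dec using norm_add_square_le[of "stopped_integral b s t w" "martingale_part s t w"] A2[OF that] by linarith
    show "expectation (\<lambda>w. (norm (Y t w - Y s w))\<^sup>2) \<le> (2 * Kb\<^sup>2 * T + 2 * C2) * (t - s)"
    proof -
      have "expectation (\<lambda>w. (norm (Y t w - Y s w))\<^sup>2) \<le> expectation (\<lambda>w. 2 * (Kb\<^sup>2 * (t - s)\<^sup>2) + 2 * (norm (martingale_part s t w))\<^sup>2)"
        using d2 in2 Y_increment_integrable by (intro integral_mono) auto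
      also have "\<dots> = 2 * (Kb\<^sup>2 * (t - s)\<^sup>2) + 2 * expectation (\<lambda>w. (norm (martingale_part s t w))\<^sup>2)"
        using in2 by (simp add: prob_space)
      also have "\<dots> \<le> 2 * (Kb\<^sup>2 * (T * (t - s))) + 2 * (C2 * (t - s))"
        using m2 st by (intro add_mono mult_left_mono) (auto simp: power2_eq_square intro!: mult_right_mono)
      finally show ?thesis by (simp add: algebra_simps)
    qed
    have d4: "(norm (Y t w - Y s w)) ^ 4 \<le> 8 * (Kb ^ 4 * (t - s) ^ 4) + 8 * (norm (martingale_part s t w)) ^ 4" if "w \<in> space M" for w
    proof -
      let ?x = "Kb\<^sup>2 * (t - s)\<^sup>2" and ?y = "(norm (martingale_part s t w))\<^sup>2"
      have "(norm (Y t w - Y s w)) ^ 4 = ((norm (Y t w - Y s w))\<^sup>2)\<^sup>2" by simp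
      also have "\<dots> \<le> (2 * ?x + 2 * ?y)\<^sup>2" using d2[OF that] by (intro power_mono) auto
      also have "\<dots> \<le> 8 * ?x\<^sup>2 + 8 * ?y\<^sup>2"
      proof -
        have "0 \<le> 4 * (?x - ?y)\<^sup>2" by simp
        then show ?thesis by (simp add: power2_eq_square algebra_simps)
      qed
      finally show ?thesis by (simp add: power_mult_distrib)
    qed
    show "expectation (\<lambda>w. (norm (Y t w - Y s w)) ^ 4) \<le> (8 * Kb ^ 4 * T\<^sup>2 + 8 * C4) * (t - s)\<^sup>2"
    proof -
      have "expectation (\<lambda>w. (norm (Y t w - Y s w)) ^ 4) \<le> expectation (\<lambda>w. 8 * (Kb ^ 4 * (t - s) ^ 4) + 8 * (norm (martingale_part s t w)) ^ 4)"
        using d4 in4 Y_increment_integrable by (intro integral_mono) auto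
      also have "\<dots> = 8 * (Kb ^ 4 * (t - s) ^ 4) + 8 * expectation (\<lambda>w. (norm (martingale_part s t w)) ^ 4)"
        using in4 by (simp add: prob_space)
      also have "\<dots> \<le> 8 * (Kb ^ 4 * (T\<^sup>2 * (t - s)\<^sup>2)) + 8 * (C4 * (t - s)\<^sup>2)"
      proof -
        have "(t - s) ^ 4 = (t - s)\<^sup>2 * (t - s)\<^sup>2" by (simp add: power2_eq_square eval_nat_numeral)
        also have "\<dots> \<le> T\<^sup>2 * (t - s)\<^sup>2" using st by (intro mult_right_mono power_mono) auto
        finally show ?thesis using m4 Kb(1) by (intro add_mono mult_left_mono) auto
      qed
      finally show ?thesis by (simp add: algebra_simps)
    qed
  qed
  show thesis
  proof (rule that[of "C2 + (2 * Kb\<^sup>2 * T + 2 * C2) + (8 * Kb ^ 4 * T\<^sup>2 + 8 * C4)"])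
    let ?C = "C2 + (2 * Kb\<^sup>2 * T + 2 * C2) + (8 * Kb ^ 4 * T\<^sup>2 + 8 * C4)"
    have n: "0 \<le> 2 * Kb\<^sup>2 * T" "0 \<le> 8 * Kb ^ 4 * T\<^sup>2" using T Kb by simp_all
    show "0 \<le> ?C" using n C24 by simp
    have le: "C2 \<le> ?C" "2 * Kb\<^sup>2 * T + 2 * C2 \<le> ?C" "8 * Kb ^ 4 * T\<^sup>2 + 8 * C4 \<le> ?C" using n C24 by simp_all
    fix s t assume st: "0 \<le> s" "s \<le> t" "t \<le> T"
    show "expectation (\<lambda>w. (norm (martingale_part s t w))\<^sup>2) \<le> ?C * (t - s)"
      using main(1)[OF st] mult_right_mono[OF le(1), of "t - s"] st by linarith
    show "expectation (\<lambda>w. (norm (Y t w - Y s w))\<^sup>2) \<le> ?C * (t - s)"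
      using main(3)[OF st] mult_right_mono[OF le(2), of "t - s"] st by linarith
    show "expectation (\<lambda>w. (norm (Y t w - Y s w)) ^ 4) \<le> ?C * (t - s)\<^sup>2"
      using main(4)[OF st] mult_right_mono[OF le(3) zero_le_power2[of "t - s"]] by linarith
  qed
qed

end

section \<open>Growth of the expectation\<close>

text \<open>Steps of length \<open>T / N\<close> yield the recursion of the explicit Euler scheme,
  and the powers of \<open>1 + \<alpha> * T / N\<close> tend to \<open>exp (\<alpha> * T)\<close>. A
  bound on every increment, not only on those from time 0, makes this work for either sign of
  \<alpha>. The term with \<open>C\<close> disappears as \<open>N\<close> grows; afterwards
  \<epsilon> tends to 0.\<close>

lemma discrete_Gronwall:
  fixes u :: "real \<Rightarrow> real"
  assumes T: "0 < T"
    and step: "\<And>\<epsilon>. 0 < \<epsilon> \<Longrightarrow> \<exists>C\<ge>0. \<forall>s t. 0 \<le> s \<longrightarrow> s \<le> t \<longrightarrow> t \<le> T \<longrightarrow>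
      u t - u s \<le> (t - s) * (\<alpha> * u s + \<beta> + \<epsilon> + C * (t - s))"
  shows "u T \<le> (if \<alpha> = 0 then u 0 + \<beta> * T else exp (\<alpha> * T) * u 0 + \<beta> / \<alpha> * (exp (\<alpha> * T) - 1))"
proof -
  let ?F = "\<lambda>\<beta>. if \<alpha> = 0 then u 0 + \<beta> * T else exp (\<alpha> * T) * u 0 + \<beta> / \<alpha> * (exp (\<alpha> * T) - 1)"
  have eps: "u T \<le> ?F (\<beta> + \<epsilon>)" if \<epsilon>: "0 < \<epsilon>" for \<epsilon>
  proof -
    obtain C where C: "0 \<le> C" "\<And>s t. 0 \<le> s \<Longrightarrow> s \<le> t \<Longrightarrow> t \<le> T \<Longrightarrow>
      u t - u s \<le> (t - s) * (\<alpha> * u s + \<beta> + \<epsilon> + C * (t - s))"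
      using step[OF \<epsilon>] by (elim exE conjE) (rule that, assumption, blast)
    \<comment> \<open>With step length \<open>h\<close> and
      \<open>B = \<beta> + \<epsilon> + C * h\<close>, the recursion multiplies by
      \<open>1 + \<alpha> * h\<close> and adds \<open>h * B\<close>. For nonzero \<alpha> its fixed
      point is \<open>- B / \<alpha>\<close>, and the distance from it is multiplied by
      \<open>1 + \<alpha> * h\<close> in each step.\<close>
    define G where "G N = (if \<alpha> = 0 then u 0 + (\<beta> + \<epsilon> + C * (T / real N)) * T
       else (1 + \<alpha> * T / real N) ^ N * u 0 + (\<beta> + \<epsilon> + C * (T / real N)) / \<alpha> * ((1 + \<alpha> * T / real N) ^ N - 1))" for N :: nat
    have G: "u T \<le> G N" if N: "0 < N" "0 \<le> 1 + \<alpha> * T / real N" for N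
    proof -
      define h where "h = T / real N"
      define B where "B = \<beta> + \<epsilon> + C * h"
      have h: "0 < h" "real N * h = T" using N T by (auto simp: h_def)
      have st: "u (real (Suc i) * h) \<le> (1 + \<alpha> * h) * u (real i * h) + h * B" if "i < N" for i
      proof -
        have "real (Suc i) * h \<le> real N * h" using that h by (intro mult_right_mono) auto
        then have "u (real (Suc i) * h) - u (real i * h) \<le> (real (Suc i) * h - real i * h) * (\<alpha> * u (real i * h) + \<beta> + \<epsilon> + C * (real (Suc i) * h - real i * h))"
          using h by (intro C(2)) (auto intro!: mult_right_mono)
        also have "real (Suc i) * h - real i * h = h" by (simp add: algebra_simps)
        finally show ?thesis by (simp add: B_def algebra_simps)
      qed
      \<comment> \<open>Nonnegativity, which holds for large \<open>N\<close>, permits multiplying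
        the induction hypothesis by this factor.\<close>
      have h1: "0 \<le> 1 + \<alpha> * h" using N(2) by (simp add: h_def)
      show ?thesis
      proof (cases "\<alpha> = 0")
        case True
        have "i \<le> N \<Longrightarrow> u (real i * h) \<le> u 0 + real i * (h * B)" for i
        proof (induction i)
          case (Suc i)
          then show ?case using st[of i] True by (simp add: algebra_simps)
        qed simp
        moreover have "real N * (h * B) = T * B" using h(2) by (simp add: mult.assoc[symmetric])
        ultimately have "u T \<le> u 0 + B * T" using h(2) by (metis mult.commute order_refl)
        then show ?thesis using True by (simp add: G_def B_def h_def)
      next
        case False
        have "i \<le> N \<Longrightarrow> u (real i * h) \<le> (1 + \<alpha> * h) ^ i * u 0 + B / \<alpha> * ((1 + \<alpha> * h) ^ i - 1)" for i
        proof (induction i)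
          case (Suc i)
          have "u (real (Suc i) * h) \<le> (1 + \<alpha> * h) * u (real i * h) + h * B" using st Suc by simp
          also have "\<dots> \<le> (1 + \<alpha> * h) * ((1 + \<alpha> * h) ^ i * u 0 + B / \<alpha> * ((1 + \<alpha> * h) ^ i - 1)) + h * B"
            using Suc h1 by (intro add_right_mono mult_left_mono) auto
          also have "\<dots> = (1 + \<alpha> * h) ^ Suc i * u 0 + B / \<alpha> * ((1 + \<alpha> * h) ^ Suc i - 1)"
            using False by (simp add: field_simps)
          finally show ?case .
        qed simp
        from this[of N] show ?thesis using h False by (simp add: G_def B_def h_def)
      qed
    qed
    have l0: "(\<lambda>N. T / real N) \<longlonglongrightarrow> 0" by (rule lim_const_over_n)
    have lim: "G \<longlonglongrightarrow> ?F (\<beta> + \<epsilon>)"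
    proof (cases "\<alpha> = 0")
      case True
      have "(\<lambda>N. u 0 + (\<beta> + \<epsilon> + C * (T / real N)) * T) \<longlonglongrightarrow> u 0 + (\<beta> + \<epsilon> + C * 0) * T"
        by (intro tendsto_intros l0)
      then show ?thesis using True by (simp add: G_def[abs_def])
    next
      case False
      have "(\<lambda>N. (1 + \<alpha> * T / real N) ^ N * u 0 + (\<beta> + \<epsilon> + C * (T / real N)) / \<alpha> * ((1 + \<alpha> * T / real N) ^ N - 1))
        \<longlonglongrightarrow> exp (\<alpha> * T) * u 0 + (\<beta> + \<epsilon> + C * 0) / \<alpha> * (exp (\<alpha> * T) - 1)"
        by (intro tendsto_intros l0 tendsto_exp_limit_sequentially) (use False in auto)
      then show ?thesis using False by (simp add: G_def[abs_def])
    qed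
    have "(\<lambda>N. 1 + \<alpha> * T / real N) \<longlonglongrightarrow> 1 + 0" by (intro tendsto_intros lim_const_over_n)
    then have "\<forall>\<^sub>F N in sequentially. 0 < 1 + \<alpha> * T / real N"
      using order_tendstoD(1)[of _ "1 :: real" sequentially 0] by simp
    then have "\<forall>\<^sub>F N in sequentially. u T \<le> G N"
      using eventually_gt_at_top[of 0] by eventually_elim (rule G, auto)
    then show ?thesis by (rule tendsto_lowerbound[OF lim]) simp
  qed
  have "(\<lambda>n. ?F (\<beta> + 1 / real (Suc n))) \<longlonglongrightarrow> ?F \<beta>"
  proof (cases "\<alpha> = 0")
    case True
    have "(\<lambda>n. u 0 + (\<beta> + 1 / real (Suc n)) * T) \<longlonglongrightarrow> u 0 + (\<beta> + 0) * T"
      by (intro tendsto_intros LIMSEQ_Suc[OF lim_1_over_n])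
    then show ?thesis using True by simp
  next
    case False
    have "(\<lambda>n. exp (\<alpha> * T) * u 0 + (\<beta> + 1 / real (Suc n)) / \<alpha> * (exp (\<alpha> * T) - 1)) \<longlonglongrightarrow>
      exp (\<alpha> * T) * u 0 + (\<beta> + 0) / \<alpha> * (exp (\<alpha> * T) - 1)"
      by (intro tendsto_intros LIMSEQ_Suc[OF lim_1_over_n]) (use False in auto)
    then show ?thesis using False by simp
  qed
  then show ?thesis
    by (rule LIMSEQ_le_const) (intro exI[of _ 0] allI impI eps, auto)
qed

section \<open>Growth of the expectation over one time step\<close>

context stopped_diffusion
begin

lemma Y_compose_measurable:
  assumes "continuous_on UNIV f"
  shows "(\<lambda>w. f (Y s w)) \<in> borel_measurable M"
  by (rule measurable_compose[OF Y_measurable borel_measurable_continuous_onI[OF assms]])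

lemma Y_compose_integrable:
  fixes f :: "real ^ 'n \<Rightarrow> real"
  assumes "continuous_on UNIV f"
  shows "integrable M (\<lambda>w. f (Y s w))"
proof -
  obtain B where "0 \<le> B" "\<And>y. norm y \<le> R \<Longrightarrow> norm (f y) \<le> B" by (rule bounded_on_range[OF assms]) blast
  then show ?thesis
    using Y_compose_measurable[OF assms] Y_bounded by (intro abs_expectation_le(1)[of _ B]) auto
qed

definition generator_integral :: "(real ^ 'n \<Rightarrow> real) \<Rightarrow> real \<Rightarrow> real \<Rightarrow> 'w \<Rightarrow> real" where
  "generator_integral v s t w =
     (LINT r:{s<..t}|lborel. if r \<le> \<theta> w then mixed_generator b \<sigma> v (Y s w) (Y r w) else 0)"

text \<open>The derivatives are taken at \<open>Y s w\<close>, which does not depend on the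
  integration time, so they come out of the integral.\<close>

lemma generator_integral_eq:
  assumes v: "twice_continuously_differentiable v" and w: "w \<in> space M"
  shows "generator_integral v s t w = gradient v (Y s w) \<bullet> stopped_integral b s t w +
    (\<Sum>i\<in>UNIV. \<Sum>j\<in>UNIV. hessian v (Y s w) $ i $ j * stopped_integral (\<lambda>y. \<sigma> y $ i \<bullet> \<sigma> y $ j) s t w) / 2"
proof -
  let ?g = "gradient v (Y s w)" and ?H = "hessian v (Y s w)"
  let ?I = "\<lambda>r. r \<le> \<theta> w"
  obtain Kb where Kb: "0 \<le> Kb" "\<And>y. norm y \<le> R \<Longrightarrow> norm (b y) \<le> Kb" by (rule bounded_on_range[OF b]) blast
  have contc: "continuous_on UNIV (\<lambda>y. \<sigma> y $ i \<bullet> \<sigma> y $ j)" for i j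
    by (intro continuous_intros \<sigma>)
  have ib: "set_integrable lborel {s<..t} (\<lambda>r. if ?I r then b (Y r w) else 0)"
    by (rule stopped_integrand_integrable[OF b w Kb(2)])
  have ic: "set_integrable lborel {s<..t} (\<lambda>r. if ?I r then \<sigma> (Y r w) $ i \<bullet> \<sigma> (Y r w) $ j else 0)" for i j
  proof -
    obtain B where "0 \<le> B" "\<And>y. norm y \<le> R \<Longrightarrow> norm (\<sigma> y $ i \<bullet> \<sigma> y $ j) \<le> B" by (rule bounded_on_range[OF contc]) blast
    then show ?thesis by (intro stopped_integrand_integrable[OF contc w]) auto
  qed
  have ib': "integrable lborel (\<lambda>r. ?g \<bullet> (indicator {s<..t} r *\<^sub>R (if ?I r then b (Y r w) else 0)))"
    using ib unfolding set_integrable_def by (rule integrable_inner_right)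
  have ic': "integrable lborel (\<lambda>r. ?H $ i $ j * (indicator {s<..t} r *\<^sub>R (if ?I r then \<sigma> (Y r w) $ i \<bullet> \<sigma> (Y r w) $ j else 0)))" for i j
    using ic[of i j] unfolding set_integrable_def by (rule integrable_mult_right)
  have "generator_integral v s t w = (LINT r|lborel. ?g \<bullet> (indicator {s<..t} r *\<^sub>R (if ?I r then b (Y r w) else 0)) +
     (\<Sum>i\<in>UNIV. \<Sum>j\<in>UNIV. ?H $ i $ j * (indicator {s<..t} r *\<^sub>R (if ?I r then \<sigma> (Y r w) $ i \<bullet> \<sigma> (Y r w) $ j else 0))) / 2)"
    unfolding generator_integral_def set_lebesgue_integral_def
    by (intro Bochner_Integration.integral_cong refl) (simp add: mixed_generator_def indicator_def)
  also have "\<dots> = (LINT r|lborel. ?g \<bullet> (indicator {s<..t} r *\<^sub>R (if ?I r then b (Y r w) else 0))) +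
     (\<Sum>i\<in>UNIV. \<Sum>j\<in>UNIV. LINT r|lborel. ?H $ i $ j * (indicator {s<..t} r *\<^sub>R (if ?I r then \<sigma> (Y r w) $ i \<bullet> \<sigma> (Y r w) $ j else 0))) / 2"
    using ib' ic' by (subst Bochner_Integration.integral_add) (auto simp: Bochner_Integration.integral_sum)
  also have "(LINT r|lborel. ?g \<bullet> (indicator {s<..t} r *\<^sub>R (if ?I r then b (Y r w) else 0))) = ?g \<bullet> stopped_integral b s t w"
    unfolding stopped_integral_def set_lebesgue_integral_def
    using ib unfolding set_integrable_def by (rule integral_inner_right)
  finally show ?thesis
    unfolding stopped_integral_def set_lebesgue_integral_def by (simp only: integral_mult_right_zero)
qed

text \<open>Taylor expansion at \<open>Y s w\<close>, with the increment split into drift and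
  martingale part. The term linear in the martingale part has mean 0, and the quadratic one is given
  by the covariation. Products of drift and martingale part have order \<open>t - s\<close> to the
  power 3/2; a weighted inequality splits them into a small multiple of \<open>t - s\<close> and a
  term of order \<open>(t - s)\<^sup>2\<close>.\<close>

lemma expectation_increment_le:
  assumes v: "twice_continuously_differentiable v" and \<epsilon>: "0 < \<epsilon>"
  shows "\<exists>C\<ge>0. \<forall>s t. 0 \<le> s \<longrightarrow> s \<le> t \<longrightarrow> t \<le> T \<longrightarrow> integrable M (generator_integral v s t) \<and>
    expectation (\<lambda>w. v (Y t w)) - expectation (\<lambda>w. v (Y s w)) \<le>
      expectation (generator_integral v s t) + (t - s) * (\<epsilon> + C * (t - s))"
proof -
  note cv = continuous_function[OF v] continuous_gradient[OF v] continuous_hessian[OF v]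
  obtain Kb where Kb: "0 \<le> Kb" "\<And>y. norm y \<le> R \<Longrightarrow> norm (b y) \<le> Kb" by (rule bounded_on_range[OF b]) blast
  obtain KH where KH: "0 \<le> KH" "\<And>y. norm y \<le> R \<Longrightarrow> norm (hessian v y) \<le> KH" by (rule bounded_on_range[OF cv(3)]) blast
  obtain C where C: "0 \<le> C"
    "\<And>s t. 0 \<le> s \<Longrightarrow> s \<le> t \<Longrightarrow> t \<le> T \<Longrightarrow> expectation (\<lambda>w. (norm (martingale_part s t w))\<^sup>2) \<le> C * (t - s)"
    "\<And>s t. 0 \<le> s \<Longrightarrow> s \<le> t \<Longrightarrow> t \<le> T \<Longrightarrow> expectation (\<lambda>w. (norm (Y t w - Y s w))\<^sup>2) \<le> C * (t - s)"
    "\<And>s t. 0 \<le> s \<Longrightarrow> s \<le> t \<Longrightarrow> t \<le> T \<Longrightarrow> expectation (\<lambda>w. (norm (Y t w - Y s w)) ^ 4) \<le> C * (t - s)\<^sup>2"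
    by (rule increment_moments) blast
  obtain B where B: "0 \<le> B" "\<And>w s t. w \<in> space M \<Longrightarrow> 0 \<le> s \<Longrightarrow> s \<le> t \<Longrightarrow> t \<le> T \<Longrightarrow> norm (martingale_part s t w) \<le> B"
    by (rule martingale_part_bounded) blast
  \<comment> \<open>\<delta> and \<eta> are chosen such that the squared martingale part from the
    mixed products and the quadratic part of the Taylor error each cost at most
    \<open>\<epsilon> / 2\<close> per unit of time. The added \<open>1\<close> keeps the
    denominators positive.\<close>
  define \<delta> where "\<delta> = \<epsilon> / (2 * (KH * C + 1))"
  define \<eta> where "\<eta> = \<epsilon> / (2 * (C + 1))"
  have KC: "0 \<le> KH * C" using KH C by simp
  have de: "0 < \<delta>" "0 < \<eta>" using \<epsilon> KC C(1) by (simp_all add: \<delta>_def \<eta>_def)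
  have dC: "KH * (\<delta> * C) \<le> \<epsilon> / 2"
  proof -
    have "KH * (\<delta> * C) = \<epsilon> / 2 * ((KH * C) / (KH * C + 1))" using KC by (simp add: \<delta>_def field_simps)
    also have "\<dots> \<le> \<epsilon> / 2 * 1" using KC \<epsilon> by (intro mult_left_mono) auto
    finally show ?thesis by simp
  qed
  have eC: "\<eta> * C \<le> \<epsilon> / 2"
  proof -
    have "\<eta> * C = \<epsilon> / 2 * (C / (C + 1))" using C(1) by (simp add: \<eta>_def field_simps)
    also have "\<dots> \<le> \<epsilon> / 2 * 1" using C(1) \<epsilon> by (intro mult_left_mono) auto
    finally show ?thesis by simp
  qed
  obtain C1 where C1: "0 \<le> C1" "\<And>x y. norm x \<le> R \<Longrightarrow> norm y \<le> R \<Longrightarrow>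
      \<bar>v y - v x - gradient v x \<bullet> (y - x) - ((y - x) \<bullet> (hessian v x *v (y - x))) / 2\<bar> \<le> \<eta> * (norm (y - x))\<^sup>2 + C1 * (norm (y - x)) ^ 4"
    using second_order_remainder[OF v compact_cball[of 0 R] convex_cball[of 0 R] de(2)] by auto
  let ?C = "KH * ((1 / \<delta> + 1) * Kb\<^sup>2) + C1 * C"
  show ?thesis
  proof (intro exI[of _ ?C] conjI allI impI)
    show "0 \<le> ?C" using KH(1) C(1) C1(1) de by simp
    fix s t assume st: "0 \<le> s" "s \<le> t" "t \<le> T"
    note [measurable] = martingale_part_measurable[of s t] Y_measurable
    let ?A = "stopped_integral b s t" and ?D = "martingale_part s t"
    let ?c = "\<lambda>i j. stopped_integral (\<lambda>y. \<sigma> y $ i \<bullet> \<sigma> y $ j) s t"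
    have contc: "continuous_on UNIV (\<lambda>y. \<sigma> y $ i \<bullet> \<sigma> y $ j)" for i j
      by (intro continuous_intros \<sigma>)
    have A: "norm (?A w) \<le> Kb * (t - s)" if "w \<in> space M" for w
      by (rule stopped_integral_bound[OF that Kb(2) st(2)])
    have dec: "Y t w - Y s w = ?A w + ?D w" for w by (simp add: martingale_part_def)
    have iD2: "integrable M (\<lambda>w. (norm (?D w))\<^sup>2)"
      using power_mono[OF B(2)[OF _ st] norm_ge_zero, of _ 2] by (intro abs_expectation_le(1)[of _ "B\<^sup>2"]) auto
    \<comment> \<open>Measurability with respect to \<open>F s\<close>, not merely \<open>M\<close>,
      is what admits the derivatives as weights in the moment identities.\<close>
    have gF: "(\<lambda>w. gradient v (Y s w) $ i) \<in> borel_measurable (F s)" for i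
      by (rule measurable_compose[OF Y_adapted[OF st(1)] borel_measurable_continuous_onI]) (intro continuous_intros cv)
    have hF: "(\<lambda>w. hessian v (Y s w) $ i $ j) \<in> borel_measurable (F s)" for i j
      by (rule measurable_compose[OF Y_adapted[OF st(1)] borel_measurable_continuous_onI]) (intro continuous_intros cv)
    obtain Kg where Kg: "0 \<le> Kg" "\<And>y. norm y \<le> R \<Longrightarrow> norm (gradient v y) \<le> Kg" by (rule bounded_on_range[OF cv(2)]) blast
    have gB: "\<bar>gradient v (Y s w) $ i\<bar> \<le> Kg" if "w \<in> space M" for w i
      using order_trans[OF component_le_norm_cart Kg(2)[OF Y_bounded[OF that]]] .
    have hB: "\<bar>hessian v (Y s w) $ i $ j\<bar> \<le> KH" if "w \<in> space M" for w i j
      using order_trans[OF component_le_norm_cart order_trans[OF Finite_Cartesian_Product.norm_nth_le KH(2)[OF Y_bounded[OF that]]]] .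
    have DB: "\<bar>?D w $ i\<bar> \<le> B" if "w \<in> space M" for w i
      using order_trans[OF component_le_norm_cart B(2)[OF that st]] .
    have Di[measurable]: "(\<lambda>w. ?D w $ i) \<in> borel_measurable M" for i
      by (rule measurable_compose[OF martingale_part_measurable borel_measurable_continuous_onI]) (intro continuous_intros)
    note [measurable] = measurable_F_imp[OF gF] measurable_F_imp[OF hF] stopped_integral_measurable[OF contc, where s=s and t=t]
    have igD: "integrable M (\<lambda>w. gradient v (Y s w) $ i * ?D w $ i)" for i
    proof (rule abs_expectation_le(1))
      fix w assume w: "w \<in> space M"
      show "\<bar>gradient v (Y s w) $ i * ?D w $ i\<bar> \<le> Kg * B"
        unfolding abs_mult using gB[OF w] DB[OF w] Kg(1) by (intro mult_mono) auto
    qed measurable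
    have ihD: "integrable M (\<lambda>w. hessian v (Y s w) $ i $ j * (?D w $ i * ?D w $ j))" for i j
    proof (rule abs_expectation_le(1))
      fix w assume w: "w \<in> space M"
      show "\<bar>hessian v (Y s w) $ i $ j * (?D w $ i * ?D w $ j)\<bar> \<le> KH * (B * B)"
        unfolding abs_mult using hB[OF w] DB[OF w] KH(1) B(1) by (intro mult_mono) auto
    qed measurable
    have ihc: "integrable M (\<lambda>w. hessian v (Y s w) $ i $ j * ?c i j w)" for i j
    proof -
      obtain Bc where Bc: "0 \<le> Bc" "\<And>y. norm y \<le> R \<Longrightarrow> norm (\<sigma> y $ i \<bullet> \<sigma> y $ j) \<le> Bc" by (rule bounded_on_range[OF contc]) blast
      show ?thesis
      proof (rule abs_expectation_le(1))
        fix w assume w: "w \<in> space M"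
        have "norm (?c i j w) \<le> Bc * (t - s)" by (rule stopped_integral_bound[OF w Bc(2) st(2)])
        then show "\<bar>hessian v (Y s w) $ i $ j * ?c i j w\<bar> \<le> KH * (Bc * (t - s))"
          unfolding abs_mult using hB[OF w] KH(1) by (intro mult_mono) auto
      qed measurable
    qed
    have igA: "integrable M (\<lambda>w. gradient v (Y s w) \<bullet> ?A w)"
    proof (rule abs_expectation_le(1))
      fix w assume w: "w \<in> space M"
      show "\<bar>gradient v (Y s w) \<bullet> ?A w\<bar> \<le> Kg * (Kb * (t - s))"
        by (rule order_trans[OF Cauchy_Schwarz_ineq2 mult_mono[OF Kg(2)[OF Y_bounded[OF w]] A[OF w] Kg(1)]]) simp
    next
      have [measurable]: "?A \<in> borel_measurable M" by (rule stopped_integral_measurable[OF b])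
      have [measurable]: "(\<lambda>w. gradient v (Y s w)) \<in> borel_measurable M" by (rule Y_compose_measurable[OF cv(2)])
      show "(\<lambda>w. gradient v (Y s w) \<bullet> ?A w) \<in> borel_measurable M" by measurable
    qed
    define G where "G w = gradient v (Y s w) \<bullet> ?A w + (\<Sum>i\<in>UNIV. \<Sum>j\<in>UNIV. hessian v (Y s w) $ i $ j * ?c i j w) / 2" for w
    have Gint: "integrable M G" unfolding G_def using igA ihc
      by (intro Bochner_Integration.integrable_add Bochner_Integration.integrable_divide Bochner_Integration.integrable_sum) auto
    have GG: "G w = generator_integral v s t w" if "w \<in> space M" for w
      using generator_integral_eq[OF v that] by (simp add: G_def)
    show "integrable M (generator_integral v s t)"
      using Gint GG by (simp cong: Bochner_Integration.integrable_cong)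
    have EG: "expectation (generator_integral v s t) = expectation G"
      using GG by (intro Bochner_Integration.integral_cong) auto
    define L where "L w = (\<Sum>i\<in>UNIV. gradient v (Y s w) $ i * ?D w $ i)" for w
    define Q where "Q w = (\<Sum>i\<in>UNIV. \<Sum>j\<in>UNIV. hessian v (Y s w) $ i $ j * (?D w $ i * ?D w $ j))" for w
    have iL: "integrable M L" unfolding L_def using igD by (intro Bochner_Integration.integrable_sum)
    have iQ: "integrable M Q" unfolding Q_def using ihD by (intro Bochner_Integration.integrable_sum)
    have EL: "expectation L = 0"
    proof -
      have "expectation L = (\<Sum>i\<in>UNIV. expectation (\<lambda>w. gradient v (Y s w) $ i * ?D w $ i))"
        unfolding L_def using igD by (intro Bochner_Integration.integral_sum)
      also have "\<dots> = 0"
      proof (rule sum.neutral, rule ballI)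
        fix i
        obtain Ks where Ks: "0 \<le> Ks" "\<And>y. norm y \<le> R \<Longrightarrow> norm (\<sigma> y) \<le> Ks" by (rule bounded_on_range[OF \<sigma>]) blast
        show "expectation (\<lambda>w. gradient v (Y s w) $ i * ?D w $ i) = 0"
          using martingale_part_moments(1)[OF st gF gB Ks(2), where l="axis i 1"] by (simp add: inner_axis')
      qed
      finally show ?thesis .
    qed
    have EQ: "expectation Q = expectation (\<lambda>w. \<Sum>i\<in>UNIV. \<Sum>j\<in>UNIV. hessian v (Y s w) $ i $ j * ?c i j w)"
    proof -
      have "expectation Q = (\<Sum>i\<in>UNIV. \<Sum>j\<in>UNIV. expectation (\<lambda>w. hessian v (Y s w) $ i $ j * (?D w $ i * ?D w $ j)))"
        unfolding Q_def using ihD by (simp add: Bochner_Integration.integral_sum)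
      also have "\<dots> = (\<Sum>i\<in>UNIV. \<Sum>j\<in>UNIV. expectation (\<lambda>w. hessian v (Y s w) $ i $ j * ?c i j w))"
        by (intro sum.cong refl martingale_part_covariation[OF st hF hB])
      also have "\<dots> = expectation (\<lambda>w. \<Sum>i\<in>UNIV. \<Sum>j\<in>UNIV. hessian v (Y s w) $ i $ j * ?c i j w)"
        using ihc by (simp add: Bochner_Integration.integral_sum)
      finally show ?thesis .
    qed
    \<comment> \<open>The pointwise error: first the part of the Hessian form that involves the
      drift, then the Taylor remainder.\<close>
    define E where "E w = KH * (\<delta> * (norm (?D w))\<^sup>2 + (1 / \<delta> + 1) * (Kb * (t - s))\<^sup>2) +
       (\<eta> * (norm (Y t w - Y s w))\<^sup>2 + C1 * (norm (Y t w - Y s w)) ^ 4)" for w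
    have iE: "integrable M E" unfolding E_def using iD2 Y_increment_integrable by auto
    have fac: "(e / 2 + e / 2) * h + c * h\<^sup>2 = h * (e + c * h)" for e c h :: real
      by (simp add: power2_eq_square algebra_simps)
    have comb: "x \<le> ga + l + q / 2 + (p + e)" if "x \<le> g + d / 2 + e" "g = ga + l" "d = q + z" "z \<le> p * 2"
      for x g d e ga l q z p :: real using that by linarith
    have pw: "v (Y t w) - v (Y s w) \<le> gradient v (Y s w) \<bullet> ?A w + L w + Q w / 2 + E w" if w: "w \<in> space M" for w
    proof -
      let ?g = "gradient v (Y s w)" and ?H = "hessian v (Y s w)" and ?a = "?A w" and ?m = "?D w"
      let ?d = "Y t w - Y s w"
      have "v (Y t w) - v (Y s w) \<le> ?g \<bullet> ?d + (?d \<bullet> (?H *v ?d)) / 2 + (\<eta> * (norm ?d)\<^sup>2 + C1 * (norm ?d) ^ 4)"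
        using C1(2)[OF Y_bounded[OF w] Y_bounded[OF w], of t s] by (simp add: abs_le_iff)
      moreover have "?g \<bullet> ?d = ?g \<bullet> ?a + L w"
        unfolding dec L_def inner_add_right by (simp add: inner_vec_def)
      moreover have "?d \<bullet> (?H *v ?d) = Q w + (?m \<bullet> (?H *v ?a) + ?a \<bullet> (?H *v ?m) + ?a \<bullet> (?H *v ?a))"
        unfolding dec Q_def inner_matrix_vector_mult_sum[symmetric]
        by (simp add: matrix_vector_right_distrib inner_add_left inner_add_right)
      \<comment> \<open>Twice the error is allowed here because the Hessian form enters Taylor's
        formula with the factor 1/2.\<close>
      moreover have "?m \<bullet> (?H *v ?a) + ?a \<bullet> (?H *v ?m) + ?a \<bullet> (?H *v ?a) \<le>
          KH * (\<delta> * (norm ?m)\<^sup>2 + (1 / \<delta> + 1) * (Kb * (t - s))\<^sup>2) * 2"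
      proof -
        have q: "x \<bullet> (?H *v y) \<le> KH * (norm x * norm y)" for x y
        proof -
          have "x \<bullet> (?H *v y) \<le> norm x * (KH * norm y)"
            using KH(2)[OF Y_bounded[OF w], of s]
            by (intro order_trans[OF norm_cauchy_schwarz] mult_left_mono order_trans[OF norm_matrix_vector_mult] mult_right_mono) auto
          then show ?thesis by (simp add: mult_ac)
        qed
        have a2: "(norm ?a)\<^sup>2 \<le> (Kb * (t - s))\<^sup>2" using A[OF w] by (rule power_mono) simp
        have "norm ?a * norm ?m \<le> \<delta> * (norm ?m)\<^sup>2 + (norm ?a)\<^sup>2 / \<delta>" by (rule mult_le_weighted_squares[OF de(1)])
        also have "\<dots> \<le> \<delta> * (norm ?m)\<^sup>2 + (Kb * (t - s))\<^sup>2 / \<delta>"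
          using a2 de(1) by (intro add_left_mono divide_right_mono) auto
        finally have am: "norm ?a * norm ?m \<le> \<delta> * (norm ?m)\<^sup>2 + (Kb * (t - s))\<^sup>2 / \<delta>" .
        have "?m \<bullet> (?H *v ?a) + ?a \<bullet> (?H *v ?m) + ?a \<bullet> (?H *v ?a) \<le> KH * (2 * (norm ?a * norm ?m) + (norm ?a)\<^sup>2)"
          using q[of ?m ?a] q[of ?a ?m] q[of ?a ?a] by (simp add: algebra_simps power2_eq_square)
        also have "\<dots> \<le> KH * (2 * (\<delta> * (norm ?m)\<^sup>2 + (Kb * (t - s))\<^sup>2 / \<delta>) + 2 * (Kb * (t - s))\<^sup>2)"
        proof (intro mult_left_mono[OF _ KH(1)] add_mono)
          show "2 * (norm ?a * norm ?m) \<le> 2 * (\<delta> * (norm ?m)\<^sup>2 + (Kb * (t - s))\<^sup>2 / \<delta>)"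
            using mult_left_mono[OF am, of 2] by simp
          show "(norm ?a)\<^sup>2 \<le> 2 * (Kb * (t - s))\<^sup>2" using a2 zero_le_power2[of "Kb * (t - s)"] by linarith
        qed
        also have "\<dots> = KH * (\<delta> * (norm ?m)\<^sup>2 + (1 / \<delta> + 1) * (Kb * (t - s))\<^sup>2) * 2" by (simp add: algebra_simps)
        finally show ?thesis .
      qed
      ultimately show ?thesis unfolding E_def by (rule comb)
    qed
    have "expectation (\<lambda>w. v (Y t w)) - expectation (\<lambda>w. v (Y s w)) = expectation (\<lambda>w. v (Y t w) - v (Y s w))"
      using Y_compose_integrable[OF cv(1)] by simp
    also have "\<dots> \<le> expectation (\<lambda>w. gradient v (Y s w) \<bullet> ?A w + L w + Q w / 2 + E w)"
      using Y_compose_integrable[OF cv(1)] igA iL iQ iE pw by (intro integral_mono) auto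
    also have "\<dots> = expectation (\<lambda>w. gradient v (Y s w) \<bullet> ?A w) + expectation L + expectation Q / 2 + expectation E"
      using igA iL iQ iE by simp
    also have "\<dots> = expectation G + expectation E"
      unfolding EL EQ G_def using igA ihc by simp
    also have "expectation E \<le> (t - s) * (\<epsilon> + ?C * (t - s))"
    proof -
      have "expectation E = KH * (\<delta> * expectation (\<lambda>w. (norm (?D w))\<^sup>2) + (1 / \<delta> + 1) * (Kb * (t - s))\<^sup>2) +
         (\<eta> * expectation (\<lambda>w. (norm (Y t w - Y s w))\<^sup>2) + C1 * expectation (\<lambda>w. (norm (Y t w - Y s w)) ^ 4))"
        unfolding E_def using iD2 Y_increment_integrable by (simp add: prob_space)
      also have "\<dots> \<le> KH * (\<delta> * (C * (t - s)) + (1 / \<delta> + 1) * (Kb * (t - s))\<^sup>2) + (\<eta> * (C * (t - s)) + C1 * (C * (t - s)\<^sup>2))"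
        using KH(1) de C1(1) by (intro add_mono mult_left_mono C st order_refl) auto
      also have "\<dots> = (KH * (\<delta> * C) + \<eta> * C) * (t - s) + ?C * (t - s)\<^sup>2"
        unfolding power_mult_distrib by (simp add: distrib_left distrib_right mult_ac)
      also have "\<dots> \<le> (\<epsilon> / 2 + \<epsilon> / 2) * (t - s) + ?C * (t - s)\<^sup>2"
        using st by (intro add_right_mono mult_right_mono add_mono dC eC) simp
      also have "\<dots> = (t - s) * (\<epsilon> + ?C * (t - s))" by (rule fac)
      finally show ?thesis .
    qed
    finally show "expectation (\<lambda>w. v (Y t w)) - expectation (\<lambda>w. v (Y s w)) \<le>
      expectation (generator_integral v s t) + (t - s) * (\<epsilon> + ?C * (t - s))"
      unfolding EG by simp
  qed
qed

text \<open>Before \<theta> the rate of growth is bounded by the generator inequality. Afterwards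
  the path rests, and its rate 0 is bounded by the boundary inequality, so one differential
  inequality holds up to time \<open>T\<close>. On \<open>N\<close> the path may come to rest where
  \<open>\<alpha> * v + \<beta>\<close> is negative, but it is never below \<open>- c\<close>; this
  adds \<open>c * prob N\<close> to \<beta>.\<close>

lemma expectation_barrier_le:
  assumes v: "twice_continuously_differentiable v" and T0: "0 < T"
    and gen: "\<And>w r. w \<in> space M \<Longrightarrow> 0 \<le> r \<Longrightarrow> r < \<theta> w \<Longrightarrow> generator b \<sigma> v (X r w) \<le> \<alpha> * v (X r w) + \<beta>"
    and N: "N \<in> sets M" "\<And>w. w \<in> space M \<Longrightarrow> w \<notin> N \<Longrightarrow> \<theta> w < T \<Longrightarrow> 0 \<le> \<alpha> * v (X (\<theta> w) w) + \<beta>"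
    and c: "0 \<le> c" "\<And>y. norm y \<le> R \<Longrightarrow> - c \<le> \<alpha> * v y + \<beta>"
    and X0: "\<And>w. w \<in> space M \<Longrightarrow> X 0 w = x0"
  shows "expectation (\<lambda>w. v (Y T w)) \<le> (if \<alpha> = 0 then v x0 + (\<beta> + c * prob N) * T
    else exp (\<alpha> * T) * v x0 + (\<beta> + c * prob N) / \<alpha> * (exp (\<alpha> * T) - 1))"
proof -
  let ?u = "\<lambda>t. expectation (\<lambda>w. v (Y t w))"
  interpret PL: pair_sigma_finite M lborel ..
  note cv = continuous_function[OF v]
  note cg = continuous_mixed_generator[OF v b \<sigma>]
  have u0: "?u 0 = v x0"
  proof -
    have "?u 0 = expectation (\<lambda>_. v x0)"
      using X0 theta(1) by (intro Bochner_Integration.integral_cong) (auto simp: Y_eq)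
    then show ?thesis by (simp add: prob_space)
  qed
  have "?u T \<le> (if \<alpha> = 0 then ?u 0 + (\<beta> + c * prob N) * T
    else exp (\<alpha> * T) * ?u 0 + (\<beta> + c * prob N) / \<alpha> * (exp (\<alpha> * T) - 1))"
  proof (rule discrete_Gronwall[OF T0])
    fix \<epsilon> :: real assume \<epsilon>: "0 < \<epsilon>"
    \<comment> \<open>One third each for the Taylor remainder, for moving the derivatives from
      \<open>Y s w\<close> to \<open>Y r w\<close>, and for moving \<open>\<alpha> * v\<close> back
      from \<open>Y r w\<close> to \<open>Y s w\<close>.\<close>
    then have \<epsilon>3: "0 < \<epsilon> / 3" by simp
    obtain C0 where C0: "0 \<le> C0" "\<And>s t. 0 \<le> s \<Longrightarrow> s \<le> t \<Longrightarrow> t \<le> T \<Longrightarrow>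
        ?u t - ?u s \<le> expectation (generator_integral v s t) + (t - s) * (\<epsilon> / 3 + C0 * (t - s))"
      using expectation_increment_le[OF v \<epsilon>3] by blast
    have "continuous_on (cball 0 R \<times> cball 0 R) (\<lambda>p. mixed_generator b \<sigma> v (fst p) (snd p) - mixed_generator b \<sigma> v (snd p) (snd p))"
      by (intro continuous_on_diff continuous_on_subset[OF cg] continuous_on_compose2[OF cg, of _ "\<lambda>p. (snd p, snd p)", simplified] continuous_intros) auto
    from compact_diagonal_modulus[OF compact_cball this _ \<epsilon>3]
    obtain C1 where C1: "0 \<le> C1" "\<And>x y. norm x \<le> R \<Longrightarrow> norm y \<le> R \<Longrightarrow>
        \<bar>mixed_generator b \<sigma> v x y - mixed_generator b \<sigma> v y y\<bar> \<le> \<epsilon> / 3 + C1 * (norm (x - y))\<^sup>2" by auto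
    have "continuous_on (cball 0 R \<times> cball 0 R) (\<lambda>p. \<alpha> * v (snd p) - \<alpha> * v (fst p))"
      by (intro continuous_intros continuous_on_compose2[OF cv]) auto
    from compact_diagonal_modulus[OF compact_cball this _ \<epsilon>3]
    obtain C2 where C2: "0 \<le> C2" "\<And>x y. norm x \<le> R \<Longrightarrow> norm y \<le> R \<Longrightarrow>
        \<bar>\<alpha> * v y - \<alpha> * v x\<bar> \<le> \<epsilon> / 3 + C2 * (norm (x - y))\<^sup>2" by auto
    obtain C where C: "0 \<le> C"
      "\<And>s t. 0 \<le> s \<Longrightarrow> s \<le> t \<Longrightarrow> t \<le> T \<Longrightarrow> expectation (\<lambda>w. (norm (Y t w - Y s w))\<^sup>2) \<le> C * (t - s)"
      by (rule increment_moments) blast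
    show "\<exists>C\<ge>0. \<forall>s t. 0 \<le> s \<longrightarrow> s \<le> t \<longrightarrow> t \<le> T \<longrightarrow>
        ?u t - ?u s \<le> (t - s) * (\<alpha> * ?u s + (\<beta> + c * prob N) + \<epsilon> + C * (t - s))"
    proof (intro exI[of _ "C0 + (C1 + C2) * C"] conjI allI impI)
      show "0 \<le> C0 + (C1 + C2) * C" using C0 C1 C2 C by simp
      fix s t assume st: "0 \<le> s" "s \<le> t" "t \<le> T"
      \<comment> \<open>A bound for the expected rate at every time of the step; two of the three
        thirds of \<epsilon> are spent here.\<close>
      define k where "k = \<alpha> * ?u s + \<beta> + c * prob N + 2 * \<epsilon> / 3 + (C1 + C2) * (C * (t - s))"
      \<comment> \<open>The times \<open>\<theta> w\<close> and \<open>t\<close> are left out, as the pointwise bound may fail there.\<close>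
      define f where "f w r = indicator {s<..<t} r * (if r < \<theta> w then mixed_generator b \<sigma> v (Y s w) (Y r w) else 0)" for w r
      note [measurable] = Y_jointly_measurable Y_measurable
      have fm: "(\<lambda>(w, r). f w r) \<in> borel_measurable (M \<Otimes>\<^sub>M lborel)"
      proof -
        have "(\<lambda>p. (Y s (fst p), Y (snd p) (fst p))) \<in> borel_measurable (M \<Otimes>\<^sub>M lborel)"
          by (intro borel_measurable_Pair Y_jointly_measurable measurable_compose[OF measurable_fst Y_measurable])
        from measurable_compose[OF this borel_measurable_continuous_onI[OF cg]]
        have [measurable]: "(\<lambda>p. mixed_generator b \<sigma> v (Y s (fst p)) (Y (snd p) (fst p))) \<in> borel_measurable (M \<Otimes>\<^sub>M lborel)"
          by simp
        show ?thesis unfolding f_def split_beta' by measurable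
      qed
      have "bounded ((\<lambda>p. mixed_generator b \<sigma> v (fst p) (snd p)) ` (cball 0 R \<times> cball 0 R))"
        by (intro compact_imp_bounded compact_continuous_image continuous_on_subset[OF cg] compact_Times) auto
      then obtain B where B: "0 < B" "\<And>x y. norm x \<le> R \<Longrightarrow> norm y \<le> R \<Longrightarrow> \<bar>mixed_generator b \<sigma> v x y\<bar> \<le> B"
        unfolding bounded_pos by force
      have fb: "\<bar>f w r\<bar> \<le> B" if "w \<in> space M" for w r
        using B(2)[OF Y_bounded[OF that] Y_bounded[OF that], of s r] B(1) by (auto simp: f_def indicator_def)
      have fint: "integrable (M \<Otimes>\<^sub>M lborel) (\<lambda>(w, r). f w r)"
      proof -
        have i1: "integrable (M \<Otimes>\<^sub>M lborel) (\<lambda>p. indicator (space M \<times> {s<..<t}) p *\<^sub>R (\<lambda>(w, r). f w r) p)"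
        proof (rule integrableI_bounded_set_indicator[where B=B])
          have "emeasure (M \<Otimes>\<^sub>M lborel) (space M \<times> {s<..<t}) = emeasure M (space M) * emeasure lborel {s<..<t}"
            by (intro lborel.emeasure_pair_measure_Times) auto
          also have "\<dots> < \<infinity>" using st by (simp add: emeasure_space_1)
          finally show "emeasure (M \<Otimes>\<^sub>M lborel) (space M \<times> {s<..<t}) < \<infinity>" .
          show "AE p \<in> space M \<times> {s<..<t} in M \<Otimes>\<^sub>M lborel. norm ((\<lambda>(w, r). f w r) p) \<le> B"
            using fb by (intro AE_I2) auto
        qed (use fm in auto)
        have e1: "indicator (space M \<times> {s<..<t}) p *\<^sub>R (\<lambda>(w, r). f w r) p = (\<lambda>(w, r). f w r) p"
          if "p \<in> space (M \<Otimes>\<^sub>M lborel)" for p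
          using that by (auto simp: f_def indicator_def space_pair_measure)
        show ?thesis by (rule Bochner_Integration.integrable_cong[OF refl e1, THEN iffD1, OF _ i1])
      qed
      have gi: "generator_integral v s t w = (LINT r|lborel. f w r)" if w: "w \<in> space M" for w
        unfolding generator_integral_def set_lebesgue_integral_def
      proof (rule integral_cong_AE)
        show "AE r in lborel. indicator {s<..t} r *\<^sub>R (if r \<le> \<theta> w then mixed_generator b \<sigma> v (Y s w) (Y r w) else 0) = f w r"
          using AE_lborel_singleton[of t] AE_lborel_singleton[of "\<theta> w"]
          by eventually_elim (auto simp: f_def indicator_def)
        show "f w \<in> borel_measurable lborel" using measurable_Pair2[OF fm w] by simp
        have "continuous_on UNIV (\<lambda>r. mixed_generator b \<sigma> v (Y s w) (Y r w))"
          by (rule continuous_on_compose2[OF cg, of _ "\<lambda>r. (Y s w, Y r w)", simplified]) (intro continuous_intros Y_continuous[OF w])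
        then have [measurable]: "(\<lambda>r. mixed_generator b \<sigma> v (Y s w) (Y r w)) \<in> borel_measurable borel"
          by (rule borel_measurable_continuous_onI)
        show "(\<lambda>r. indicator {s<..t} r *\<^sub>R (if r \<le> \<theta> w then mixed_generator b \<sigma> v (Y s w) (Y r w) else 0)) \<in> borel_measurable lborel"
          by measurable
      qed
      have "expectation (generator_integral v s t) = expectation (\<lambda>w. LINT r|lborel. f w r)"
        using gi by (intro Bochner_Integration.integral_cong) auto
      \<comment> \<open>The order is exchanged because the error terms are controlled in expectation
        at a fixed time \<open>r\<close>, not along a single path.\<close>
      also have "\<dots> = (LINT r|lborel. expectation (\<lambda>w. f w r))"
        by (rule PL.Fubini_integral[symmetric]) (use fint in simp)
      also have "\<dots> \<le> (LINT r|lborel. indicator {s<..<t} r * k)"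
      proof (rule integral_mono)
        show "integrable lborel (\<lambda>r. expectation (\<lambda>w. f w r))"
          by (rule PL.integrable_snd) (use fint in simp)
        show "integrable lborel (\<lambda>r. indicator {s<..<t} r * k)"
          using st by (intro integrable_mult_left integrable_real_indicator) auto
        fix r
        show "expectation (\<lambda>w. f w r) \<le> indicator {s<..<t} r * k"
        proof (cases "r \<in> {s<..<t}")
          case False
          then show ?thesis by (simp add: f_def)
        next
          case True
          then have r: "s < r" "r < t" by auto
          let ?D = "\<lambda>w. (norm (Y s w - Y r w))\<^sup>2"
          have pw: "f w r \<le> \<alpha> * v (Y s w) + \<beta> + c * indicator N w + 2 * \<epsilon> / 3 + (C1 + C2) * ?D w" if w: "w \<in> space M" for w
          proof -
            have key: "\<alpha> * v (Y r w) \<le> \<alpha> * v (Y s w) + \<epsilon> / 3 + C2 * ?D w"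
              using C2(2)[OF Y_bounded[OF w] Y_bounded[OF w], of r s] by linarith
            have d0: "0 \<le> C1 * ?D w" using C1(1) by simp
            have ind: "0 \<le> c * indicator N w" using c(1) by simp
            have "f w r \<le> \<alpha> * v (Y r w) + \<beta> + c * indicator N w + \<epsilon> / 3 + C1 * ?D w"
            proof (cases "r < \<theta> w")
              case True
              have Yr: "Y r w = X r w" using True r st by (simp add: Y_eq[OF w])
              have "f w r = mixed_generator b \<sigma> v (Y s w) (Y r w)" using True r by (simp add: f_def)
              also have "\<dots> \<le> generator b \<sigma> v (Y r w) + (\<epsilon> / 3 + C1 * ?D w)"
                using C1(2)[OF Y_bounded[OF w] Y_bounded[OF w], of s r] unfolding mixed_generator_diag by linarith
              also have "generator b \<sigma> v (Y r w) \<le> \<alpha> * v (Y r w) + \<beta>"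
                unfolding Yr using gen[OF w _ True] r st by simp
              finally show ?thesis using ind by linarith
            next
              case False
              \<comment> \<open>From \<open>\<theta> w \<le> r < t \<le> T\<close> the path has come
                to rest before \<open>T\<close>, so the boundary inequality is available off
                \<open>N\<close>.\<close>
              have Yr: "Y r w = X (\<theta> w) w" using False r st by (simp add: Y_eq[OF w])
              have "0 \<le> \<alpha> * v (Y r w) + \<beta> + c * indicator N w"
              proof (cases "w \<in> N")
                case True
                then show ?thesis using c(2)[OF Y_bounded[OF w], of r] by simp
              next
                case nN: False
                then show ?thesis using N(2)[OF w nN] False r st by (simp add: Yr)
              qed
              then show ?thesis using False d0 \<epsilon> by (simp add: f_def)
            qed
            then show ?thesis using key by (simp add: distrib_right)
          qed
          have iD: "integrable M ?D" by (rule Y_increment_integrable)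
          have iN: "integrable M (indicator N :: 'w \<Rightarrow> real)"
            using N(1) by (intro integrable_real_indicator) (auto simp: emeasure_eq_measure)
          have iv: "integrable M (\<lambda>w. v (Y s w))" by (rule Y_compose_integrable[OF cv])
          have "expectation (\<lambda>w. f w r) \<le> expectation (\<lambda>w. \<alpha> * v (Y s w) + \<beta> + c * indicator N w + 2 * \<epsilon> / 3 + (C1 + C2) * ?D w)"
          proof (rule integral_mono)
            have "(\<lambda>w. f w r) \<in> borel_measurable M" using measurable_Pair1[OF fm, of r] by simp
            then show "integrable M (\<lambda>w. f w r)" by (rule abs_expectation_le(1)) (rule fb)
            show "integrable M (\<lambda>w. \<alpha> * v (Y s w) + \<beta> + c * indicator N w + 2 * \<epsilon> / 3 + (C1 + C2) * ?D w)"
              using iD iN iv by (intro Bochner_Integration.integrable_add integrable_mult_right integrable_const)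
          qed (rule pw)
          also have "\<dots> = \<alpha> * ?u s + \<beta> + c * prob N + 2 * \<epsilon> / 3 + (C1 + C2) * expectation ?D"
            using iD iN iv N(1) by (simp add: prob_space)
          also have "\<dots> \<le> k"
          proof -
            have "expectation ?D \<le> C * (r - s)" using C(2)[of s r] st r by (simp add: norm_minus_commute)
            also have "\<dots> \<le> C * (t - s)" using C(1) r by (intro mult_left_mono) auto
            finally have "(C1 + C2) * expectation ?D \<le> (C1 + C2) * (C * (t - s))"
              using C1 C2 by (intro mult_left_mono) auto
            then show ?thesis by (simp add: k_def)
          qed
          finally show ?thesis using True by simp
        qed
      qed
      also have "\<dots> = (t - s) * k" using st by simp
      finally have "expectation (generator_integral v s t) \<le> (t - s) * k" .
      then have "?u t - ?u s \<le> (t - s) * k + (t - s) * (\<epsilon> / 3 + C0 * (t - s))"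
        using C0(2)[OF st] by linarith
      also have "\<dots> = (t - s) * (\<alpha> * ?u s + (\<beta> + c * prob N) + \<epsilon> + (C0 + (C1 + C2) * C) * (t - s))"
      proof -
        have "(t - s) * k + (t - s) * (\<epsilon> / 3 + C0 * (t - s)) = (t - s) * (k + \<epsilon> / 3 + C0 * (t - s))"
          by (simp add: distrib_left)
        also have "k + \<epsilon> / 3 + C0 * (t - s) = \<alpha> * ?u s + (\<beta> + c * prob N) + \<epsilon> + (C0 + (C1 + C2) * C) * (t - s)"
          by (simp add: k_def distrib_right)
        finally show ?thesis .
      qed
      finally show "?u t - ?u s \<le> (t - s) * (\<alpha> * ?u s + (\<beta> + c * prob N) + \<epsilon> + (C0 + (C1 + C2) * C) * (t - s))" .
    qed
  qed
  then show ?thesis unfolding u0 .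
qed

end

section \<open>Exit times\<close>

text \<open>Reduces the hitting of a closed set to countably many times, which makes exit times
  measurable. One direction picks a rational time shortly after a hit, with \<open>p\<close> itself
  covering a hit at the very end; in the other, the distance attains its minimum on the compact
  interval.\<close>

lemma exists_in_closed_iff_rational_approx:
  fixes x :: "real \<Rightarrow> 'a::heine_borel"
  assumes x: "continuous_on {0..p} x" and p: "0 \<le> p" and C: "closed C" "C \<noteq> {}"
  shows "(\<exists>t\<in>{0..p}. x t \<in> C) \<longleftrightarrow> (\<forall>n. \<exists>q\<in>insert p (\<rat> \<inter> {0..p}). infdist (x q) C < 1 / real (Suc n))"
proof
  let ?d = "\<lambda>t. infdist (x t) C"
  have d: "continuous_on {0..p} ?d" by (intro continuous_intros x)
  show "\<forall>n. \<exists>q\<in>insert p (\<rat> \<inter> {0..p}). ?d q < 1 / real (Suc n)" if "\<exists>t\<in>{0..p}. x t \<in> C"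
  proof
    fix n
    obtain t where t: "t \<in> {0..p}" "x t \<in> C" using \<open>\<exists>t\<in>{0..p}. x t \<in> C\<close> by blast
    have t0: "?d t = 0" using t by simp
    show "\<exists>q\<in>insert p (\<rat> \<inter> {0..p}). ?d q < 1 / real (Suc n)"
    proof (cases "t = p")
      case True
      then show ?thesis using t0 by (intro bexI[of _ p]) auto
    next
      case False
      have "0 < 1 / real (Suc n)" by simp
      then obtain \<delta> where \<delta>: "0 < \<delta>" "\<And>t'. t' \<in> {0..p} \<Longrightarrow> dist t' t < \<delta> \<Longrightarrow> dist (?d t') (?d t) < 1 / real (Suc n)"
        using d t(1) unfolding continuous_on_iff by metis
      have "t < min p (t + \<delta>)" using False t \<delta> by auto
      then obtain q where q: "q \<in> \<rat>" "t < q" "q < min p (t + \<delta>)" using Rats_dense_in_real by blast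
      then have "dist (?d q) (?d t) < 1 / real (Suc n)" using t by (intro \<delta>(2)) (auto simp: dist_real_def)
      then have "?d q < 1 / real (Suc n)" unfolding t0 dist_real_def using infdist_nonneg[of "x q" C] by linarith
      then show ?thesis using q t by (intro bexI[of _ q]) auto
    qed
  qed
  show "\<exists>t\<in>{0..p}. x t \<in> C" if a: "\<forall>n. \<exists>q\<in>insert p (\<rat> \<inter> {0..p}). ?d q < 1 / real (Suc n)"
  proof -
    obtain m where m: "m \<in> {0..p}" "\<And>t. t \<in> {0..p} \<Longrightarrow> ?d m \<le> ?d t"
      using continuous_attains_inf[OF _ _ d] p by auto
    have le: "?d m \<le> 1 / real (Suc n)" for n
    proof -
      obtain q where "q \<in> insert p (\<rat> \<inter> {0..p})" "?d q < 1 / real (Suc n)" using a by blast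
      then show ?thesis using m(2)[of q] p by auto
    qed
    have "?d m \<le> 0"
      by (rule LIMSEQ_le_const[OF LIMSEQ_Suc[OF lim_1_over_n]]) (use le in auto)
    then have "?d m = 0" using infdist_nonneg[of "x m" C] by linarith
    then show ?thesis using in_closed_iff_infdist_zero[OF C] m(1) by blast
  qed
qed

text \<open>Inserting \<open>r\<close> keeps the set nonempty and assigns \<open>r\<close> to paths
  that do not leave \<open>U\<close>. By continuity the set is closed and contains its infimum,
  whence the alternative that the path is outside \<open>U\<close> at \<open>e\<close> or
  \<open>e = r\<close>.\<close>

lemma first_exit:
  fixes x :: "real \<Rightarrow> 'a::topological_space"
  assumes x: "continuous_on {0..r} x" and r: "0 \<le> r" and U: "open U"
  defines "e \<equiv> Inf (insert r {p\<in>{0..r}. x p \<notin> U})"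
  shows "0 \<le> e" "e \<le> r" "\<And>p. 0 \<le> p \<Longrightarrow> p < e \<Longrightarrow> x p \<in> U" "e = r \<or> x e \<notin> U"
    "\<And>p. p < r \<Longrightarrow> e \<le> p \<longleftrightarrow> (\<exists>t\<in>{0..p}. x t \<notin> U)"
proof -
  let ?A = "insert r {p\<in>{0..r}. x p \<notin> U}"
  have "closed ({0..r} \<inter> x -` (- U))"
    using U by (intro continuous_closed_preimage[OF x]) auto
  moreover have "?A = insert r ({0..r} \<inter> x -` (- U))" by auto
  ultimately have cl: "closed ?A" by simp
  have bdd: "bdd_below ?A" using r by (intro bdd_belowI[of _ 0]) auto
  have eA: "e \<in> ?A" unfolding e_def by (rule closed_contains_Inf[OF _ bdd cl]) simp
  show "0 \<le> e" "e \<le> r" using eA r by auto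
  have low: "e \<le> p" if "p \<in> ?A" for p unfolding e_def by (rule cInf_lower[OF that bdd])
  show "x p \<in> U" if "0 \<le> p" "p < e" for p
    using low[of p] that \<open>e \<le> r\<close> by force
  show "e = r \<or> x e \<notin> U" using eA by auto
  show "e \<le> p \<longleftrightarrow> (\<exists>t\<in>{0..p}. x t \<notin> U)" if "p < r" for p
  proof
    assume "e \<le> p"
    then have "x e \<notin> U" using eA that by auto
    then show "\<exists>t\<in>{0..p}. x t \<notin> U" using \<open>e \<le> p\<close> \<open>0 \<le> e\<close> by auto
  next
    assume "\<exists>t\<in>{0..p}. x t \<notin> U"
    then obtain t where "t \<in> {0..p}" "x t \<notin> U" by blast
    then show "e \<le> p" using low[of t] that by auto
  qed
qed

context wiener
begin

text \<open>For \<open>p < T\<close>, exit by time \<open>p\<close> means that \<rho> has passed or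
  that the path has left \<open>U\<close> within \<open>{0..p}\<close>. Unless \<rho> has passed,
  the path is defined on all of \<open>{0..p}\<close>, and the second event can be tested at
  countably many times by variables known at time \<open>p\<close>.\<close>

lemma exit_time:
  fixes X :: "real \<Rightarrow> 'w \<Rightarrow> 'a::euclidean_space"
  assumes U: "open U" "U \<noteq> UNIV" and T: "0 \<le> T"
    and rho: "\<And>w. w \<in> space M \<Longrightarrow> 0 \<le> \<rho> w \<and> ereal (\<rho> w) < life w" "stopping_time F \<rho>"
    and X: "\<And>w. w \<in> space M \<Longrightarrow> continuous_on {t. 0 \<le> t \<and> ereal t < life w} (\<lambda>t. X t w)"
    and Xm: "\<And>t. 0 \<le> t \<Longrightarrow> (\<lambda>w. if ereal t < life w then X t w else 0) \<in> borel_measurable (F t)"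
  defines "\<theta> \<equiv> \<lambda>w. Inf (insert (min T (\<rho> w)) {p\<in>{0..min T (\<rho> w)}. X p w \<notin> U})"
  shows "\<And>w. w \<in> space M \<Longrightarrow> 0 \<le> \<theta> w" "\<And>w. w \<in> space M \<Longrightarrow> \<theta> w \<le> min T (\<rho> w)"
    "\<And>w p. w \<in> space M \<Longrightarrow> 0 \<le> p \<Longrightarrow> p < \<theta> w \<Longrightarrow> X p w \<in> U"
    "\<And>w. w \<in> space M \<Longrightarrow> \<theta> w = min T (\<rho> w) \<or> X (\<theta> w) w \<notin> U"
    "\<And>p. 0 \<le> p \<Longrightarrow> {w\<in>space M. \<theta> w \<le> p} \<in> sets (F p)"
    "\<And>s. 0 \<le> s \<Longrightarrow> (\<lambda>w. X (min s (\<theta> w)) w) \<in> borel_measurable (F s)"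
proof -
  have cont: "continuous_on {0..min T (\<rho> w)} (\<lambda>t. X t w)" if w: "w \<in> space M" for w
  proof (rule continuous_on_subset[OF X[OF w]])
    show "{0..min T (\<rho> w)} \<subseteq> {t. 0 \<le> t \<and> ereal t < life w}"
    proof
      fix t assume "t \<in> {0..min T (\<rho> w)}"
      then have t: "0 \<le> t" "ereal t \<le> ereal (\<rho> w)" by auto
      from le_less_trans[OF t(2) rho(1)[OF w, THEN conjunct2]] t(1)
      show "t \<in> {t. 0 \<le> t \<and> ereal t < life w}" by simp
    qed
  qed
  have r0: "0 \<le> min T (\<rho> w)" if w: "w \<in> space M" for w using rho(1)[OF w] T by simp
  have fe: "0 \<le> \<theta> w" "\<theta> w \<le> min T (\<rho> w)" "\<And>p. 0 \<le> p \<Longrightarrow> p < \<theta> w \<Longrightarrow> X p w \<in> U"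
    "\<theta> w = min T (\<rho> w) \<or> X (\<theta> w) w \<notin> U"
    "\<And>p. p < min T (\<rho> w) \<Longrightarrow> \<theta> w \<le> p \<longleftrightarrow> (\<exists>t\<in>{0..p}. X t w \<notin> U)" if w: "w \<in> space M" for w
    using first_exit[OF cont[OF w] r0[OF w] U(1)] unfolding \<theta>_def by blast+
  show th: "0 \<le> \<theta> w" "\<theta> w \<le> min T (\<rho> w)" "\<And>p. 0 \<le> p \<Longrightarrow> p < \<theta> w \<Longrightarrow> X p w \<in> U"
    "\<theta> w = min T (\<rho> w) \<or> X (\<theta> w) w \<notin> U" if w: "w \<in> space M" for w
    using fe(1-4)[OF w] by blast+
  have lt: "ereal t < life w" if "w \<in> space M" "t \<le> \<theta> w" for t w
  proof -
    have "ereal t \<le> ereal (\<rho> w)" using th(2)[OF that(1)] that(2) by simp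
    from this rho(1)[OF that(1), THEN conjunct2] show ?thesis by (rule le_less_trans)
  qed
  have Xm': "(\<lambda>w. if ereal q < life w then X q w else 0) \<in> borel_measurable (F p)" if "0 \<le> q" "q \<le> p" for q p
    by (rule measurable_F_mono[OF Xm[OF that(1)] that(2)])
  show stop: "{w\<in>space M. \<theta> w \<le> p} \<in> sets (F p)" if p: "0 \<le> p" for p
  proof (cases "T \<le> p")
    case True
    then have "{w\<in>space M. \<theta> w \<le> p} = space (F p)" using th(2) by force
    then show ?thesis by (simp only: sets.top)
  next
    case False
    let ?Q = "insert p (\<rat> \<inter> {0..p})"
    \<comment> \<open>The default \<open>0\<close> beyond the lifetime makes this adapted. It can
      take effect only if \<open>\<rho> w \<le> p\<close>, and then the event has occurred
      anyway.\<close>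
    let ?h = "\<lambda>q w. infdist (if ereal q < life w then X q w else 0) (- U)"
    have R: "{w\<in>space (F p). \<rho> w \<le> p} \<in> sets (F p)"
      using rho(2) unfolding stopping_time_def pred_def by blast
    have hm: "(\<lambda>w. ?h q w) \<in> borel_measurable (F p)" if "q \<in> ?Q" for q
      using that p by (intro measurable_compose[OF Xm' borel_measurable_continuous_onI] continuous_intros) auto
    have B1: "{w\<in>space (F p). ?h q w < 1 / real (Suc n)} \<in> sets (F p)" if "q \<in> ?Q" for q n
      by (rule borel_measurable_less[OF hm[OF that] borel_measurable_const])
    define G where "G w \<longleftrightarrow> (\<forall>n. \<exists>q\<in>?Q. ?h q w < 1 / real (Suc n))" for w
    have "countable ?Q" by (simp add: countable_rat countable_Int1)
    then have "(\<Union>q\<in>?Q. {w\<in>space (F p). ?h q w < 1 / real (Suc n)}) \<in> sets (F p)" for n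
      by (rule sets.countable_UN''[OF _ B1])
    moreover have "{w\<in>space (F p). \<exists>q\<in>?Q. ?h q w < 1 / real (Suc n)} = (\<Union>q\<in>?Q. {w\<in>space (F p). ?h q w < 1 / real (Suc n)})" for n
      by blast
    ultimately have B: "{w\<in>space (F p). G w} \<in> sets (F p)"
      unfolding G_def by (intro sets.sets_Collect_countable_All) simp
    have "\<theta> w \<le> p \<longleftrightarrow> \<rho> w \<le> p \<or> G w" if w: "w \<in> space M" for w
    proof (cases "\<rho> w \<le> p")
      case True
      then show ?thesis using th(2)[OF w] by simp
    next
      case nr: False
      have pl: "ereal q < life w" if "q \<le> p" for q
      proof -
        have "ereal q < ereal (\<rho> w)" using that nr by simp
        from this rho(1)[OF w, THEN conjunct2] show ?thesis by (rule less_trans)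
      qed
      have "\<theta> w \<le> p \<longleftrightarrow> (\<exists>t\<in>{0..p}. X t w \<notin> U)"
        using fe(5)[OF w, of p] nr False by simp
      also have "\<dots> \<longleftrightarrow> (\<exists>t\<in>{0..p}. X t w \<in> - U)" by simp
      also have "\<dots> \<longleftrightarrow> (\<forall>n. \<exists>q\<in>?Q. infdist (X q w) (- U) < 1 / real (Suc n))"
        using U p pl by (intro exists_in_closed_iff_rational_approx continuous_on_subset[OF X[OF w]]) auto
      also have "\<dots> \<longleftrightarrow> (\<forall>n. \<exists>q\<in>?Q. ?h q w < 1 / real (Suc n))"
        using pl by (intro all_cong1 bex_cong refl) auto
      finally show ?thesis using nr unfolding G_def by blast
    qed
    then have "{w\<in>space M. \<theta> w \<le> p} = {w\<in>space (F p). \<rho> w \<le> p} \<union> {w\<in>space (F p). G w}"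
      by auto
    then show ?thesis using sets.Un[OF R B] by simp
  qed
  fix s :: real assume s: "0 \<le> s"
  have mth: "(\<lambda>w. min s (\<theta> w)) \<in> borel_measurable (F s)"
    unfolding borel_measurable_iff_le space_wiener_filtration
  proof
    fix p :: real
    consider "s \<le> p" | "p < 0" | "0 \<le> p" "p < s" by linarith
    then show "{w \<in> space M. min s (\<theta> w) \<le> p} \<in> sets (F s)"
    proof cases
      case 1
      then have "{w \<in> space M. min s (\<theta> w) \<le> p} = space (F s)" by auto
      then show ?thesis by (simp only: sets.top)
    next
      case 2
      then have "{w \<in> space M. min s (\<theta> w) \<le> p} = {}" using th(1) s by force
      then show ?thesis by (simp only: sets.empty_sets)
    next
      case 3
      then have "{w \<in> space M. min s (\<theta> w) \<le> p} = {w \<in> space M. \<theta> w \<le> p}" by auto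
      then show ?thesis using stop[OF 3(1)] sets_F_mono[of p s] 3 by auto
    qed
  qed
  define g where "g n w = real_of_int \<lfloor>real (Suc n) * min s (\<theta> w)\<rfloor> / real (Suc n)" for n w
  \<comment> \<open>The default cases make each \<open>f n k\<close> measurable with respect to
    \<open>F s\<close>; at the index obtained by rounding \<open>min s (\<theta> w)\<close> down
    they never apply.\<close>
  define f where "f n k w = (if 0 \<le> k \<and> real_of_int k / real (Suc n) \<le> s then
      (if ereal (real_of_int k / real (Suc n)) < life w then X (real_of_int k / real (Suc n)) w else 0) else 0)" for n :: nat and k w
  show "(\<lambda>w. X (min s (\<theta> w)) w) \<in> borel_measurable (F s)"
  proof (rule borel_measurable_LIMSEQ_metric)
    fix n
    show "(\<lambda>w. f n \<lfloor>real (Suc n) * min s (\<theta> w)\<rfloor> w) \<in> borel_measurable (F s)"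
    proof (rule measurable_compose_countable)
      show "f n k \<in> borel_measurable (F s)" for k
      proof (cases "0 \<le> k \<and> real_of_int k / real (Suc n) \<le> s")
        case True
        then have "f n k = (\<lambda>w. if ereal (real_of_int k / real (Suc n)) < life w then X (real_of_int k / real (Suc n)) w else 0)"
          by (auto simp: f_def)
        then show ?thesis using True by (simp only:) (intro Xm', auto)
      next
        case False
        then have "f n k = (\<lambda>w. 0)" by (auto simp: f_def)
        then show ?thesis by simp
      qed
      show "(\<lambda>w. \<lfloor>real (Suc n) * min s (\<theta> w)\<rfloor>) \<in> F s \<rightarrow>\<^sub>M count_space UNIV"
        using mth by measurable
    qed
  next
    fix w assume "w \<in> space (F s)"
    then have w: "w \<in> space M" by simp
    let ?m = "min s (\<theta> w)"
    have m0: "0 \<le> ?m" using s th(1)[OF w] by simp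
    have gb: "0 \<le> g n w" "g n w \<le> ?m" for n
    proof -
      have "0 \<le> real (Suc n) * ?m" using m0 by (intro mult_nonneg_nonneg) auto
      then have "0 \<le> \<lfloor>real (Suc n) * ?m\<rfloor>" by linarith
      then show "0 \<le> g n w" by (simp add: g_def)
      show "g n w \<le> ?m" unfolding g_def by (rule floor_grid(1))
    qed
    have fX: "f n \<lfloor>real (Suc n) * ?m\<rfloor> w = X (g n w) w" for n
    proof -
      have "ereal (g n w) < life w" by (rule lt[OF w]) (use gb(2)[of n] in auto)
      moreover have "0 \<le> \<lfloor>real (Suc n) * ?m\<rfloor>" using m0 by simp
      moreover have "g n w \<le> s" using gb(2)[of n] by simp
      ultimately show ?thesis by (simp add: f_def g_def del: of_nat_Suc)
    qed
    have glim: "(\<lambda>n. g n w) \<longlonglongrightarrow> ?m" unfolding g_def by (rule floor_grid(2))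
    show "(\<lambda>n. f n \<lfloor>real (Suc n) * ?m\<rfloor> w) \<longlonglongrightarrow> X ?m w"
      unfolding fX
    proof (rule continuous_on_tendsto_compose[OF X[OF w] glim])
      show "?m \<in> {t. 0 \<le> t \<and> ereal t < life w}" using m0 lt[OF w, of ?m] by simp
      show "\<forall>\<^sub>F n in sequentially. g n w \<in> {t. 0 \<le> t \<and> ereal t < life w}"
      proof (rule always_eventually, rule allI)
        fix n
        have "g n w \<le> \<theta> w" using gb(2)[of n] by simp
        then show "g n w \<in> {t. 0 \<le> t \<and> ereal t < life w}" using gb(1)[of n] lt[OF w] by simp
      qed
    qed
  qed
qed

end

section \<open>The reach-avoid bound\<close>

text \<open>Locates the exit points of a path in \<open>D - S\<close>: a limit of points of the open
  set \<open>D\<close> outside it lies on its frontier, and a point of \<open>S\<close> approached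
  from outside \<open>S\<close> lies on the frontier of \<open>S\<close>.\<close>

lemma closure_Diff_frontier:
  assumes "open D" "x \<in> closure (D - S)" "x \<notin> D - S"
  shows "x \<in> frontier D \<or> x \<in> S \<and> x \<in> frontier S"
proof (cases "x \<in> D")
  case False
  have "x \<in> closure D" using assms(2) closure_mono[of "D - S" D] by auto
  then show ?thesis using False assms(1) by (simp add: frontier_def interior_open)
next
  case True
  then have "x \<in> S" using assms(3) by simp
  moreover have "x \<in> closure (- S)" using assms(2) closure_mono[of "D - S" "- S"] by auto
  ultimately show ?thesis using closure_subset[of S] by (auto simp: frontier_def closure_complement)
qed

text \<open>Infinitely many announcing times before \<open>T\<close> force, by monotonicity, all of
  them and hence the lifetime to be at most \<open>T\<close>. If the path is bounded up to each of
  these, it is bounded up to the lifetime, which contradicts explosion.\<close>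

lemma frequently_bounded_imp_not_explosive:
  fixes x :: "real \<Rightarrow> 'a::real_normed_vector" and r :: "nat \<Rightarrow> real"
  assumes r: "incseq r" "(\<lambda>j. ereal (r j)) \<longlonglongrightarrow> L" and rL: "\<And>j. 0 \<le> r j \<and> ereal (r j) < L"
    and freq: "\<exists>\<^sub>F j in sequentially. r j < T \<and> (\<forall>t\<in>{0..<r j}. norm (x t) \<le> R)"
  shows "L < \<infinity>" "Limsup (at_left (real_of_ereal L)) (\<lambda>t. ereal (norm (x t))) \<noteq> \<infinity>"
proof -
  have ex: "\<exists>j\<ge>m. r j < T \<and> (\<forall>t\<in>{0..<r j}. norm (x t) \<le> R)" for m
    using freq unfolding frequently_sequentially by blast
  have rT: "r m \<le> T" for m
  proof -
    obtain j where "m \<le> j" "r j < T" using ex by blast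
    then show ?thesis using incseqD[OF r(1), of m j] by simp
  qed
  have "L \<le> ereal T" by (rule LIMSEQ_le_const2[OF r(2)]) (use rT in auto)
  then show "L < \<infinity>" by auto
  moreover have "0 < L"
  proof -
    have "ereal 0 \<le> ereal (r 0)" using rL[of 0] by simp
    from le_less_trans[OF this rL[of 0, THEN conjunct2]] show ?thesis by (simp add: zero_ereal_def)
  qed
  ultimately obtain l where l: "L = ereal l" "0 < l" by (cases L) auto
  \<comment> \<open>Any time before the lifetime is exceeded by all late announcing times, hence by
    one of those up to which the bound is known.\<close>
  have bd: "norm (x t) \<le> R" if t: "0 \<le> t" "t < l" for t
  proof -
    have "\<forall>\<^sub>F j in sequentially. ereal t < ereal (r j)" using r(2) l t by (intro order_tendstoD(1)[OF r(2)]) simp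
    then obtain m where m: "\<And>j. m \<le> j \<Longrightarrow> t < r j" unfolding eventually_sequentially by auto
    obtain j where "m \<le> j" "\<forall>t\<in>{0..<r j}. norm (x t) \<le> R" using ex by blast
    then show ?thesis using m[of j] t by auto
  qed
  have "\<forall>\<^sub>F t in at_left l. ereal (norm (x t)) \<le> ereal R"
    using eventually_at_left_real[OF l(2)] by eventually_elim (use bd in auto)
  then have "Limsup (at_left l) (\<lambda>t. ereal (norm (x t))) \<le> ereal R" by (rule Limsup_bounded)
  then show "Limsup (at_left (real_of_ereal L)) (\<lambda>t. ereal (norm (x t))) \<noteq> \<infinity>" using l by auto
qed

theorem corollary2:
  fixes b :: "real ^ 'n \<Rightarrow> real ^ 'n"
    and \<sigma> :: "real ^ 'n \<Rightarrow> real ^ 'k ^ 'n"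
    and M :: "'w measure"
    and W :: "real \<Rightarrow> 'w \<Rightarrow> real ^ 'k"
    and X :: "real ^ 'n \<Rightarrow> real \<Rightarrow> 'w \<Rightarrow> real ^ 'n"
    and life :: "real ^ 'n \<Rightarrow> 'w \<Rightarrow> ereal"
    and D S :: "(real ^ 'n) set"
    and T \<alpha> \<beta> :: real
    and v :: "real ^ 'n \<Rightarrow> real"
  assumes "locally_lipschitz b" and "locally_lipschitz \<sigma>"
    and "prob_space M" and "standard_wiener_process M W"
    and "\<And>x0. maximal_local_strong_solution M W b \<sigma> x0 (X x0) (life x0)"
    and "open D" and "bounded D" and "closed S" and "S \<subseteq> D"
    and "0 < T"
    and "twice_continuously_differentiable v"
    and "\<And>x. x \<in> D - S \<Longrightarrow> generator b \<sigma> v x \<le> \<alpha> * v x + \<beta>"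
    and "\<And>x. x \<in> frontier D \<union> frontier S \<Longrightarrow> 0 \<le> \<alpha> * v x + \<beta>"
    and "\<And>x. x \<in> closure (D - S) \<Longrightarrow> v x \<ge> indicator (frontier S) x"
  shows "\<forall>x0 \<in> D - S.
    reach_avoid_probability M (X x0) (life x0) D S T \<le>
      (if \<alpha> = 0 then v x0 + \<beta> * T
       else exp (\<alpha> * T) * v x0 + \<beta> / \<alpha> * (exp (\<alpha> * T) - 1))"
proof
  fix x0 assume x0: "x0 \<in> D - S"
  interpret prob_space M by fact
  interpret wiener M W by unfold_locales fact
  note v = assms(11)
  let ?U = "D - S" and ?X = "X x0" and ?L = "life x0"
  let ?B = "\<lambda>\<beta>. if \<alpha> = 0 then v x0 + \<beta> * T else exp (\<alpha> * T) * v x0 + \<beta> / \<alpha> * (exp (\<alpha> * T) - 1)"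
  \<comment> \<open>Since \<open>D\<close> is bounded, the complement of \<open>D - S\<close> is
    nonempty, and distances to it detect the exit.\<close>
  have U: "open ?U" "?U \<noteq> UNIV"
    using assms(6-8) not_bounded_UNIV bounded_subset[OF assms(7), of "D - S"] by (auto intro: open_Diff)
  have sol: "local_strong_solution M W b \<sigma> x0 ?X ?L"
    and explode: "AE w in M. ?L w < \<infinity> \<longrightarrow> Limsup (at_left (real_of_ereal (?L w))) (\<lambda>t. ereal (norm (?X t w))) = \<infinity>"
    using assms(5)[of x0] unfolding maximal_local_strong_solution_def by blast+
  have X0: "\<And>w. w \<in> space M \<Longrightarrow> ?X 0 w = x0"
    and contX: "\<And>w. w \<in> space M \<Longrightarrow> continuous_on {t. 0 \<le> t \<and> ereal t < ?L w} (\<lambda>t. ?X t w)"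
    and Xm: "\<And>t. 0 \<le> t \<Longrightarrow> (\<lambda>w. if ereal t < ?L w then ?X t w else 0) \<in> borel_measurable (F t)"
    using sol unfolding local_strong_solution_def Let_def by blast+
  obtain \<rho> :: "nat \<Rightarrow> 'w \<Rightarrow> real" where rho: "\<And>j. stopping_time F (\<rho> j)"
    "\<And>j w. w \<in> space M \<Longrightarrow> 0 \<le> \<rho> j w \<and> ereal (\<rho> j w) < ?L w"
    "AE w in M. incseq (\<lambda>j. \<rho> j w) \<and> (\<lambda>j. ereal (\<rho> j w)) \<longlonglongrightarrow> ?L w"
    and ito: "\<And>j. \<exists>I. has_ito_integral M F W (\<lambda>s w. if s \<le> \<rho> j w then \<sigma> (?X s w) else 0) I \<and>
           (AE w in M. \<forall>t\<ge>0. ?X (min t (\<rho> j w)) w = x0 + integral {0..min t (\<rho> j w)} (\<lambda>s. b (?X s w)) + I t w)"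
    using sol unfolding local_strong_solution_def Let_def by blast
  have "bounded (closure D)" using assms(7) by (rule bounded_closure)
  then obtain R where R: "0 < R" "\<And>y. y \<in> closure D \<Longrightarrow> norm y \<le> R" unfolding bounded_pos by blast
  define \<theta> where "\<theta> j w = Inf (insert (min T (\<rho> j w)) {p\<in>{0..min T (\<rho> j w)}. ?X p w \<notin> ?U})" for j w
  have T0: "0 \<le> T" using assms(10) by simp
  note ex = exit_time[OF U T0 rho(2) rho(1) contX Xm, folded \<theta>_def]
  have th: "0 \<le> \<theta> j w" "\<theta> j w \<le> min T (\<rho> j w)" "\<And>p. 0 \<le> p \<Longrightarrow> p < \<theta> j w \<Longrightarrow> ?X p w \<in> ?U"
    "\<theta> j w = min T (\<rho> j w) \<or> ?X (\<theta> j w) w \<notin> ?U" if w: "w \<in> space M" for j w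
    by (rule ex(1-4); (assumption | rule w))+
  have stop: "{w\<in>space M. \<theta> j w \<le> p} \<in> sets (F p)" if "0 \<le> p" for p j
    by (rule ex(5); (assumption | rule that))
  have adapted: "(\<lambda>w. ?X (min s (\<theta> j w)) w) \<in> borel_measurable (F s)" if "0 \<le> s" for s j
    by (rule ex(6); (assumption | rule that))
  have cont: "continuous_on {0..\<theta> j w} (\<lambda>r. ?X r w)" if w: "w \<in> space M" for j w
  proof (rule continuous_on_subset[OF contX[OF w]])
    show "{0..\<theta> j w} \<subseteq> {t. 0 \<le> t \<and> ereal t < ?L w}"
    proof
      fix t assume "t \<in> {0..\<theta> j w}"
      then have t: "0 \<le> t" "ereal t \<le> ereal (\<rho> j w)" using th(2)[OF w, of j] by auto
      from le_less_trans[OF t(2) rho(2)[OF w, THEN conjunct2]] t(1)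
      show "t \<in> {t. 0 \<le> t \<and> ereal t < ?L w}" by simp
    qed
  qed
  have clU: "?X r w \<in> closure ?U" if w: "w \<in> space M" and r: "0 \<le> r" "r \<le> \<theta> j w" for j w r
  \<comment> \<open>If the exit time is \<open>0\<close> then the half-open interval is empty and
    its closure carries no information; the starting point in \<open>D - S\<close> is used
    instead.\<close>
  proof (cases "\<theta> j w = 0")
    case True
    then show ?thesis using r X0[OF w] x0 closure_subset[of ?U] by auto
  next
    case False
    then have c: "closure {0..<\<theta> j w} = {0..\<theta> j w}" using th(1)[OF w, of j] by simp
    have "(\<lambda>r. ?X r w) ` closure {0..<\<theta> j w} \<subseteq> closure ?U"
      by (rule image_closure_subset) (use cont[OF w, of j] c th(3)[OF w, of _ j] closure_subset[of ?U] in auto)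
    then show ?thesis using c r by auto
  qed
  have front: "?X (\<theta> j w) w \<in> frontier D \<or> ?X (\<theta> j w) w \<in> S \<and> ?X (\<theta> j w) w \<in> frontier S"
    if "w \<in> space M" "?X (\<theta> j w) w \<notin> ?U" for j w
    using closure_Diff_frontier[OF assms(6) clU[OF that(1) th(1)[OF that(1)] order_refl] that(2)] .
  \<comment> \<open>The outcomes on which the announcing time cuts the path off inside
    \<open>D - S\<close> before \<open>T\<close>; only these escape the boundary inequality.\<close>
  define N where "N j = {w\<in>space M. \<theta> j w < T \<and> ?X (\<theta> j w) w \<in> ?U}" for j
  have theta_meas: "\<theta> j \<in> borel_measurable M" for j by (rule stop_measurable[OF th(1) stop])
  have Xth: "(\<lambda>w. ?X (\<theta> j w) w) \<in> borel_measurable M" for j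
  proof -
    have "min T (\<theta> j w) = \<theta> j w" if "w \<in> space M" for w using th(2)[OF that, of j] by simp
    then show ?thesis using measurable_F_imp[OF adapted[OF T0, of j]] by (simp cong: measurable_cong)
  qed
  have Nm: "N j \<in> sets M" for j
  proof -
    have "N j = {w\<in>space M. \<theta> j w < T} \<inter> ((\<lambda>w. ?X (\<theta> j w) w) -` ?U \<inter> space M)" by (auto simp: N_def)
    then show ?thesis using theta_meas[of j] measurable_sets[OF Xth[of j], of ?U] U(1) by auto
  qed
  have "bounded ((\<lambda>y. \<alpha> * v y + \<beta>) ` cball 0 R)"
    by (intro compact_imp_bounded compact_continuous_image continuous_intros
        continuous_on_subset[OF continuous_function[OF v]]) auto
  \<comment> \<open>Bounds the violation of \<open>0 \<le> \<alpha> * v + \<beta>\<close> at a point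
    of rest inside \<open>D - S\<close>, so that the cut-off costs at most
    \<open>c * prob (N j)\<close> in \<beta>.\<close>
  then obtain c where c: "0 < c" "\<And>y. norm y \<le> R \<Longrightarrow> \<bar>\<alpha> * v y + \<beta>\<bar> \<le> c" unfolding bounded_pos by auto
  have v0: "0 \<le> v y" if "y \<in> closure ?U" for y
    by (rule order_trans[OF indicator_pos_le assms(14)[OF that]])
  have bound: "measure M {w \<in> space M. \<exists>t\<in>{0..T}. ereal t < ?L w \<and> ?X t w \<in> S \<and> (\<forall>\<tau>\<in>{0..<t}. ?X \<tau> w \<in> D)}
      \<le> ?B (\<beta> + c * prob (N j)) + prob (N j)" \<comment> \<open>if the event is not measurable, its \<open>measure\<close> is \<open>0\<close>\<close> (is "measure M ?reach \<le> _") for j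
  proof -
    obtain I where I: "has_ito_integral M F W (\<lambda>s w. if s \<le> \<rho> j w then \<sigma> (?X s w) else 0) I"
      "AE w in M. \<forall>t\<ge>0. ?X (min t (\<rho> j w)) w = x0 + integral {0..min t (\<rho> j w)} (\<lambda>s. b (?X s w)) + I t w"
      using ito by blast
    interpret SD: stopped_diffusion M W b \<sigma> ?X "\<theta> j" "\<rho> j" I x0 R T
    proof
      show "continuous_on UNIV b" "continuous_on UNIV \<sigma>"
        using assms(1,2) by (simp_all add: locally_lipschitz_continuous)
      show "norm (?X r w) \<le> R" if "w \<in> space M" "0 \<le> r" "r \<le> \<theta> j w" for w r
        using clU[OF that] closure_mono[of ?U D] by (intro R(2)) auto
    qed (use R T0 I th stop cont adapted in auto)
    have YT: "SD.Y T w = ?X (\<theta> j w) w" if "w \<in> space M" for w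
      using SD.Y_eq[OF that T0] th(2)[OF that, of j] by simp
    have clT: "SD.Y T w \<in> closure ?U" if "w \<in> space M" for w
      unfolding YT[OF that] using th(1)[OF that] by (intro clU[OF that]) auto
    have E: "expectation (\<lambda>w. v (SD.Y T w)) \<le> ?B (\<beta> + c * prob (N j))"
    proof (rule SD.expectation_barrier_le[OF v assms(10)])
      show "generator b \<sigma> v (?X r w) \<le> \<alpha> * v (?X r w) + \<beta>" if "w \<in> space M" "0 \<le> r" "r < \<theta> j w" for w r
        by (rule assms(12)[OF th(3)[OF that]])
      show "0 \<le> \<alpha> * v (?X (\<theta> j w) w) + \<beta>" if "w \<in> space M" "w \<notin> N j" "\<theta> j w < T" for w
        using front[of w j] that by (intro assms(13)) (auto simp: N_def)
      show "- c \<le> \<alpha> * v y + \<beta>" if "norm y \<le> R" for y using c(2)[OF that] by (simp add: abs_le_iff)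
    qed (use Nm c(1) X0 in auto)
    have iv: "integrable M (\<lambda>w. v (SD.Y T w))" by (rule SD.Y_compose_integrable[OF continuous_function[OF v]])
    have iN: "integrable M (indicator (N j) :: 'w \<Rightarrow> real)"
      using Nm by (intro integrable_real_indicator) (auto simp: emeasure_eq_measure)
    have "measure M ?reach \<le> expectation (\<lambda>w. v (SD.Y T w)) + prob (N j)"
    proof (cases "?reach \<in> sets M")
      case False
      have "0 \<le> expectation (\<lambda>w. v (SD.Y T w))" using v0[OF clT] by (intro integral_nonneg_AE) auto
      then show ?thesis using False by (simp add: measure_notin_sets)
    next
      case True
      have "measure M ?reach = expectation (indicator ?reach)" using True by simp
      also have "\<dots> \<le> expectation (\<lambda>w. v (SD.Y T w) + indicator (N j) w)"
      proof (rule integral_mono)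
        show "integrable M (indicator ?reach :: 'w \<Rightarrow> real)"
          using True by (intro integrable_real_indicator) (auto simp: emeasure_eq_measure)
        show "integrable M (\<lambda>w. v (SD.Y T w) + indicator (N j) w)" using iv iN by (rule Bochner_Integration.integrable_add)
        fix w assume w: "w \<in> space M"
        have vY: "0 \<le> v (SD.Y T w)" by (rule v0[OF clT[OF w]])
        show "indicator ?reach w \<le> v (SD.Y T w) + indicator (N j) w"
        proof (cases "w \<in> ?reach \<and> w \<notin> N j")
          case False
          then show ?thesis using vY by (auto simp: indicator_def)
        next
          case True
          then obtain t where t: "0 \<le> t" "t \<le> T" "?X t w \<in> S" "\<And>\<tau>. 0 \<le> \<tau> \<Longrightarrow> \<tau> < t \<Longrightarrow> ?X \<tau> w \<in> D" by auto
          have "\<theta> j w \<le> t" using th(3)[OF w t(1), of j] t(3) by force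
          have nN: "\<not> (\<theta> j w < T \<and> ?X (\<theta> j w) w \<in> ?U)" using True w by (auto simp: N_def)
          \<comment> \<open>The path is stopped no later than its arrival in \<open>S\<close> at
            time \<open>t\<close>. If it is stopped earlier, it is still in \<open>D\<close> at that
            moment but, off \<open>N j\<close>, not in \<open>D - S\<close>; hence it is in
            \<open>S\<close>.\<close>
          have inS: "?X (\<theta> j w) w \<in> S"
          proof (cases "\<theta> j w = t")
            case True
            then show ?thesis using t by simp
          next
            case False
            then have "\<theta> j w < t" using \<open>\<theta> j w \<le> t\<close> by simp
            then show ?thesis using nN t(2) t(4)[OF th(1)[OF w]] by auto
          qed
          \<comment> \<open>\<open>S\<close> lies in the open set \<open>D\<close> and so misses the
            frontier of \<open>D\<close>. The exit point is thus on the frontier of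
            \<open>S\<close>, where \<open>v\<close> is at least \<open>1\<close>.\<close>
          then have "?X (\<theta> j w) w \<in> frontier S"
            using front[OF w, of j] assms(6,9) by (auto simp: frontier_def interior_open)
          then have "1 \<le> v (SD.Y T w)" using assms(14)[OF clT[OF w]] by (simp add: YT[OF w])
          then show ?thesis by (auto simp: indicator_def)
        qed
      qed
      also have "\<dots> = expectation (\<lambda>w. v (SD.Y T w)) + prob (N j)"
        using iv iN Nm by simp
      finally show ?thesis .
    qed
    then show ?thesis using E by linarith
  qed
  \<comment> \<open>Almost surely only finitely many \<open>N j\<close> occur, since otherwise the
    path would stay bounded up to a finite lifetime.\<close>
  have "(\<lambda>j. expectation (indicator (N j))) \<longlonglongrightarrow> expectation (\<lambda>_. 0 :: real)"
  proof (rule integral_dominated_convergence[where w="\<lambda>_. 1"])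
    show "AE w in M. (\<lambda>j. indicator (N j) w :: real) \<longlonglongrightarrow> 0"
      using rho(3) explode AE_space
    proof eventually_elim
      case (elim w)
      have ev: "\<forall>\<^sub>F j in sequentially. w \<notin> N j"
      proof (rule ccontr)
        assume "\<not> (\<forall>\<^sub>F j in sequentially. w \<notin> N j)"
        then have fr: "\<exists>\<^sub>F j in sequentially. w \<in> N j" by (simp add: frequently_def)
        have "\<exists>\<^sub>F j in sequentially. \<rho> j w < T \<and> (\<forall>t\<in>{0..<\<rho> j w}. norm (?X t w) \<le> R)"
        proof (rule frequently_elim1[OF fr])
          fix j assume "w \<in> N j"
          \<comment> \<open>On \<open>N j\<close> the path has not left \<open>D - S\<close>, so the
            exit time is the announcing time, and the path lies in \<open>D\<close> until
            then.\<close>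
          then have "\<theta> j w < T" "\<theta> j w = min T (\<rho> j w)" using th(4)[OF elim(3), of j] by (auto simp: N_def)
          then have r: "\<theta> j w = \<rho> j w" "\<rho> j w < T" by (auto simp: min_def split: if_splits)
          have "norm (?X t w) \<le> R" if "t \<in> {0..<\<rho> j w}" for t
            using th(3)[OF elim(3), of t j] that r closure_subset[of D] by (intro R(2)) auto
          then show "\<rho> j w < T \<and> (\<forall>t\<in>{0..<\<rho> j w}. norm (?X t w) \<le> R)" using r by blast
        qed
        from frequently_bounded_imp_not_explosive[OF _ _ rho(2)[OF elim(3)] this]
        show False using elim(1,2) by blast
      qed
      have "\<forall>\<^sub>F j in sequentially. 0 = (indicator (N j) w :: real)"
        using ev by eventually_elim simp
      then show ?case by (rule Lim_transform_eventually[OF tendsto_const])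
    qed
  qed (use Nm in \<open>auto simp: indicator_def\<close>)
  then have pN: "(\<lambda>j. prob (N j)) \<longlonglongrightarrow> 0" using Nm by simp
  have "(\<lambda>j. ?B (\<beta> + c * prob (N j)) + prob (N j)) \<longlonglongrightarrow> ?B \<beta>"
  proof (cases "\<alpha> = 0")
    case True
    have "(\<lambda>j. v x0 + (\<beta> + c * prob (N j)) * T + prob (N j)) \<longlonglongrightarrow> v x0 + (\<beta> + c * 0) * T + 0"
      by (intro tendsto_intros pN)
    then show ?thesis using True by simp
  next
    case False
    have "(\<lambda>j. exp (\<alpha> * T) * v x0 + (\<beta> + c * prob (N j)) / \<alpha> * (exp (\<alpha> * T) - 1) + prob (N j)) \<longlonglongrightarrow>
      exp (\<alpha> * T) * v x0 + (\<beta> + c * 0) / \<alpha> * (exp (\<alpha> * T) - 1) + 0"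
      by (intro tendsto_intros pN) (use False in auto)
    then show ?thesis using False by simp
  qed
  then show "reach_avoid_probability M ?X ?L D S T \<le> ?B \<beta>"
    unfolding reach_avoid_probability_def
    by (rule LIMSEQ_le_const) (use bound in auto)
qed

end
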